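(* Let $\mathbf{\Sigma}$ be a normalized irreducible incommensurable random substitution system in $\mathbb{R}^d$ with prototiles $(T_1,\ldots,T_n)$. Let $S$ be a tile of legal type and scale, let $1\le r\le n$ and let $0\le a\le b\le 1$. Let $\mathbf{v}\in\mathbb{R}^n$ be a left Perron--Frobenius eigenvector of $V_{\mathbf{\Sigma}}$ and $\mathbf{1}=(1,\ldots,1)^T\in\mathbb{R}^n$. Then, as $t\to\infty$, $$\frac{\mathbb{E}\left[\#\{\text{tiles of type } r \text{ and volume in }[a,b]\text{ in } F^{\mathbf{\Sigma}}_t(S)\}\right]}{\mathrm{vol}(e^tS)}=\int_a^b\frac{\left[\mathbf{v}^TC_{\mathbf{\Sigma}}(x)\right]_r}{\mathbf{v}^TH_{\mathbf{\Sigma}}\mathbf{1}}\,dx+o(1),$$ $$\frac{\mathbb{E}\left[\mathrm{vol}\left(\bigcup\text{tiles of type } r \text{ and volume in }[a,b]\text{ in } F^{\mathbf{\Sigma}}_t(S)\right)\right]}{\mathrm{vol}(e^tS)}=\int_a^b\frac{\left[\mathbf{v}^TD_{\mathbf{\Sigma}}(x)\right]_r}{\mathbf{v}^TH_{\mathbf{\Sigma}}\mathbf{1}}\,dx+o(1),$$ independently of the type of $S$. In particular, as $t\to\infty$, $$\frac{\mathbb{E}\left[\#\{\text{tiles of type } r \text{ in } F^{\mathbf{\Sigma}}_t(S)\}\right]}{\mathrm{vol}(e^tS)}=\frac{\left[\mathbf{v}^T\left(S_{\mathbf{\Sigma}}-V_{\mathbf{\Sigma}}\right)\right]_r}{\mathbf{v}^TH_{\mathbf{\Sigma}}\mathbf{1}}+o(1),$$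 $$\frac{\mathbb{E}\left[\mathrm{vol}\left(\bigcup\text{tiles of type } r \text{ in } F^{\mathbf{\Sigma}}_t(S)\right)\right]}{\mathrm{vol}(e^tS)}=\frac{\left[\mathbf{v}^TH_{\mathbf{\Sigma}}\right]_r}{\mathbf{v}^TH_{\mathbf{\Sigma}}\mathbf{1}}+o(1).$$ In the non-random case (that is, when every prototile has exactly one substitution rule) the same formulas hold with the expectation symbols removed.
   Context: A tile in $\mathbb{R}^d$ is a labeled measurable set of positive Lebesgue measure (denoted $\mathrm{vol}$) whose boundary has measure zero. A random substitution system $\mathbf{\Sigma}$ in $\mathbb{R}^d$ consists of: a finite list of prototiles $\tau_{\mathbf{\Sigma}}=(T_1,\ldots,T_n)$; for each $T_i$, a number $\ell_i\in\mathbb{N}$ of substitution rules $\varrho_1(T_i),\ldots,\varrho_{\ell_i}(T_i)$, where $\varrho_k(T_i)$ is a partition of $T_i$ into isometric copies of the elements of a finite list $\omega_k(T_i)$ of substitution tiles, each of the form $\alpha T_j$ with $\alpha\in(0,1)$ and $1\le j\le n$; and a probability vector $\mathbf{p}_i=(p_{i,1},\ldots,p_{i,\ell_i})$ with $p_{i,k}>0$ and $\sum_k p_{i,k}=1$. Any (rescaled, isometric) copy of $T_j$ carries the label $j$ and is said to be of type $j$. The system is normalized if all prototiles have volume $1$. Lists are counted with multiplicity. Associated graph $G_{\mathbf{\Sigma}}$: the directed multigraph with vertices $\{1,\ldots,n\}$ which, for every $i$, every $1\le k\le \ell_i$ and every substitution tile $T\in\omega_k(T_i)$ of type $j$, has an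 edge from $i$ to $j$ of length $\log\frac{1}{\mathrm{vol}\,T}$. $\mathbf{\Sigma}$ is irreducible if $G_{\mathbf{\Sigma}}$ is strongly connected, and incommensurable if $G_{\mathbf{\Sigma}}$ contains two closed paths of lengths $a,b$ (sums of edge lengths) with $a\notin b\mathbb{Q}$. A tile of legal type and scale is a labeled tile $S$ that is a copy of $\alpha T_i$ for some $i$, with volume at most $1$. Random substitution semi-flow: for $t\ge 0$, $F_t^{\mathbf{\Sigma}}(S)$ is the random patch obtained from the inflated tile $e^tS$ by repeatedly substituting every tile whose volume is greater than $1$, until all tiles have volume at most $1$; each time a tile of type $i$ is substituted, an index $k$ is chosen with probability $p_{i,k}$, independently of all other substitutions, and the tile is partitioned according to the correspondingly rescaled (and moved by an isometry) copy of $\varrho_k(T_i)$. Matrices in $M_n(\mathbb{R})$ (inner sums are over tiles $T\in\omega_k(T_i)$ of type $j$): $$(S_{\mathbf{\Sigma}})_{ij}=\sum_{k=1}^{\ell_i}p_{i,k}\sum_{T}1,\quad (V_{\mathbf{\Sigma}})_{ij}=\sum_{k=1}^{\ell_i}p_{i,k}\sum_{T}\mathrm{vol}\,T,\quad (H_{\mathbf{\Sigma}})_{ij}=\sum_{k=1}^{\ell_i}p_{i,k}\sum_{T}-\mathrm{vol}\,T\cdot\log\mathrm{vol}\,T,$$ and matrix-valued functions of $x\in\mathbb{R}$: $$(C_{\mathbf{\Sigma}}(x))_{ij}=\sum_{k=1}^{\ell_i}p_{i,k}\sum_{T}c_{\mathrm{vol}\,T}(x),\quad (D_{\mathbf{\Sigma}}(x))_{ij}=\sum_{k=1}^{\ell_i}p_{i,k}\sum_{T}d_{\mathrm{vol}\,T}(x),$$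 where $c_{\mathrm{vol}\,T}(x)=\frac{\mathrm{vol}\,T}{x^2}$ and $d_{\mathrm{vol}\,T}(x)=\frac{\mathrm{vol}\,T}{x}$ if $\mathrm{vol}\,T<x\le 1$, and both are $0$ otherwise. The Perron--Frobenius eigenvalue of $V_{\mathbf{\Sigma}}$ is $1$ (with right eigenvector $\mathbf{1}$). $[\mathbf{w}]_r$ denotes the $r$-th entry of a vector $\mathbf{w}$. *)

theory Defs
  imports
    "HOL-Probability.Probability"
    "Graph_Theory.Digraph_Component"
    "Graph_Theory.Arc_Walk"
begin

section \<open>Random substitution systems\<close>

definition isometric_map :: "(real^('d::finite) \<Rightarrow> real^'d) \<Rightarrow> bool" where
  "isometric_map g \<longleftrightarrow> (\<forall>x y. dist (g x) (g y) = dist x y)"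

text \<open>The prototiles are indexed by a finite type \<open>'n\<close>, which plays the role of \<open>{1, \<dots>, n}\<close>;
  the index is at the same time the label (type) of the tile.

  The list \<open>rule \<Sigma> i k\<close> describes the partition of the \<open>i\<close>-th prototile by its \<open>k\<close>-th rule.
  An entry \<open>(j, \<alpha>, g)\<close> stands for the substitution tile \<open>\<alpha> T\<^sub>j\<close>, moved to its place by the
  isometry \<open>g\<close>.

  The probability vector of the \<open>i\<close>-th prototile is \<open>rule_pmf \<Sigma> i\<close>, so that
  \<open>p\<^sub>i\<^sub>,\<^sub>k = pmf (rule_pmf \<Sigma> i) k\<close>.\<close>

record ('d, 'n) rss =
  proto :: "'n \<Rightarrow> (real^'d) set"
  num_rules :: "'n \<Rightarrow> nat"
  rule :: "'n \<Rightarrow> nat \<Rightarrow> ('n \<times> real \<times> (real^'d \<Rightarrow> real^'d)) list"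
  rule_pmf :: "'n \<Rightarrow> nat pmf"

definition is_tile :: "(real^('d::finite)) set \<Rightarrow> bool" where
  "is_tile A \<longleftrightarrow> A \<in> lmeasurable \<and> 0 < measure lebesgue A \<and> negligible (frontier A)"

text \<open>Partitions are understood modulo null sets, so that closed tiles sharing boundary points,
  half-open tiles and open tiles are all covered.\<close>

definition is_partition :: "(real^('d::finite)) set \<Rightarrow> (real^'d) set list \<Rightarrow> bool" where
  "is_partition A As \<longleftrightarrow>
     (\<forall>l < length As. \<forall>m < length As. l \<noteq> m \<longrightarrow> negligible (As ! l \<inter> As ! m)) \<and>
     negligible (sym_diff A (\<Union>(set As)))"

text \<open>The condition on the support of \<open>rule_pmf \<Sigma> i\<close> says that \<open>p\<^sub>i\<^sub>,\<^sub>k > 0\<close> exactly for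
  \<open>1 \<le> k \<le> \<ell>\<^sub>i\<close>; that these numbers add up to 1 is part of the type \<open>pmf\<close>.\<close>

definition random_substitution_system :: "('d::finite, 'n) rss \<Rightarrow> bool" where
  "random_substitution_system \<Sigma> \<longleftrightarrow>
     (\<forall>i. is_tile (proto \<Sigma> i)) \<and>
     (\<forall>i. set_pmf (rule_pmf \<Sigma> i) = {1..num_rules \<Sigma> i}) \<and>
     (\<forall>i. \<forall>k \<in> {1..num_rules \<Sigma> i}.
        (\<forall>(j, \<alpha>, g) \<in> set (rule \<Sigma> i k). 0 < \<alpha> \<and> \<alpha> < 1 \<and> isometric_map g) \<and>
        is_partition (proto \<Sigma> i)
          (map (\<lambda>(j, \<alpha>, g). g ` ((*\<^sub>R) \<alpha> ` proto \<Sigma> j)) (rule \<Sigma> i k)))"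

definition normalized :: "('d::finite, 'n) rss \<Rightarrow> bool" where
  "normalized \<Sigma> \<longleftrightarrow> (\<forall>i. measure lebesgue (proto \<Sigma> i) = 1)"

definition subst_tiles :: "('d::finite, 'n) rss \<Rightarrow> 'n \<Rightarrow> nat \<Rightarrow> ('n \<times> (real^'d) set) list" where
  "subst_tiles \<Sigma> i k = map (\<lambda>(j, \<alpha>, g). (j, (*\<^sub>R) \<alpha> ` proto \<Sigma> j)) (rule \<Sigma> i k)"

text \<open>The arc \<open>(i, k, m)\<close> of the associated graph comes from the \<open>m\<close>-th substitution tile of the
  \<open>k\<close>-th rule of the \<open>i\<close>-th prototile.\<close>

definition assoc_graph :: "('d::finite, 'n) rss \<Rightarrow> ('n, 'n \<times> nat \<times> nat) pre_digraph" where
  "assoc_graph \<Sigma> =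
     \<lparr> verts = UNIV,
       arcs = {(i, k, m). k \<in> {1..num_rules \<Sigma> i} \<and> m < length (subst_tiles \<Sigma> i k)},
       tail = (\<lambda>(i, k, m). i),
       head = (\<lambda>(i, k, m). fst (subst_tiles \<Sigma> i k ! m)) \<rparr>"

definition arc_length :: "('d::finite, 'n) rss \<Rightarrow> 'n \<times> nat \<times> nat \<Rightarrow> real" where
  "arc_length \<Sigma> = (\<lambda>(i, k, m). ln (1 / measure lebesgue (snd (subst_tiles \<Sigma> i k ! m))))"

definition irreducible_system :: "('d::finite, 'n) rss \<Rightarrow> bool" where
  "irreducible_system \<Sigma> \<longleftrightarrow> strongly_connected (assoc_graph \<Sigma>)"

definition closed_path :: "('d::finite, 'n) rss \<Rightarrow> ('n \<times> nat \<times> nat) list \<Rightarrow> bool" where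
  "closed_path \<Sigma> p \<longleftrightarrow> p \<noteq> [] \<and> (\<exists>u. pre_digraph.awalk (assoc_graph \<Sigma>) u p u)"

definition path_length :: "('d::finite, 'n) rss \<Rightarrow> ('n \<times> nat \<times> nat) list \<Rightarrow> real" where
  "path_length \<Sigma> p = (\<Sum>e\<leftarrow>p. arc_length \<Sigma> e)"

definition incommensurable :: "('d::finite, 'n) rss \<Rightarrow> bool" where
  "incommensurable \<Sigma> \<longleftrightarrow>
     (\<exists>p q. closed_path \<Sigma> p \<and> closed_path \<Sigma> q \<and>
        path_length \<Sigma> p \<notin> {path_length \<Sigma> q * x | x. x \<in> \<rat>})"


section \<open>The random substitution semi-flow\<close>

text \<open>A placed tile \<open>(i, f)\<close> is a copy of the \<open>i\<close>-th prototile, moved by the similarity \<open>f\<close>. The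
  placement is recorded, and not only the resulting set, because it determines how the rules
  are transported to the tile. A patch is the list of its tiles, in irrelevant order.\<close>

type_synonym ('d, 'n) tile = "'n \<times> (real^'d \<Rightarrow> real^'d)"
type_synonym ('d, 'n) patch = "('d::finite, 'n) tile list"

definition region :: "('d::finite, 'n) rss \<Rightarrow> ('d, 'n) tile \<Rightarrow> (real^'d) set" where
  "region \<Sigma> T = snd T ` proto \<Sigma> (fst T)"

definition tile_vol :: "('d::finite, 'n) rss \<Rightarrow> ('d, 'n) tile \<Rightarrow> real" where
  "tile_vol \<Sigma> T = measure lebesgue (region \<Sigma> T)"

definition legal_tile :: "('d::finite, 'n) rss \<Rightarrow> ('d, 'n) tile \<Rightarrow> bool" where
  "legal_tile \<Sigma> T \<longleftrightarrow>
     (\<exists>\<alpha> g. 0 < \<alpha> \<and> isometric_map g \<and> snd T = (\<lambda>x. g (\<alpha> *\<^sub>R x))) \<and> tile_vol \<Sigma> T \<le> 1"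

definition inflate :: "real \<Rightarrow> ('d::finite, 'n) tile \<Rightarrow> ('d, 'n) tile" where
  "inflate c T = (fst T, \<lambda>x. c *\<^sub>R snd T x)"

definition apply_rule :: "('d::finite, 'n) rss \<Rightarrow> nat \<Rightarrow> ('d, 'n) tile \<Rightarrow> ('d, 'n) patch" where
  "apply_rule \<Sigma> k T = map (\<lambda>(j, \<alpha>, g). (j, \<lambda>x. snd T (g (\<alpha> *\<^sub>R x)))) (rule \<Sigma> (fst T) k)"

definition substitute_tile :: "('d::finite, 'n) rss \<Rightarrow> ('d, 'n) tile \<Rightarrow> ('d, 'n) patch pmf" where
  "substitute_tile \<Sigma> T =
     (if tile_vol \<Sigma> T > 1 then map_pmf (\<lambda>k. apply_rule \<Sigma> k T) (rule_pmf \<Sigma> (fst T))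
      else return_pmf [T])"

text \<open>One round substitutes simultaneously all tiles of volume greater than 1. Drawing the results
  for the individual tiles by successive \<open>bind_pmf\<close> makes the choices independent.\<close>

primrec substitute_patch :: "('d::finite, 'n) rss \<Rightarrow> ('d, 'n) patch \<Rightarrow> ('d, 'n) patch pmf" where
  "substitute_patch \<Sigma> [] = return_pmf []"
| "substitute_patch \<Sigma> (T # P) =
     bind_pmf (substitute_tile \<Sigma> T) (\<lambda>Q.
     bind_pmf (substitute_patch \<Sigma> P) (\<lambda>R. return_pmf (Q @ R)))"

primrec substitute_rounds ::
  "('d::finite, 'n) rss \<Rightarrow> nat \<Rightarrow> ('d, 'n) patch \<Rightarrow> ('d, 'n) patch pmf" where
  "substitute_rounds \<Sigma> 0 P = return_pmf P"
| "substitute_rounds \<Sigma> (Suc N) P = bind_pmf (substitute_rounds \<Sigma> N P) (substitute_patch \<Sigma>)"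

definition finished_after :: "('d::finite, 'n) rss \<Rightarrow> nat \<Rightarrow> ('d, 'n) patch \<Rightarrow> bool" where
  "finished_after \<Sigma> N P \<longleftrightarrow>
     (\<forall>Q \<in> set_pmf (substitute_rounds \<Sigma> N P). \<forall>T \<in> set Q. tile_vol \<Sigma> T \<le> 1)"

text \<open>The class \<open>wellorder\<close> on the coordinate type of \<open>\<real>\<^sup>d\<close>, which the library requires in its
  change of variables results, is no restriction: \<open>{1, \<dots>, d}\<close> is well-ordered.\<close>

definition similarity_map :: "real \<Rightarrow> (real^('d::finite) \<Rightarrow> real^'d) \<Rightarrow> bool" where
  "similarity_map c f \<longleftrightarrow> (\<forall>x y. dist (f x) (f y) = c * dist x y)"

lemma measure_similarity_image:
  fixes f :: "real^'d::{finite,wellorder} \<Rightarrow> real^'d::_"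
  assumes c: "c > 0" and f: "similarity_map c f" and A: "A \<in> lmeasurable"
  shows "measure lebesgue (f ` A) = c ^ CARD('d) * measure lebesgue A"
proof -
  define h where "h x = f (x /\<^sub>R c) - f 0" for x
  have h: "orthogonal_transformation h"
    unfolding orthogonal_transformation_isometry
  proof (intro conjI allI)
    show "h 0 = 0" by (simp add: h_def)
    fix x y
    have "dist (h x) (h y) = dist (f (x /\<^sub>R c)) (f (y /\<^sub>R c))"
      by (simp add: h_def dist_norm)
    also have "\<dots> = c * dist (x /\<^sub>R c) (y /\<^sub>R c)"
      using f by (simp add: similarity_map_def)
    also have "\<dots> = dist x y"
      using c by (simp add: dist_norm flip: scaleR_diff_right)
    finally show "dist (h x) (h y) = dist x y" .
  qed
  have sc: "measure lebesgue ((*\<^sub>R) c ` A) = c ^ CARD('d) * measure lebesgue A"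
    using measure_lebesgue_affine[of c 0 A] c by simp
  have "f ` A = (\<lambda>x. f 0 + h (c *\<^sub>R x)) ` A"
    by (rule image_cong) (use c in \<open>simp_all add: h_def\<close>)
  then have "f ` A = (+) (f 0) ` h ` (*\<^sub>R) c ` A" by (simp only: image_image)
  moreover have "(*\<^sub>R) c ` A \<in> lmeasurable"
    by (rule measurable_linear_image) (auto simp: A)
  ultimately show ?thesis
    by (simp only: measure_translation measure_orthogonal_image[OF h] sc)
qed

lemma set_substitute_patch:
  assumes "Q \<in> set_pmf (substitute_patch \<Sigma> P)" "T \<in> set Q"
  shows "\<exists>T' \<in> set P. \<exists>R \<in> set_pmf (substitute_tile \<Sigma> T'). T \<in> set R"
  using assms by (induction P arbitrary: Q) fastforce+

lemma ex_finished_after: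
  fixes \<Sigma> :: "('d::{finite,wellorder}, 'n::finite) rss"
  assumes \<Sigma>: "random_substitution_system \<Sigma>" and S: "legal_tile \<Sigma> S"
  shows "\<exists>N. finished_after \<Sigma> N [inflate (exp t) S]"
proof -
  define X where "X = (\<Union>i. \<Union>k \<in> {1..num_rules \<Sigma> i}. (fst \<circ> snd) ` set (rule \<Sigma> i k))"
  define \<beta> where "\<beta> = Max (insert (1/2) X)"
  have finX: "finite X" by (auto simp: X_def)
  have scale: "0 < \<alpha> \<and> \<alpha> \<le> \<beta> \<and> isometric_map g"
    if "k \<in> {1..num_rules \<Sigma> i}" "(j, \<alpha>, g) \<in> set (rule \<Sigma> i k)" for i k j \<alpha> g
  proof -
    have "\<alpha> \<in> X" using that unfolding X_def by force
    then have "\<alpha> \<le> \<beta>" using finX by (simp add: \<beta>_def)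
    moreover have "0 < \<alpha> \<and> isometric_map g"
      using that \<Sigma> unfolding random_substitution_system_def by fast
    ultimately show ?thesis by blast
  qed
  have "\<forall>\<alpha>\<in>X. \<alpha> < 1" using \<Sigma> unfolding X_def random_substitution_system_def by fastforce
  then have \<beta>1: "\<beta> < 1" using finX by (simp add: \<beta>_def)
  have "1/2 \<le> \<beta>" unfolding \<beta>_def by (rule Max_ge) (use finX in auto)
  then have \<beta>0: "0 < \<beta>" by simp
  obtain c\<^sub>0 g\<^sub>0 where c0: "c\<^sub>0 > 0" "isometric_map g\<^sub>0" "snd S = (\<lambda>x. g\<^sub>0 (c\<^sub>0 *\<^sub>R x))"
    using S by (auto simp: legal_tile_def)
  define K where "K = exp t * c\<^sub>0"
  have K: "K > 0" using c0 by (simp add: K_def)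
  have inv: "tile_vol \<Sigma> T \<le> 1 \<or> (\<exists>c > 0. c \<le> K * \<beta> ^ N \<and> similarity_map c (snd T))"
    if "Q \<in> set_pmf (substitute_rounds \<Sigma> N [inflate (exp t) S])" "T \<in> set Q" for N Q T
    using that
  proof (induction N arbitrary: Q T)
    case 0
    have "similarity_map K (snd (inflate (exp t) S))"
      unfolding similarity_map_def
    proof (intro allI)
      fix x y
      have "dist (snd (inflate (exp t) S) x) (snd (inflate (exp t) S) y)
            = exp t * dist (g\<^sub>0 (c\<^sub>0 *\<^sub>R x)) (g\<^sub>0 (c\<^sub>0 *\<^sub>R y))"
        unfolding inflate_def c0(3) by (simp add: dist_norm flip: scaleR_diff_right)
      also have "\<dots> = exp t * dist (c\<^sub>0 *\<^sub>R x) (c\<^sub>0 *\<^sub>R y)"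
        using c0(2) by (simp only: isometric_map_def)
      also have "\<dots> = K * dist x y"
        using c0(1) by (simp add: K_def dist_norm flip: scaleR_diff_right)
      finally show "dist (snd (inflate (exp t) S) x) (snd (inflate (exp t) S) y) = K * dist x y" .
    qed
    then show ?case using 0 K by auto
  next
    case (Suc N)
    then obtain P where P: "P \<in> set_pmf (substitute_rounds \<Sigma> N [inflate (exp t) S])"
      "Q \<in> set_pmf (substitute_patch \<Sigma> P)" by auto
    from set_substitute_patch[OF P(2) Suc.prems(2)] obtain T' R where T':
      "T' \<in> set P" "R \<in> set_pmf (substitute_tile \<Sigma> T')" "T \<in> set R" by blast
    show ?case
    proof (cases "tile_vol \<Sigma> T' \<le> 1")
      case True
      then have "T = T'" using T'(2,3) by (simp add: substitute_tile_def)
      then show ?thesis using True by blast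
    next
      case False
      then obtain c where c: "c > 0" "c \<le> K * \<beta> ^ N" "similarity_map c (snd T')"
        using Suc.IH[OF P(1) T'(1)] by blast
      obtain k where k: "k \<in> set_pmf (rule_pmf \<Sigma> (fst T'))" "R = apply_rule \<Sigma> k T'"
        using T'(2) False by (auto simp: substitute_tile_def)
      have "set_pmf (rule_pmf \<Sigma> (fst T')) = {1..num_rules \<Sigma> (fst T')}"
        using \<Sigma> unfolding random_substitution_system_def by blast
      with k(1) have k': "k \<in> {1..num_rules \<Sigma> (fst T')}" by blast
      obtain j \<alpha> g where jag: "(j, \<alpha>, g) \<in> set (rule \<Sigma> (fst T') k)"
        "snd T = (\<lambda>x. snd T' (g (\<alpha> *\<^sub>R x)))"
        using T'(3) unfolding k(2) apply_rule_def by auto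
      have \<alpha>: "0 < \<alpha>" "\<alpha> \<le> \<beta>" "isometric_map g" using scale[OF k' jag(1)] by auto
      have "similarity_map (c * \<alpha>) (snd T)"
        unfolding similarity_map_def
      proof (intro allI)
        fix x y
        have "dist (snd T x) (snd T y) = c * dist (g (\<alpha> *\<^sub>R x)) (g (\<alpha> *\<^sub>R y))"
          using c(3) unfolding similarity_map_def jag(2) by blast
        also have "\<dots> = c * dist (\<alpha> *\<^sub>R x) (\<alpha> *\<^sub>R y)"
          using \<alpha>(3) by (simp only: isometric_map_def)
        also have "\<dots> = c * \<alpha> * dist x y"
          using \<alpha>(1) by (simp add: dist_norm flip: scaleR_diff_right)
        finally show "dist (snd T x) (snd T y) = c * \<alpha> * dist x y" .
      qed
      moreover have "c * \<alpha> \<le> (K * \<beta> ^ N) * \<beta>"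
        by (rule mult_mono) (use c \<alpha> K \<beta>0 in auto)
      ultimately show ?thesis
        using c(1) \<alpha>(1) by (intro disjI2 exI[of _ "c * \<alpha>"]) (auto simp: mult_ac)
    qed
  qed
  define M where "M = Max (range (\<lambda>i. measure lebesgue (proto \<Sigma> i)))"
  have M: "measure lebesgue (proto \<Sigma> i) \<le> M" for i by (simp add: M_def)
  have "(\<lambda>N. (K * \<beta> ^ N) ^ CARD('d) * M) \<longlonglongrightarrow> (K * 0) ^ CARD('d) * M"
    by (intro tendsto_intros LIMSEQ_realpow_zero) (use \<beta>0 \<beta>1 in auto)
  then have "(\<lambda>N. (K * \<beta> ^ N) ^ CARD('d) * M) \<longlonglongrightarrow> 0" by (simp add: power_0_left)
  then have "\<forall>\<^sub>F N in sequentially. (K * \<beta> ^ N) ^ CARD('d) * M < 1"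
    by (rule order_tendstoD) simp
  then obtain N where N: "(K * \<beta> ^ N) ^ CARD('d) * M < 1"
    by (auto simp: eventually_sequentially)
  have "tile_vol \<Sigma> T \<le> 1"
    if Q: "Q \<in> set_pmf (substitute_rounds \<Sigma> N [inflate (exp t) S])" "T \<in> set Q" for Q T
  proof (rule ccontr)
    assume "\<not> tile_vol \<Sigma> T \<le> 1"
    with inv[OF Q] obtain c where c: "c > 0" "c \<le> K * \<beta> ^ N" "similarity_map c (snd T)" by blast
    have lm: "proto \<Sigma> (fst T) \<in> lmeasurable"
      using \<Sigma> unfolding random_substitution_system_def is_tile_def by blast
    have "tile_vol \<Sigma> T = c ^ CARD('d) * measure lebesgue (proto \<Sigma> (fst T))"
      unfolding tile_vol_def region_def by (rule measure_similarity_image[OF c(1,3) lm])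
    also have "\<dots> \<le> (K * \<beta> ^ N) ^ CARD('d) * M"
      by (intro mult_mono power_mono M) (use c K \<beta>0 in auto)
    finally show False using N \<open>\<not> tile_vol \<Sigma> T \<le> 1\<close> by linarith
  qed
  then show ?thesis unfolding finished_after_def by blast
qed

text \<open>The distribution of the random patch \<open>F\<^sub>t(S)\<close>. A patch all of whose tiles have volume at most
  1 is not changed by further rounds, so it is harmless to perform the same number of rounds
  for every outcome. Such a number exists by \<open>ex_finished_after\<close>.\<close>

definition semiflow ::
  "('d::finite, 'n) rss \<Rightarrow> real \<Rightarrow> ('d, 'n) tile \<Rightarrow> ('d, 'n) patch pmf" where
  "semiflow \<Sigma> t S =
     (let P = [inflate (exp t) S]
      in substitute_rounds \<Sigma> (LEAST N. finished_after \<Sigma> N P) P)"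

definition tiles_in ::
  "('d::finite, 'n) rss \<Rightarrow> 'n \<Rightarrow> real set \<Rightarrow> ('d, 'n) patch \<Rightarrow> ('d, 'n) patch" where
  "tiles_in \<Sigma> r I P = filter (\<lambda>T. fst T = r \<and> tile_vol \<Sigma> T \<in> I) P"

definition num_tiles :: "('d::finite, 'n) rss \<Rightarrow> 'n \<Rightarrow> real set \<Rightarrow> ('d, 'n) patch \<Rightarrow> real" where
  "num_tiles \<Sigma> r I P = real (length (tiles_in \<Sigma> r I P))"

definition vol_tiles :: "('d::finite, 'n) rss \<Rightarrow> 'n \<Rightarrow> real set \<Rightarrow> ('d, 'n) patch \<Rightarrow> real" where
  "vol_tiles \<Sigma> r I P = measure lebesgue (\<Union>T \<in> set (tiles_in \<Sigma> r I P). region \<Sigma> T)"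


section \<open>Matrices\<close>

definition weighted_matrix ::
  "('d::finite, 'n::finite) rss \<Rightarrow> (real \<Rightarrow> real) \<Rightarrow> real^'n^'n" where
  "weighted_matrix \<Sigma> h =
     (\<chi> i j. \<Sum>k = 1..num_rules \<Sigma> i. pmf (rule_pmf \<Sigma> i) k *
        (\<Sum>T \<leftarrow> filter (\<lambda>T. fst T = j) (subst_tiles \<Sigma> i k). h (measure lebesgue (snd T))))"

definition S_mat :: "('d::finite, 'n::finite) rss \<Rightarrow> real^'n^'n" where
  "S_mat \<Sigma> = weighted_matrix \<Sigma> (\<lambda>v. 1)"

definition V_mat :: "('d::finite, 'n::finite) rss \<Rightarrow> real^'n^'n" where
  "V_mat \<Sigma> = weighted_matrix \<Sigma> (\<lambda>v. v)"

definition H_mat :: "('d::finite, 'n::finite) rss \<Rightarrow> real^'n^'n" where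
  "H_mat \<Sigma> = weighted_matrix \<Sigma> (\<lambda>v. - v * ln v)"

definition C_mat :: "('d::finite, 'n::finite) rss \<Rightarrow> real \<Rightarrow> real^'n^'n" where
  "C_mat \<Sigma> x = weighted_matrix \<Sigma> (\<lambda>v. if v < x \<and> x \<le> 1 then v / x^2 else 0)"

definition D_mat :: "('d::finite, 'n::finite) rss \<Rightarrow> real \<Rightarrow> real^'n^'n" where
  "D_mat \<Sigma> x = weighted_matrix \<Sigma> (\<lambda>v. if v < x \<and> x \<le> 1 then v / x else 0)"

text \<open>The Perron--Frobenius eigenvalue of a nonnegative matrix is its spectral radius.\<close>

definition perron_frobenius_eigenvalue :: "real^'n^('n::finite) \<Rightarrow> real" where
  "perron_frobenius_eigenvalue A =
     Sup {cmod z | z. \<exists>w :: complex^'n. w \<noteq> 0 \<and> (\<chi> i j. complex_of_real (A $ i $ j)) *v w = z *s w}"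

definition left_perron_frobenius_eigenvector :: "real^'n^('n::finite) \<Rightarrow> real^'n \<Rightarrow> bool" where
  "left_perron_frobenius_eigenvector A v \<longleftrightarrow>
     v \<noteq> 0 \<and> v v* A = perron_frobenius_eigenvalue A *s v"

end

theory Submission
  imports Defs
begin

text \<open>
  Let \<open>N\<^sub>i(u)\<close> be the expected number (or volume) of the tiles in question that arise from a tile of
  type \<open>i\<close> and volume \<open>e\<^sup>u\<close>. By linearity of expectation, \<open>f\<^sub>i(u) = e\<^sup>-\<^sup>u N\<^sub>i(u)\<close> satisfies, for \<open>u > 0\<close>,
  the renewal equation \<open>f\<^sub>i(u) = \<Sum>\<^sub>e q\<^sub>e f\<^sub>j(u - l\<^sub>e)\<close> over the arcs \<open>e\<close> from \<open>i\<close> to \<open>j = j(e)\<close> of the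
  associated graph, where \<open>l\<^sub>e\<close> is the length and \<open>q\<^sub>e = p\<^sub>e vol\<^sub>e\<close> sums to 1.

  A Lipschitz solution converges: where it is close to its limsup, it is so along all short paths,
  and by incommensurability the path lengths are eventually dense. This applies to the moving
  integrals of \<open>f\<close>. The limit is found from the conserved quantity
  \<open>\<Sum>\<^sub>e v\<^sub>i\<^sub>(\<^sub>e\<^sub>) q\<^sub>e \<integral> f\<^sub>j\<^sub>(\<^sub>e\<^sub>)\<close>, the integral being over \<open>[u - l\<^sub>e, u]\<close>. Finally \<open>f\<close> itself is bounded below by
  moving integrals for shrunken data, since small tiles survive a small inflation, and above by
  applying this to the complementary tiles.\<close>

section \<open>Renewal equations on a finite graph\<close>

text \<open>The obstacle is that \<open>f\<close> jumps: its data for \<open>u \<le> 0\<close> are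
  an indicator of volumes times \<open>1\<close> or \<open>exp (- u)\<close>, and the equation can
  carry jumps to late times, while the limsup argument needs a modulus of continuity that does not
  deteriorate. Averaging over a window of length \<open>h\<close> supplies one. The way back from
  averages to \<open>f\<close> uses monotonicity instead of regularity: an interval of logarithmic
  volumes shrunk by \<open>h\<close> stays inside the original under all shifts up to
  \<open>h\<close>, at a cost of order \<open>h\<close> in the limit.

  Summed over parallel arcs, the weights \<open>q\<close> give the matrix \<open>V_mat\<close>. It
  is stochastic, so \<open>v\<close> is a stationary vector; its constant sign follows from
  irreducibility. The conserved quantity is the stationary mass in transit on the arcs. For the
  constant solution 1 it is the sum of \<open>v q l\<close>, and \<open>q l = - p vol ln vol\<close>
  turns this into the denominator \<open>v \<bullet> (H_mat \<Sigma> *v 1)\<close>. At time 0 an arc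
  of length \<open>l\<close> sees the datum on \<open>[- l, 0]\<close>, that is, volumes between
  that of its tile and 1; with \<open>x = exp u\<close> this is the condition
  \<open>vol T < x \<le> 1\<close> in the density matrices.\<close>

text \<open>Dirichlet approximation yields a multiple \<open>x\<close> of \<alpha> and a multiple
  \<open>y\<close> of \<beta> at a positive distance \<delta> < \<eta>. Trading copies of the
  smaller for copies of the larger moves a sum in steps of \<delta>, and adding further copies of
  \<beta> covers all large \<open>s\<close>.\<close>

lemma irrational_combinations_dense:
  fixes \<alpha> \<beta> \<eta> :: real
  assumes pos: "\<alpha> > 0" "\<beta> > 0" and irr: "\<alpha> / \<beta> \<notin> \<rat>" and \<eta>: "\<eta> > 0"
  shows "\<forall>\<^sub>F s in at_top. \<exists>k m. s - \<eta> \<le> real k * \<alpha> + real m * \<beta> \<and> real k * \<alpha> + real m * \<beta> \<le> s"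
proof -
  \<comment> \<open>The approximation error is below \<open>\<beta> / N\<close>. The first bound
    makes it smaller than \<eta>; the second makes it smaller than \<alpha>, which forces
    \<open>h\<close> to be positive, as needed for combinations with natural coefficients.\<close>
  obtain N :: nat where N: "real N > max (\<beta> / \<eta>) (\<beta> / \<alpha>)"
    using reals_Archimedean2 by blast
  then have N0: "N > 0" using pos \<eta> by (metis divide_pos_pos max_less_iff_conj of_nat_0_less_iff order_less_trans)
  obtain h k :: int where hk: "0 < k" "k \<le> int N" "\<bar>of_int k * (\<alpha>/\<beta>) - of_int h\<bar> < 1 / N"
    using Dirichlet_approx[OF N0, of "\<alpha>/\<beta>"] by blast
  have small: "\<bar>of_int k * \<alpha> - of_int h * \<beta>\<bar> < \<beta> / N"
  proof -
    have "\<bar>of_int k * \<alpha> - of_int h * \<beta>\<bar> = \<beta> * \<bar>of_int k * (\<alpha>/\<beta>) - of_int h\<bar>"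
      using pos abs_mult_pos[of \<beta> "of_int k * (\<alpha>/\<beta>) - of_int h"] by (simp add: field_simps)
    also have "\<dots> < \<beta> * (1/N)" using hk(3) pos by (intro mult_strict_left_mono)
    finally show ?thesis by simp
  qed
  have "\<beta> / N < \<eta>" using N N0 \<eta> by (simp add: field_simps)
  have "\<beta> / N < \<alpha>" using N N0 pos by (simp add: field_simps)
  have "\<alpha> \<le> of_int k * \<alpha>" using hk pos by simp
  with small \<open>\<beta> / N < \<alpha>\<close> have "of_int h * \<beta> > 0" by linarith
  then have h0: "h > 0" using pos by (simp add: zero_less_mult_iff)
  define x where "x = real (nat k) * \<alpha>"
  define y where "y = real (nat h) * \<beta>"
  have xk: "x = of_int k * \<alpha>" "y = of_int h * \<beta>" using hk h0 by (simp_all add: x_def y_def)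
  have "x \<noteq> y"
  proof
    assume "x = y"
    then have "\<alpha> / \<beta> = of_int h / of_int k" using xk pos hk by (simp add: field_simps)
    then show False using irr by simp
  qed
  define \<delta> where "\<delta> = \<bar>x - y\<bar>"
  have \<delta>: "0 < \<delta>" "\<delta> < \<eta>" using \<open>x \<noteq> y\<close> small \<open>\<beta>/N < \<eta>\<close> by (auto simp: \<delta>_def xk)
  \<comment> \<open>\<open>T\<close> steps of length \<delta> span more than \<beta>, hence every
    remainder modulo \<beta>. The base point \<open>z\<close> consists of \<open>T\<close> copies of
    the smaller of \<open>x\<close> and \<open>y\<close>; replacing \<open>t\<close> of them gives
    \<open>z + t \<delta>\<close>.\<close>
  obtain T :: nat where T: "real T > \<beta> / \<delta>" using reals_Archimedean2 by blast
  define z where "z = real T * min x y"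
  show ?thesis unfolding eventually_at_top_linorder
  proof (rule exI[of _ z], intro allI impI)
    fix s assume s: "z \<le> s"
    define m where "m = nat \<lfloor>(s - z) / \<beta>\<rfloor>"
    have m: "real m * \<beta> \<le> s - z" "s - z < (real m + 1) * \<beta>"
    proof -
      have *: "real m = of_int \<lfloor>(s - z) / \<beta>\<rfloor>" using s pos by (simp add: m_def)
      show "real m * \<beta> \<le> s - z" "s - z < (real m + 1) * \<beta>"
        unfolding * using pos floor_divide_lower[of \<beta> "s - z"] floor_divide_upper[of \<beta> "s - z"] by auto
    qed
    define w where "w = s - z - real m * \<beta>"
    have w: "0 \<le> w" "w < \<beta>" using m by (auto simp: w_def algebra_simps)
    define t where "t = nat \<lfloor>w / \<delta>\<rfloor>"
    have t: "real t * \<delta> \<le> w" "w < (real t + 1) * \<delta>"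
    proof -
      have *: "real t = of_int \<lfloor>w / \<delta>\<rfloor>" using w \<delta> by (simp add: t_def)
      show "real t * \<delta> \<le> w" "w < (real t + 1) * \<delta>"
        unfolding * using \<delta> floor_divide_lower[of \<delta> w] floor_divide_upper[of \<delta> w] by auto
    qed
    have "\<beta> < real T * \<delta>" using T \<delta> by (simp add: field_simps)
    then have "real t * \<delta> < real T * \<delta>" using t w by linarith
    then have tT: "t \<le> T" using \<delta> by simp
    define u where "u = z + real t * \<delta>"
    have u: "s - \<eta> \<le> u + real m * \<beta>" "u + real m * \<beta> \<le> s"
      using t \<delta> by (auto simp: u_def w_def algebra_simps)
    have "\<exists>a b. u = real a * x + real b * y"
    proof (cases "x < y")
      case True
      then have "u = real (T - t) * x + real t * y"
        using tT by (simp add: u_def z_def \<delta>_def min_def of_nat_diff algebra_simps)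
      then show ?thesis by blast
    next
      case False
      then have "u = real t * x + real (T - t) * y"
        using tT by (simp add: u_def z_def \<delta>_def min_def of_nat_diff algebra_simps)
      then show ?thesis by blast
    qed
    then obtain a b where ab: "u = real a * x + real b * y" by blast
    have "real (a * nat k) * \<alpha> + real (b * nat h + m) * \<beta> = u + real m * \<beta>"
      unfolding ab by (simp add: x_def y_def algebra_simps)
    then show "\<exists>k m. s - \<eta> \<le> real k * \<alpha> + real m * \<beta> \<and> real k * \<alpha> + real m * \<beta> \<le> s"
      using u by (intro exI[of _ "a * nat k"] exI[of _ "b * nat h + m"]) linarith
  qed
qed

text \<open>The data of a Markov renewal process: from the state \<open>i\<close>, an arc
  \<open>e\<close> leaving \<open>i\<close> is taken with probability \<open>q e\<close> and lasts
  for the time \<open>l e\<close>.\<close>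

locale renewal =
  fixes E :: "'e set" and src tgt :: "'e \<Rightarrow> 'n::finite" and q l :: "'e \<Rightarrow> real"
  assumes finE: "finite E"
    and q_pos: "\<And>e. e \<in> E \<Longrightarrow> q e > 0"
    and l_pos: "\<And>e. e \<in> E \<Longrightarrow> l e > 0"
    and q_sum: "\<And>i. (\<Sum>e | e \<in> E \<and> src e = i. q e) = 1"
begin

text \<open>The arcs themselves are forgotten. The number of arcs controls the loss of weight along
  the path, and the length controls the shift of the argument.\<close>

inductive path :: "'n \<Rightarrow> nat \<Rightarrow> real \<Rightarrow> 'n \<Rightarrow> bool" where
  Nil: "path i 0 0 i"
| Cons: "e \<in> E \<Longrightarrow> path (tgt e) n s j \<Longrightarrow> path (src e) (Suc n) (l e + s) j"

lemma path_trans: "path i n s j \<Longrightarrow> path j n' s' j' \<Longrightarrow> path i (n + n') (s + s') j'"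
proof (induction rule: path.induct)
  case (Cons e n s j)
  then have "path (src e) (Suc (n + n')) (l e + (s + s')) j'" by (intro path.Cons) auto
  then show ?case by (simp add: add.assoc)
qed simp

lemma path_pow: "path i n s i \<Longrightarrow> path i (k * n) (real k * s) i"
proof (induction k)
  case 0 show ?case by (simp add: path.Nil)
next
  case (Suc k)
  from path_trans[OF Suc.prems Suc.IH[OF Suc.prems]] show ?case by (simp add: algebra_simps)
qed

lemma E_nonempty: "E \<noteq> {}"
  using q_sum[of undefined] by force

definition lmin :: real where "lmin = Min (l ` E)"
definition lmax :: real where "lmax = Max (l ` E)"
definition qmin :: real where "qmin = Min (q ` E)"

lemma lmin: "lmin > 0" "e \<in> E \<Longrightarrow> lmin \<le> l e"
  and lmax: "lmax > 0" "e \<in> E \<Longrightarrow> l e \<le> lmax"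
  and qmin: "qmin > 0" "e \<in> E \<Longrightarrow> qmin \<le> q e" "qmin \<le> 1"
proof -
  show a: "lmin > 0" "e \<in> E \<Longrightarrow> lmin \<le> l e" "qmin > 0" "e \<in> E \<Longrightarrow> qmin \<le> q e"
     "e \<in> E \<Longrightarrow> l e \<le> lmax" for e
    using finE E_nonempty l_pos q_pos unfolding lmin_def lmax_def qmin_def by auto
  obtain e where e: "e \<in> E" using E_nonempty by blast
  show "lmax > 0" using a(5)[OF e] l_pos[OF e] by linarith
  have "q e \<le> (\<Sum>e' | e' \<in> E \<and> src e' = src e. q e')"
    by (rule member_le_sum) (use e finE q_pos in \<open>auto intro: less_imp_le\<close>)
  then show "qmin \<le> 1" using a(4)[OF e] q_sum by simp
qed

lemma path_length_ge: "path i n s j \<Longrightarrow> real n * lmin \<le> s"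
proof (induction rule: path.induct)
  case (Cons e n s j)
  then show ?case using lmin(2)[of e] by (simp add: algebra_simps)
qed simp

text \<open>The threshold \<open>c\<close> is variable because moving integrals over a window of
  length \<open>h\<close> satisfy the equation only beyond \<open>h\<close>.\<close>

definition solves :: "real \<Rightarrow> ('n \<Rightarrow> real \<Rightarrow> real) \<Rightarrow> bool" where
  "solves c f \<longleftrightarrow> (\<forall>i u. u > c \<longrightarrow> f i u = (\<Sum>e | e \<in> E \<and> src e = i. q e * f (tgt e) (u - l e)))"

text \<open>Each arc lowers the argument by at least \<open>lmin > 0\<close>, so the region
  \<open>u \<le> c\<close> is reached after finitely many steps, whose number carries the
  induction.\<close>

lemma renewal_induct [case_names init step]:
  assumes init: "\<And>i u. u \<le> c \<Longrightarrow> P i u"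
    and step: "\<And>i u. u > c \<Longrightarrow> (\<And>e. e \<in> E \<Longrightarrow> src e = i \<Longrightarrow> P (tgt e) (u - l e)) \<Longrightarrow> P i u"
  shows "P i (u::real)"
proof -
  have "u \<le> c + real n * lmin \<Longrightarrow> P i u" for n i u
  proof (induction n arbitrary: i u)
    case 0 then show ?case by (simp add: init)
  next
    case (Suc n)
    show ?case
    proof (cases "u \<le> c")
      case False
      show ?thesis
      proof (rule step)
        fix e assume e: "e \<in> E"
        show "P (tgt e) (u - l e)" 
          by (rule Suc.IH) (use Suc.prems lmin(2)[OF e] in \<open>simp add: algebra_simps\<close>)
      qed (use False in simp)
    qed (rule init)
  qed
  moreover obtain n :: nat where "real n > (u - c) / lmin" using reals_Archimedean2 by blast
  then have "u \<le> c + real n * lmin" using lmin(1) by (simp add: field_simps)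
  ultimately show ?thesis by blast
qed

lemma avg_mono:
  assumes "\<And>e. e \<in> E \<Longrightarrow> src e = i \<Longrightarrow> x e \<le> y e"
  shows "(\<Sum>e | e \<in> E \<and> src e = i. q e * x e) \<le> (\<Sum>e | e \<in> E \<and> src e = i. q e * y e)"
  by (rule sum_mono) (use assms q_pos in \<open>auto intro!: mult_left_mono less_imp_le\<close>)

lemma avg_const: "(\<Sum>e | e \<in> E \<and> src e = i. q e * x) = x"
  using q_sum[of i] by (simp flip: sum_distrib_right)

text \<open>A minimum principle: each later value is an average of values at most
  \<open>lmax\<close> earlier, so a lower bound on one window of that length persists.\<close>

lemma solves_ge:
  assumes f: "solves c f" and w: "\<And>i u. u0 - lmax \<le> u \<Longrightarrow> u \<le> u0 \<Longrightarrow> f i u \<ge> m" and u0: "u0 \<ge> c"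
    and u: "u \<ge> u0 - lmax"
  shows "f i u \<ge> m"
proof -
  have "u \<ge> u0 - lmax \<longrightarrow> f i u \<ge> m"
  proof (induction i u rule: renewal_induct[where c = u0])
    case (step i u)
    have "m = (\<Sum>e | e \<in> E \<and> src e = i. q e * m)" by (simp add: avg_const)
    also have "\<dots> \<le> (\<Sum>e | e \<in> E \<and> src e = i. q e * f (tgt e) (u - l e))"
    proof (rule avg_mono)
      fix e assume e: "e \<in> E" "src e = i"
      show "m \<le> f (tgt e) (u - l e)" 
        using step(2)[OF e] step(1) lmax(2)[OF e(1)] by (cases "u0 - lmax \<le> u - l e") auto
    qed
    also have "\<dots> = f i u" using f step(1) u0 by (simp add: solves_def)
    finally show ?case by simp
  qed (use w in auto)
  then show ?thesis using u by blast
qed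

text \<open>The value of \<open>f\<close> at the start of the path is an average that gives its end at least the weight
  \<open>qmin\<^sup>n\<close>.\<close>

lemma path_defect:
  assumes f: "solves c f" and M: "\<And>i u. u \<ge> U \<Longrightarrow> f i u \<le> M" and U: "U \<ge> c"
  shows "path i n s j \<Longrightarrow> u - s \<ge> U + lmax \<Longrightarrow> M - f j (u - s) \<le> (M - f i u) / qmin ^ n"
proof (induction arbitrary: u rule: path.induct)
  case (Cons e n s j)
  have s0: "s \<ge> 0" using path_length_ge[OF Cons.hyps(2)] lmin(1)
    by (meson mult_nonneg_nonneg of_nat_0_le_iff order.strict_implies_order order_trans)
  have le: "l e > 0" "l e \<le> lmax" using l_pos lmax Cons.hyps by auto
  have uU: "u - lmax > U" using Cons.prems s0 le by linarith
  let ?A = "{e' \<in> E. src e' = src e}"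
  \<comment> \<open>As the weights at a vertex sum to 1, the defect \<open>M - f\<close> obeys the
    same equation. All its terms are nonnegative here, so each single one is bounded by the
    sum.\<close>
  have "M - f (src e) u = (\<Sum>e'\<in>?A. q e' * M) - (\<Sum>e'\<in>?A. q e' * f (tgt e') (u - l e'))"
    using f uU U lmax(1) by (simp add: solves_def avg_const)
  also have "\<dots> = (\<Sum>e'\<in>?A. q e' * (M - f (tgt e') (u - l e')))"
    by (simp add: sum_subtractf right_diff_distrib)
  finally have eq: "M - f (src e) u = (\<Sum>e'\<in>?A. q e' * (M - f (tgt e') (u - l e')))" .
  have nonneg: "0 \<le> M - f (tgt e') (u - l e')" if "e' \<in> E" for e'
    using M[of "u - l e'"] uU lmax(2)[OF that] by simp
  have "qmin * (M - f (tgt e) (u - l e)) \<le> q e * (M - f (tgt e) (u - l e))"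
    using nonneg qmin(2) Cons.hyps(1) by (intro mult_right_mono) auto
  also have "\<dots> \<le> M - f (src e) u"
    unfolding eq
    by (rule member_le_sum) (use Cons.hyps finE nonneg q_pos in \<open>auto intro!: mult_nonneg_nonneg simp: less_imp_le\<close>)
  finally have 1: "M - f (tgt e) (u - l e) \<le> (M - f (src e) u) / qmin"
    using qmin(1) by (simp add: field_simps)
  have "M - f j (u - l e - s) \<le> (M - f (tgt e) (u - l e)) / qmin ^ n"
    by (rule Cons.IH) (use Cons.prems in auto)
  also have "\<dots> \<le> (M - f (src e) u) / qmin / qmin ^ n"
    using 1 qmin(1) by (intro divide_right_mono) auto
  finally show ?case by (simp add: algebra_simps)
qed simp

end

section \<open>Convergence of Lipschitz solutions\<close>

locale nonlattice_renewal = renewal +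
  assumes connected: "\<exists>n s. path i n s j"
    and nonlattice: "\<exists>i j m n \<alpha> \<beta>. path i m \<alpha> i \<and> path j n \<beta> j \<and> \<alpha> > 0 \<and> \<beta> > 0 \<and> \<alpha> / \<beta> \<notin> \<rat>"
begin

text \<open>Paths run from \<open>i\<close> to the first cycle, around it \<open>a\<close> times, on
  to the second cycle, around it \<open>b\<close> times, and then to \<open>j\<close>. The three
  connecting pieces only translate the set of combinations of the two cycle lengths. Finiteness of
  the vertex set makes the threshold uniform.\<close>

lemma path_lengths_dense:
  assumes \<eta>: "\<eta> > 0"
  shows "\<forall>\<^sub>F s in at_top. \<forall>i j. \<exists>n t. path i n t j \<and> s - \<eta> \<le> t \<and> t \<le> s"
proof -
  obtain x y m n \<alpha> \<beta> where xy: "path x m \<alpha> x" "path y n \<beta> y" "\<alpha> > 0" "\<beta> > 0" "\<alpha> / \<beta> \<notin> \<rat>"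
    using nonlattice by blast
  have "\<forall>\<^sub>F s in at_top. \<exists>n t. path i n t j \<and> s - \<eta> \<le> t \<and> t \<le> s" for i j
  proof -
    obtain n1 s1 n2 s2 n3 s3 where p: "path i n1 s1 x" "path x n2 s2 y" "path y n3 s3 j"
      using connected by meson
    have "\<forall>\<^sub>F s in at_top. \<exists>k m. s - \<eta> \<le> real k * \<alpha> + real m * \<beta> \<and> real k * \<alpha> + real m * \<beta> \<le> s"
      by (rule irrational_combinations_dense) (use xy \<eta> in auto)
    then have "\<forall>\<^sub>F s in at_top. \<exists>k m. (- (s1 + s2 + s3) + s) - \<eta> \<le> real k * \<alpha> + real m * \<beta> \<and>
        real k * \<alpha> + real m * \<beta> \<le> (- (s1 + s2 + s3) + s)"
      by (rule eventually_compose_filterlim)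
         (rule filterlim_tendsto_add_at_top[OF tendsto_const filterlim_ident])
    then show ?thesis
    proof eventually_elim
      case (elim s)
      then obtain a b where ab: "(- (s1 + s2 + s3) + s) - \<eta> \<le> real a * \<alpha> + real b * \<beta>"
        "real a * \<alpha> + real b * \<beta> \<le> (- (s1 + s2 + s3) + s)" by blast
      have "path i (n1 + (a * m + (n2 + (b * n + n3)))) (s1 + (real a * \<alpha> + (s2 + (real b * \<beta> + s3)))) j"
        by (intro path_trans[OF p(1)] path_trans[OF path_pow[OF xy(1)]] path_trans[OF p(2)]
            path_trans[OF path_pow[OF xy(2)]] p(3))
      moreover have "s - \<eta> \<le> s1 + (real a * \<alpha> + (s2 + (real b * \<beta> + s3)))"
        "s1 + (real a * \<alpha> + (s2 + (real b * \<beta> + s3))) \<le> s" using ab by auto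
      ultimately show ?case by blast
    qed
  qed
  then have "\<forall>\<^sub>F s in at_top. \<forall>p\<in>UNIV. \<exists>n t. path (fst p) n t (snd p) \<and> s - \<eta> \<le> t \<and> t \<le> s"
    by (intro eventually_ball_finite) auto
  then show ?thesis by eventually_elim auto
qed

text \<open>The limit is the limsup \<open>M\<close>: near a point where \<open>f\<close> is almost \<open>M\<close>, the defect is small along
  all sufficiently short paths. Their lengths are dense, so \<open>f\<close> is almost \<open>M\<close> on a window of
  length \<open>lmax\<close>, and hence ever after, since it is an average of earlier values.\<close>

theorem lipschitz_solution_converges:
  assumes f: "solves c f" and bdd: "\<And>i u. \<bar>f i u\<bar> \<le> B"
    and lip: "\<And>i u s. \<bar>f i u - f i s\<bar> \<le> K * \<bar>u - s\<bar>"
  obtains M where "\<And>i. (f i \<longlongrightarrow> M) at_top"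
proof -
  define X where "X = {x. \<exists>U. \<forall>u\<ge>U. \<forall>i. f i u \<le> x}"
  define M where "M = Inf X"
  have "B \<in> X" using bdd unfolding X_def by (auto simp: abs_le_iff)
  have "- B \<le> x" if x: "x \<in> X" for x
  proof -
    obtain U where "\<forall>u\<ge>U. \<forall>i. f i u \<le> x" using x by (auto simp: X_def)
    then have "f undefined U \<le> x" by blast
    then show ?thesis using bdd[of undefined U] by linarith
  qed
  then have Xbdd: "bdd_below X" by (auto simp: bdd_below_def)
  have K0: "K \<ge> 0" using lip[of undefined 1 0] by simp
  have main: "\<exists>U. \<forall>u\<ge>U. \<forall>i. \<bar>f i u - M\<bar> \<le> \<epsilon>" if \<epsilon>: "\<epsilon> > 0" for \<epsilon>
  proof -
    \<comment> \<open>Half of \<epsilon> pays for replacing \<open>v\<close> by the nearby point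
      that a path reaches exactly; the other half pays for the defect at that point.\<close>
    define \<eta> where "\<eta> = \<epsilon> / (2 * (K + 1))"
    have \<eta>: "\<eta> > 0" "K * \<eta> \<le> \<epsilon> / 2" using \<epsilon> K0 by (auto simp: \<eta>_def field_simps)
    obtain R where R: "\<And>s i j. s \<ge> R \<Longrightarrow> \<exists>n t. path i n t j \<and> s - \<eta> \<le> t \<and> t \<le> s"
      using path_lengths_dense[OF \<eta>(1)] unfolding eventually_at_top_linorder by blast
    \<comment> \<open>Paths of length at most \<open>R + lmax\<close> have at most \<open>N\<close>
      arcs, so \<open>path_defect\<close> enlarges a defect by at most \<open>1 / qmin ^ N\<close>.
      The factor \<open>qmin ^ N\<close> in \<epsilon>' compensates for this.\<close>
    define N where "N = nat \<lceil>(R + lmax) / lmin\<rceil>"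
    define \<epsilon>' where "\<epsilon>' = \<epsilon> / 4 * qmin ^ N"
    have \<epsilon>': "\<epsilon>' > 0" "2 * \<epsilon>' / qmin ^ N = \<epsilon> / 2" using \<epsilon> qmin(1) by (auto simp: \<epsilon>'_def)
    have "\<epsilon>' \<le> \<epsilon> / 4 * 1" unfolding \<epsilon>'_def using \<epsilon> qmin by (intro mult_left_mono power_le_one) auto
    then have "\<epsilon>' \<le> \<epsilon>" using \<epsilon> by simp
    obtain x where x: "x \<in> X" "x < M + \<epsilon>'"
      using cInf_lessD[of X "M + \<epsilon>'"] \<open>B \<in> X\<close> \<epsilon>'(1) M_def by auto
    then obtain U0 where U0: "\<And>u i. u \<ge> U0 \<Longrightarrow> f i u \<le> x" by (auto simp: X_def)
    define U where "U = max U0 c"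
    have U: "f i u \<le> M + \<epsilon>'" if "u \<ge> U" for u i using U0[of u i] that x by (simp add: U_def)
    \<comment> \<open>Values above \<open>M - \<epsilon>'\<close> therefore occur arbitrarily late.
      The point \<open>u\<close> is taken so late that the paths considered below end where the
      upper bound \<open>M + \<epsilon>'\<close> is already in force.\<close>
    have "M - \<epsilon>' \<notin> X" using cInf_lower[OF _ Xbdd, of "M - \<epsilon>'"] \<epsilon>'(1) by (auto simp: M_def)
    then obtain u i where u: "u \<ge> U + R + 2 * lmax + \<bar>R\<bar>" "f i u > M - \<epsilon>'"
      unfolding X_def mem_Collect_eq not_ex not_all not_imp not_le by blast
    have win: "f j v \<ge> M - \<epsilon>" if v: "u - R - lmax \<le> v" "v \<le> u - R" for j v
    proof -
      obtain n t where nt: "path i n t j" "u - v - \<eta> \<le> t" "t \<le> u - v"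
        using R[of "u - v" i j] v by auto
      have "real n \<le> (R + lmax) / lmin"
        using path_length_ge[OF nt(1)] nt(3) v lmin(1) by (simp add: field_simps)
      then have nN: "n \<le> N" unfolding N_def by linarith
      have "M + \<epsilon>' - f j (u - t) \<le> (M + \<epsilon>' - f i u) / qmin ^ n"
        using path_defect[OF f U _ nt(1), of U u] nt v u by (auto simp: U_def)
      also have "\<dots> \<le> (2 * \<epsilon>') / qmin ^ N"
        using u(2) qmin nN \<epsilon>' by (intro frac_le power_decreasing) auto
      also have "\<dots> = \<epsilon> / 2" by (rule \<epsilon>'(2))
      finally have 1: "M - \<epsilon> / 2 \<le> f j (u - t)" using \<epsilon>'(1) by linarith
      have "\<bar>f j v - f j (u - t)\<bar> \<le> K * \<bar>v - (u - t)\<bar>" by (rule lip)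
      also have "\<dots> \<le> K * \<eta>" using K0 nt by (intro mult_left_mono) auto
      also have "\<dots> \<le> \<epsilon> / 2" by (rule \<eta>)
      finally show ?thesis using 1 by linarith
    qed
    have low: "f j v \<ge> M - \<epsilon>" if "v \<ge> u - R - lmax" for j v
      by (rule solves_ge[OF f win]) (use u that lmax(1) in \<open>auto simp: U_def\<close>)
    show ?thesis
    proof (intro exI allI impI)
      fix v i assume v: "v \<ge> max U (u - R - lmax)"
      show "\<bar>f i v - M\<bar> \<le> \<epsilon>"
        using low[of v i] U[of v i] v \<open>\<epsilon>' \<le> \<epsilon>\<close> by (auto simp: abs_le_iff)
    qed
  qed
  have "(f i \<longlongrightarrow> M) at_top" for i
  proof (rule tendstoI)
    fix e :: real assume "e > 0"
    then obtain U where "\<forall>u\<ge>U. \<forall>i. \<bar>f i u - M\<bar> \<le> e / 2" using main[of "e/2"] by auto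
    then have "dist (f i u) M < e" if "u \<ge> U" for u
      using \<open>e > 0\<close> that order.strict_trans1[of "\<bar>f i u - M\<bar>" "e/2" e] by (simp add: dist_real_def)
    then show "\<forall>\<^sub>F x in at_top. dist (f i x) M < e" by (auto simp: eventually_at_top_linorder)
  qed
  then show ?thesis by (rule that)
qed

end

section \<open>The renewal theorem\<close>

lemma bounded_borel_integrable:
  fixes f :: "real \<Rightarrow> real"
  assumes "f \<in> borel_measurable borel" "\<And>x. \<bar>f x\<bar> \<le> B"
  shows "f integrable_on {a..b}"
proof (rule measurable_bounded_by_integrable_imp_integrable_real[where g = "\<lambda>_. B"])
  show "f \<in> borel_measurable (lebesgue_on {a..b})"
    using assms(1) by (intro measurable_restrict_space1 measurable_completion) simp
qed (use assms in auto)

lemma integral_shift_interval: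
  fixes f :: "real \<Rightarrow> real"
  shows "integral {a..b} (\<lambda>x. f (x + c)) = integral {a + c..b + c} f"
  using integral_shift_Icc_real[of a b f c] by (simp add: o_def add.commute)

lemma integral_split:
  fixes f :: "real \<Rightarrow> real"
  assumes "\<And>a b. f integrable_on {a..b}" "a \<le> c" "c \<le> b"
  shows "integral {a..b} f = integral {a..c} f + integral {c..b} f"
  using Henstock_Kurzweil_Integration.integral_combine[of a c b f] assms by simp

section \<open>Solutions with given initial data\<close>

context renewal
begin

text \<open>The counter bounds how often the equation is unrolled; when it is exhausted, the datum
  is read off even at a positive argument. After about \<open>u / lmin\<close> unrollings every
  branch has reached \<open>u \<le> 0\<close>, which is why \<open>sol\<close> is well defined. The
  same iterates describe rounds of substitution later on.\<close>

primrec it :: "nat \<Rightarrow> ('n \<Rightarrow> real \<Rightarrow> real) \<Rightarrow> 'n \<Rightarrow> real \<Rightarrow> real" where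
  "it 0 g i u = g i u"
| "it (Suc k) g i u =
     (if u \<le> 0 then g i u else \<Sum>e | e \<in> E \<and> src e = i. q e * it k g (tgt e) (u - l e))"

definition sol :: "('n \<Rightarrow> real \<Rightarrow> real) \<Rightarrow> 'n \<Rightarrow> real \<Rightarrow> real" where
  "sol g i u = it (nat \<lceil>u / lmin\<rceil>) g i u"

lemma it_stable: "u \<le> real k * lmin \<Longrightarrow> k \<le> k' \<Longrightarrow> it k' g i u = it k g i u"
proof (induction k arbitrary: i u k')
  case 0 then show ?case by (cases k') auto
next
  case (Suc k)
  then obtain k'' where k'': "k' = Suc k''" "k \<le> k''" by (cases k') auto
  have "it k'' g (tgt e) (u - l e) = it k g (tgt e) (u - l e)" if "e \<in> E" for e
    by (rule Suc.IH) (use Suc.prems k'' lmin(2)[OF that] in \<open>auto simp: algebra_simps\<close>)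
  then show ?case by (auto simp: k'' intro!: sum.cong)
qed

lemma sol_eq_it:
  assumes "u \<le> real k * lmin"
  shows "sol g i u = it k g i u"
proof -
  have *: "u / lmin \<le> real k" using assms lmin(1) by (simp add: field_simps)
  have "u / lmin \<le> real (nat \<lceil>u / lmin\<rceil>)" by linarith
  then have "u \<le> real (nat \<lceil>u / lmin\<rceil>) * lmin" using lmin(1) by (simp add: field_simps)
  moreover have "nat \<lceil>u / lmin\<rceil> \<le> k" using * by linarith
  ultimately show ?thesis unfolding sol_def by (rule it_stable[symmetric])
qed

lemma sol_init: "u \<le> 0 \<Longrightarrow> sol g i u = g i u"
  using sol_eq_it[of u 0] by simp

lemma solves_sol: "solves 0 (sol g)"
  unfolding solves_def
proof (intro allI impI)
  fix i and u :: real assume u: "u > 0"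
  obtain k :: nat where "real k > u / lmin" using reals_Archimedean2 by blast
  then have k: "u \<le> real k * lmin" using lmin(1) by (simp add: field_simps)
  have "sol g (tgt e) (u - l e) = it k g (tgt e) (u - l e)" if "e \<in> E" for e
    by (rule sol_eq_it) (use k l_pos[OF that] in simp)
  moreover have "sol g i u = it (Suc k) g i u"
    by (rule sol_eq_it) (use k lmin(1) in \<open>simp add: algebra_simps\<close>)
  ultimately show "sol g i u = (\<Sum>e | e \<in> E \<and> src e = i. q e * sol g (tgt e) (u - l e))"
    using u by (auto intro!: sum.cong)
qed

lemma solves_unique:
  assumes f: "solves 0 f" and f': "solves 0 f'"
    and init: "\<And>i u. - lmax \<le> u \<Longrightarrow> u \<le> 0 \<Longrightarrow> f i u = f' i u" and u: "- lmax \<le> u"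
  shows "f i u = f' i u"
proof -
  have "- lmax \<le> u \<longrightarrow> f i u = f' i u"
  proof (induction i u rule: renewal_induct[where c = 0])
    case (step i u)
    have "q e * f (tgt e) (u - l e) = q e * f' (tgt e) (u - l e)" if "e \<in> E" "src e = i" for e
      using step(1) step(2)[OF that] lmax(2)[OF that(1)] by simp
    then show ?case using f f' step(1) by (auto simp: solves_def intro!: sum.cong)
  qed (use init in auto)
  then show ?thesis using u by blast
qed

lemma sol_bounded:
  assumes "\<And>i u. u \<le> 0 \<Longrightarrow> \<bar>g i u\<bar> \<le> B"
  shows "\<bar>sol g i u\<bar> \<le> B"
proof (induction i u rule: renewal_induct[where c = 0])
  case (step i u)
  have "\<bar>sol g i u\<bar> \<le> (\<Sum>e | e \<in> E \<and> src e = i. \<bar>q e * sol g (tgt e) (u - l e)\<bar>)"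
    using solves_sol step(1) by (simp add: solves_def)
  also have "\<dots> = (\<Sum>e | e \<in> E \<and> src e = i. q e * \<bar>sol g (tgt e) (u - l e)\<bar>)"
    by (rule sum.cong) (use q_pos in \<open>auto simp: abs_mult less_imp_le\<close>)
  also have "\<dots> \<le> (\<Sum>e | e \<in> E \<and> src e = i. q e * B)"
    by (rule avg_mono) (use step(2) in auto)
  finally show ?case by (simp add: avg_const)
qed (use assms in \<open>simp add: sol_init\<close>)

text \<open>A tile that is already small survives a further small inflation.\<close>

lemma sol_shift_mono:
  assumes s: "0 \<le> s"
    and le: "\<And>i x. x + s \<le> 0 \<Longrightarrow> g' i x \<le> g i (x + s)"
    and zero: "\<And>i x. x \<le> 0 \<Longrightarrow> x + s > 0 \<Longrightarrow> g' i x \<le> 0"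
    and nonneg: "\<And>i x. x \<le> 0 \<Longrightarrow> g i x \<ge> 0"
  shows "sol g' i u \<le> sol g i (u + s)"
proof (induction i u rule: renewal_induct[where c = 0])
  case (init i u)
  have sol_nonneg: "sol g i x \<ge> 0" for i x
  proof (induction i x rule: renewal_induct[where c = 0])
    case (step i u)
    have "0 = (\<Sum>e | e \<in> E \<and> src e = i. q e * 0)" by simp
    also have "\<dots> \<le> (\<Sum>e | e \<in> E \<and> src e = i. q e * sol g (tgt e) (u - l e))"
      by (rule avg_mono) (use step(2) in auto)
    finally show ?case using solves_sol step(1) by (simp add: solves_def)
  qed (simp add: sol_init nonneg)
  show ?case
  proof (cases "u + s \<le> 0")
    case True
    then show ?thesis using init le s by (simp add: sol_init)
  next
    case False
    then show ?thesis using init zero[of u i] sol_nonneg[of i "u + s"] by (simp add: sol_init)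
  qed
next
  case (step i u)
  have "(\<Sum>e | e \<in> E \<and> src e = i. q e * sol g' (tgt e) (u - l e)) \<le>
        (\<Sum>e | e \<in> E \<and> src e = i. q e * sol g (tgt e) (u + s - l e))"
    by (rule avg_mono) (use step(2) in \<open>simp add: algebra_simps\<close>)
  then show ?case using solves_sol step(1) s by (simp add: solves_def)
qed

text \<open>At each point the iterates become stationary, so the solution is a pointwise limit of
  finite combinations of shifted data.\<close>

lemma sol_measurable:
  assumes g: "\<And>i. g i \<in> borel_measurable borel"
  shows "sol g i \<in> borel_measurable borel"
proof (rule borel_measurable_LIMSEQ_real)
  fix u :: real
  obtain K :: nat where "real K > u / lmin" using reals_Archimedean2 by blast
  then have "u \<le> real K * lmin" using lmin(1) by (simp add: field_simps)
  then have "sol g i u = it k g i u" if "k \<ge> K" for k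
    using that sol_eq_it it_stable by metis
  then have "\<forall>\<^sub>F k in sequentially. it k g i u = sol g i u"
    by (metis (mono_tags) eventually_sequentiallyI)
  then show "(\<lambda>k. it k g i u) \<longlonglongrightarrow> sol g i u" by (rule tendsto_eventually)
next
  show "it k g i \<in> borel_measurable borel" for k
  proof (induction k arbitrary: i)
    case 0 then show ?case using g by simp
  next
    case (Suc k)
    have "(\<lambda>u. it k g j (u - l e)) \<in> borel_measurable borel" for j e
      by (rule measurable_compose[OF _ Suc]) simp
    then show ?case using g by (simp cong: measurable_cong)
  qed
qed

lemma sol_integrable:
  assumes "\<And>i. g i \<in> borel_measurable borel" "\<And>i u. u \<le> 0 \<Longrightarrow> \<bar>g i u\<bar> \<le> B"
  shows "sol g i integrable_on {a..b}"
  by (rule bounded_borel_integrable[OF sol_measurable sol_bounded]) (use assms in auto)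

text \<open>A stationary row vector of the chain of types whose transition probabilities are the
  weights \<open>q\<close>. It may have any sign and any scale.\<close>

definition invariant :: "('n \<Rightarrow> real) \<Rightarrow> bool" where
  "invariant v \<longleftrightarrow> (\<forall>j. (\<Sum>e | e \<in> E \<and> tgt e = j. v (src e) * q e) = v j)"

definition mean_length :: "('n \<Rightarrow> real) \<Rightarrow> real" where
  "mean_length v = (\<Sum>e\<in>E. v (src e) * q e * l e)"

text \<open>This conserved quantity identifies the limit.\<close>

lemma invariant_integral:
  assumes v: "invariant v" and f: "solves 0 f" and int: "\<And>i a b. f i integrable_on {a..b}" and u: "u \<ge> 0"
  shows "(\<Sum>e\<in>E. v (src e) * q e * integral {u - l e..u} (f (tgt e))) =
         (\<Sum>e\<in>E. v (src e) * q e * integral {- l e..0} (f (tgt e)))"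
proof -
  \<comment> \<open>The change of each window integral between times 0 and \<open>u\<close> becomes
    what has entered the arc minus what has left it. It remains to show that, weighted by
    \<open>v\<close>, total inflow equals total outflow.\<close>
  have 1: "integral {u - l e..u} (f j) - integral {- l e..0} (f j) =
        integral {0..u} (f j) - integral {0..u} (\<lambda>s. f j (s - l e))" if "e \<in> E" for e j
  proof -
    have "integral {- l e..u - l e} (f j) + integral {u - l e..u} (f j) =
          integral {- l e..0} (f j) + integral {0..u} (f j)"
      using l_pos[OF that] u integral_split[OF int, of "- l e" "u - l e" u]
        integral_split[OF int, of "- l e" 0 u] by simp
    moreover have "integral {- l e..u - l e} (f j) = integral {0..u} (\<lambda>s. f j (s - l e))"
      using integral_shift_interval[of 0 u "f j" "- l e"] by simp
    ultimately show ?thesis by simp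
  qed
  have int': "(\<lambda>s. f j (s - c)) integrable_on {a..b}" for j c a b
    using integrable_on_shift_Icc_real[of "f j" "- c" a b] int by (simp add: o_def)
  \<comment> \<open>Grouping by targets allows invariance to be applied; the renewal equation then
    expands each \<open>f j\<close> over the arcs leaving \<open>j\<close>, and regrouping by
    sources gives the delayed integrals.\<close>
  have "(\<Sum>e\<in>E. v (src e) * q e * integral {0..u} (f (tgt e))) =
        (\<Sum>j\<in>UNIV. \<Sum>e | e \<in> E \<and> tgt e = j. v (src e) * q e * integral {0..u} (f (tgt e)))"
    by (rule sum.group[symmetric]) (auto simp: finE)
  also have "\<dots> = (\<Sum>j\<in>UNIV. (\<Sum>e | e \<in> E \<and> tgt e = j. v (src e) * q e) * integral {0..u} (f j))"
    unfolding sum_distrib_right by (intro sum.cong) auto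
  also have "\<dots> = (\<Sum>j\<in>UNIV. v j * integral {0..u} (f j))"
    using v by (simp add: invariant_def)
  also have "\<dots> = (\<Sum>j\<in>UNIV. v j * (\<Sum>e | e \<in> E \<and> src e = j. q e * integral {0..u} (\<lambda>s. f (tgt e) (s - l e))))"
  proof (intro sum.cong refl arg_cong2[where f = "(*)"])
    fix j
    \<comment> \<open>The equation holds only for positive arguments, so the endpoint 0 is discarded
      as a null set.\<close>
    have "integral {0..u} (f j) = integral {0..u} (\<lambda>s. \<Sum>e | e \<in> E \<and> src e = j. q e * f (tgt e) (s - l e))"
      by (rule integral_spike[of "{0}"]) (use f in \<open>auto simp: solves_def\<close>)
    also have "\<dots> = (\<Sum>e | e \<in> E \<and> src e = j. integral {0..u} (\<lambda>s. q e * f (tgt e) (s - l e)))"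
      by (rule integral_sum) (use finE int' in \<open>auto intro!: integrable_cmul[where 'b = real, simplified]\<close>)
    finally show "integral {0..u} (f j) = (\<Sum>e | e \<in> E \<and> src e = j. q e * integral {0..u} (\<lambda>s. f (tgt e) (s - l e)))"
      by simp
  qed
  also have "\<dots> = (\<Sum>j\<in>UNIV. \<Sum>e | e \<in> E \<and> src e = j. v (src e) * q e * integral {0..u} (\<lambda>s. f (tgt e) (s - l e)))"
    unfolding sum_distrib_left by (intro sum.cong) (auto simp: mult.assoc)
  also have "\<dots> = (\<Sum>e\<in>E. v (src e) * q e * integral {0..u} (\<lambda>s. f (tgt e) (s - l e)))"
    by (rule sum.group) (auto simp: finE)
  finally have 2: "(\<Sum>e\<in>E. v (src e) * q e * integral {0..u} (f (tgt e))) = \<dots>" .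
  have "(\<Sum>e\<in>E. v (src e) * q e * integral {u - l e..u} (f (tgt e))) -
        (\<Sum>e\<in>E. v (src e) * q e * integral {- l e..0} (f (tgt e))) =
        (\<Sum>e\<in>E. v (src e) * q e * (integral {u - l e..u} (f (tgt e)) - integral {- l e..0} (f (tgt e))))"
    by (simp add: sum_subtractf right_diff_distrib)
  also have "\<dots> = (\<Sum>e\<in>E. v (src e) * q e * (integral {0..u} (f (tgt e)) - integral {0..u} (\<lambda>s. f (tgt e) (s - l e))))"
    by (rule sum.cong) (simp_all add: 1)
  also have "\<dots> = 0" using 2 by (simp add: sum_subtractf right_diff_distrib)
  finally show ?thesis by simp
qed

end

section \<open>Moving integrals and their limits\<close>

lemma integral_abs_le:
  fixes f :: "real \<Rightarrow> real"
  assumes "f integrable_on {a..b}" "\<And>x. x \<in> {a..b} \<Longrightarrow> \<bar>f x\<bar> \<le> B" "a \<le> b"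
  shows "\<bar>integral {a..b} f\<bar> \<le> B * (b - a)"
  using integral_norm_bound_integral[of f "{a..b}" "\<lambda>_. B"] assms integrable_const_ivl[of B a b]
  by (simp add: mult.commute)

text \<open>Moving a window from \<open>s\<close> to \<open>u\<close> exchanges two pieces of length
  \<open>|u - s|\<close>. This is the regularity that the solution itself lacks.\<close>

lemma moving_integral_lipschitz:
  fixes f :: "real \<Rightarrow> real"
  assumes int: "\<And>a b. f integrable_on {a..b}" and bdd: "\<And>x. \<bar>f x\<bar> \<le> B" and h: "h \<ge> 0"
  shows "\<bar>integral {u - h..u} f - integral {s - h..s} f\<bar> \<le> 2 * B * \<bar>u - s\<bar>"
proof -
  have *: "\<bar>integral {u - h..u} f - integral {s - h..s} f\<bar> \<le> 2 * B * \<bar>u - s\<bar>" if "s \<le> u" for s u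
  proof -
    have "integral {s - h..u - h} f + integral {u - h..u} f = integral {s - h..s} f + integral {s..u} f"
      using integral_split[OF int, of "s - h" "u - h" u] integral_split[OF int, of "s - h" s u] that h by simp
    moreover have "\<bar>integral {s - h..u - h} f\<bar> \<le> B * (u - s)" "\<bar>integral {s..u} f\<bar> \<le> B * (u - s)"
      using integral_abs_le[OF int bdd, of "s - h" "u - h"] integral_abs_le[OF int bdd, of s u] that by auto
    ultimately show ?thesis using that by simp
  qed
  show ?thesis
  proof (cases "s \<le> u")
    case False
    then show ?thesis using *[of u s] by (simp add: abs_minus_commute)
  qed (rule *)
qed

lemma moving_integral_continuous:
  fixes f :: "real \<Rightarrow> real"
  assumes int: "\<And>a b. f integrable_on {a..b}" and bdd: "\<And>x. \<bar>f x\<bar> \<le> B" and h: "h \<ge> 0"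
  shows "continuous_on A (\<lambda>u. integral {u - h..u} f)"
proof -
  have "B \<ge> 0" using bdd[of 0] by simp
  then have "(2 * B)-lipschitz_on A (\<lambda>u. integral {u - h..u} f)"
    using moving_integral_lipschitz[OF assms] by (intro lipschitz_onI) (auto simp: dist_real_def)
  then show ?thesis by (rule lipschitz_on_continuous_on)
qed

text \<open>Averaging over two windows commutes. Instead of a double integral, a primitive \<Phi> is
  used: the outcome is an expression in integrals of \<Phi> that is symmetric in \<open>a\<close>
  and \<open>b\<close>.\<close>

lemma moving_integral_swap:
  fixes f :: "real \<Rightarrow> real"
  assumes int: "\<And>a b. f integrable_on {a..b}" and ab: "a \<ge> 0" "b \<ge> 0"
  shows "integral {u - a..u} (\<lambda>s. integral {s - b..s} f) = integral {u - b..u} (\<lambda>s. integral {s - a..s} f)"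
proof -
  define z where "z = u - a - b"
  define \<Phi> where "\<Phi> s = integral {z..s} f" for s
  have "continuous_on {z..u} \<Phi>"
    unfolding \<Phi>_def by (rule indefinite_integral_continuous_1[OF int])
  then have \<Phi>: "\<Phi> integrable_on {x..y}" if "z \<le> x" "y \<le> u" for x y
    using that by (intro integrable_continuous_real) (auto elim: continuous_on_subset)
  have *: "integral {u - a..u} (\<lambda>s. integral {s - b..s} f) =
      integral {z..u} \<Phi> - integral {z..u - a} \<Phi> - integral {z..u - b} \<Phi>"
    if "a \<ge> 0" "b \<ge> 0" "z = u - a - b" for a b
  proof -
    have "integral {u - a..u} (\<lambda>s. integral {s - b..s} f) = integral {u - a..u} (\<lambda>s. \<Phi> s - \<Phi> (s - b))"
    proof (rule integral_cong)
      fix s assume "s \<in> {u - a..u}"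
      then show "integral {s - b..s} f = \<Phi> s - \<Phi> (s - b)"
        using that integral_split[OF int, of z "s - b" s] by (simp add: \<Phi>_def)
    qed
    also have "\<dots> = integral {u - a..u} \<Phi> - integral {u - a..u} (\<lambda>s. \<Phi> (s - b))"
      using integrable_on_shift_Icc_real[of \<Phi> "- b" "u - a" u] \<Phi> that
      by (intro integral_diff) (auto simp: o_def)
    also have "integral {u - a..u} (\<lambda>s. \<Phi> (s - b)) = integral {z..u - b} \<Phi>"
      using integral_shift_interval[of "u - a" u \<Phi> "- b"] that by simp
    also have "integral {u - a..u} \<Phi> = integral {z..u} \<Phi> - integral {z..u - a} \<Phi>"
      using Henstock_Kurzweil_Integration.integral_combine[of z "u - a" u \<Phi>] \<Phi> that by simp
    finally show ?thesis by simp
  qed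
  show ?thesis using *[of a b] *[of b a] ab by (simp add: z_def)
qed

lemma moving_integral_tendsto:
  fixes F :: "real \<Rightarrow> real"
  assumes int: "\<And>a b. F integrable_on {a..b}" and lim: "(F \<longlongrightarrow> c) at_top" and l: "l \<ge> 0"
  shows "((\<lambda>u. integral {u - l..u} F) \<longlongrightarrow> l * c) at_top"
proof (rule tendstoI)
  fix e :: real assume e: "e > 0"
  define \<epsilon> where "\<epsilon> = e / (l + 1)"
  have \<epsilon>: "\<epsilon> > 0" "\<epsilon> * l < e" using e l by (auto simp: \<epsilon>_def field_simps)
  have "\<forall>\<^sub>F x in at_top. dist (F x) c < \<epsilon>" by (rule tendstoD[OF lim \<epsilon>(1)])
  then obtain U where U: "\<And>x. x \<ge> U \<Longrightarrow> \<bar>F x - c\<bar> < \<epsilon>"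
    by (auto simp: eventually_at_top_linorder dist_real_def)
  have "dist (integral {u - l..u} F) (l * c) < e" if u: "u \<ge> U + l" for u
  proof -
    have "integral {u - l..u} (\<lambda>x. F x - c) = integral {u - l..u} F - l * c"
      using int l by (subst integral_diff) auto
    moreover have "\<bar>integral {u - l..u} (\<lambda>x. F x - c)\<bar> \<le> \<epsilon> * (u - (u - l))"
    proof (rule integral_abs_le)
      show "(\<lambda>x. F x - c) integrable_on {u - l..u}" using int by (intro integrable_diff) auto
    qed (use u l in \<open>auto intro!: less_imp_le[OF U]\<close>)
    ultimately show ?thesis using \<epsilon>(2) by (simp add: dist_real_def)
  qed
  then show "\<forall>\<^sub>F u in at_top. dist (integral {u - l..u} F) (l * c) < e"
    by (auto simp: eventually_at_top_linorder)
qed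

text \<open>The conserved quantity at time 0, divided by its value for the constant solution
  1.\<close>

definition (in renewal) limit_value :: "('n \<Rightarrow> real) \<Rightarrow> ('n \<Rightarrow> real \<Rightarrow> real) \<Rightarrow> real" where
  "limit_value v g = (\<Sum>e\<in>E. v (src e) * q e * integral {- l e..0} (g (tgt e))) / mean_length v"

context nonlattice_renewal
begin

text \<open>Moving integrals solve the equation beyond \<open>h\<close>, and they are bounded and
  Lipschitz, so they converge to a common constant \<open>c\<close>. The conserved quantity then has
  to agree with its value at that constant.\<close>

lemma moving_integral_sol:
  assumes v: "invariant v" "mean_length v \<noteq> 0"
    and g: "\<And>i. g i \<in> borel_measurable borel" "\<And>i u. u \<le> 0 \<Longrightarrow> \<bar>g i u\<bar> \<le> B"
    and h: "h > 0"
  shows "((\<lambda>u. integral {u - h..u} (sol g i)) \<longlongrightarrow> h * limit_value v g) at_top"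
proof -
  let ?f = "sol g"
  define F where "F i u = integral {u - h..u} (?f i)" for i u
  have int: "?f i integrable_on {a..b}" for i a b by (rule sol_integrable[OF g])
  have bdd: "\<bar>?f i u\<bar> \<le> B" for i u by (rule sol_bounded) (use g in auto)
  have int': "(\<lambda>s. ?f j (s - c)) integrable_on {a..b}" for j c a b
    using integrable_on_shift_Icc_real[of "?f j" "- c" a b] int by (simp add: o_def)
  have F: "solves h F"
    unfolding solves_def
  proof (intro allI impI)
    fix i and u :: real assume u: "u > h"
    have "F i u = integral {u - h..u} (\<lambda>s. \<Sum>e | e \<in> E \<and> src e = i. q e * ?f (tgt e) (s - l e))"
      unfolding F_def using solves_sol[of g] u by (intro integral_cong) (auto simp: solves_def)
    also have "\<dots> = (\<Sum>e | e \<in> E \<and> src e = i. integral {u - h..u} (\<lambda>s. q e * ?f (tgt e) (s - l e)))"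
      by (rule integral_sum) (use finE int' in \<open>auto intro!: integrable_cmul[where 'b = real, simplified]\<close>)
    also have "\<dots> = (\<Sum>e | e \<in> E \<and> src e = i. q e * F (tgt e) (u - l e))"
    proof (rule sum.cong)
      fix e
      have "integral {u - h..u} (\<lambda>s. ?f (tgt e) (s - l e)) = F (tgt e) (u - l e)"
        using integral_shift_interval[of "u - h" u "?f (tgt e)" "- l e"] by (simp add: F_def algebra_simps)
      then show "integral {u - h..u} (\<lambda>s. q e * ?f (tgt e) (s - l e)) = q e * F (tgt e) (u - l e)" by simp
    qed simp
    finally show "F i u = (\<Sum>e | e \<in> E \<and> src e = i. q e * F (tgt e) (u - l e))" .
  qed
  have Fbdd: "\<bar>F i u\<bar> \<le> B * h" for i u
    using integral_abs_le[OF int bdd, of "u - h" u] h by (simp add: F_def)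
  have Flip: "\<bar>F i u - F i s\<bar> \<le> (2 * B) * \<bar>u - s\<bar>" for i u s
    unfolding F_def by (rule moving_integral_lipschitz[OF int bdd]) (use h in simp)
  obtain c where c: "\<And>i. (F i \<longlongrightarrow> c) at_top"
    using lipschitz_solution_converges[OF F Fbdd Flip] by blast
  have Fint: "F i integrable_on {a..b}" for i a b
    unfolding F_def using h
    by (intro integrable_continuous_real moving_integral_continuous[OF int bdd]) auto
  define J where "J e s = integral {s - l e..s} (?f (tgt e))" for e s
  have Jint: "J e integrable_on {a..b}" if "e \<in> E" for e a b
    unfolding J_def using l_pos[OF that]
    by (intro integrable_continuous_real moving_integral_continuous[OF int bdd]) auto
  define I0 where "I0 = (\<Sum>e\<in>E. v (src e) * q e * integral {- l e..0} (g (tgt e)))"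
  have I0: "(\<Sum>e\<in>E. v (src e) * q e * J e s) = I0" if "s \<ge> 0" for s
  proof -
    have "(\<Sum>e\<in>E. v (src e) * q e * J e s) = (\<Sum>e\<in>E. v (src e) * q e * integral {- l e..0} (?f (tgt e)))"
      unfolding J_def by (rule invariant_integral[OF v(1) solves_sol int that])
    also have "\<dots> = I0" unfolding I0_def
      by (intro sum.cong arg_cong2[where f = "(*)"] integral_cong refl) (auto simp: sol_init)
    finally show ?thesis .
  qed
  \<comment> \<open>After the two windows are exchanged, the conserved quantity of \<open>F\<close>
    is the integral over a window of length \<open>h\<close> of that of the solution. The condition
    \<open>u \<ge> h\<close> keeps this window in the nonnegative range, where the latter equals
    \<open>I0\<close>.\<close>
  have "(\<Sum>e\<in>E. v (src e) * q e * integral {u - l e..u} (F (tgt e))) = h * I0" if u: "u \<ge> h" for u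
  proof -
    have "(\<Sum>e\<in>E. v (src e) * q e * integral {u - l e..u} (F (tgt e))) =
          (\<Sum>e\<in>E. v (src e) * q e * integral {u - h..u} (J e))"
      unfolding F_def J_def using h l_pos
      by (intro sum.cong arg_cong2[where f = "(*)"] moving_integral_swap[OF int] refl) (auto simp: less_imp_le)
    also have "\<dots> = integral {u - h..u} (\<lambda>s. \<Sum>e\<in>E. v (src e) * q e * J e s)"
      by (subst integral_sum)
         (use finE Jint in \<open>auto intro!: integrable_cmul[where 'b = real, simplified]\<close>)
    also have "\<dots> = integral {u - h..u} (\<lambda>s. I0)"
      by (rule integral_cong) (use u I0 in auto)
    finally show ?thesis using h by simp
  qed
  then have "((\<lambda>u. \<Sum>e\<in>E. v (src e) * q e * integral {u - l e..u} (F (tgt e))) \<longlongrightarrow> h * I0) at_top"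
    by (intro tendsto_eventually) (auto simp: eventually_at_top_linorder)
  moreover have "((\<lambda>u. \<Sum>e\<in>E. v (src e) * q e * integral {u - l e..u} (F (tgt e)))
      \<longlongrightarrow> (\<Sum>e\<in>E. v (src e) * q e * (l e * c))) at_top"
    by (intro tendsto_intros moving_integral_tendsto[OF Fint c]) (use l_pos in \<open>auto simp: less_imp_le\<close>)
  ultimately have "h * I0 = (\<Sum>e\<in>E. v (src e) * q e * (l e * c))"
    using tendsto_unique trivial_limit_at_top_linorder by blast
  also have "\<dots> = mean_length v * c"
    by (simp add: mean_length_def sum_distrib_right mult.assoc)
  finally have "c = h * limit_value v g"
    using v(2) by (simp add: limit_value_def I0_def field_simps)
  then show ?thesis using c[of i] by (simp add: F_def[abs_def])
qed

end

section \<open>Lower bounds for data supported on intervals\<close>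

lemma integral_indicator_Icc_le:
  fixes \<sigma> h a b :: real
  assumes "h \<ge> 0"
  shows "integral {a..b} (\<lambda>x. if x \<in> {\<sigma> - h..\<sigma>} then 1 else 0) \<le> h"
proof -
  have "integral {a..b} (\<lambda>x. if x \<in> {\<sigma> - h..\<sigma>} then 1 else (0::real)) = integral ({a..b} \<inter> {\<sigma> - h..\<sigma>}) (\<lambda>x. 1)"
    using integral_restrict_Int[of "{a..b}" "{\<sigma> - h..\<sigma>}" "\<lambda>_. 1::real"] by (simp only: Int_commute)
  also have "\<dots> \<le> integral {\<sigma> - h..\<sigma>} (\<lambda>x. 1)"
    by (rule integral_subset_le) (auto simp: Int_atLeastAtMost)
  finally show ?thesis using assms by simp
qed

context renewal
begin

definition datum :: "'n set \<Rightarrow> real set \<Rightarrow> (real \<Rightarrow> real) \<Rightarrow> 'n \<Rightarrow> real \<Rightarrow> real" where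
  "datum A S w j x = (if j \<in> A \<and> x \<in> S then w x else 0)"

definition regular :: "('n \<Rightarrow> real \<Rightarrow> real) \<Rightarrow> bool" where
  "regular g \<longleftrightarrow> (\<forall>i. g i \<in> borel_measurable borel) \<and> (\<exists>B. \<forall>i u. \<bar>g i u\<bar> \<le> B)"

lemma regular_add: "regular g \<Longrightarrow> regular g' \<Longrightarrow> regular (\<lambda>i u. g i u + g' i u)"
  unfolding regular_def
proof (elim conjE exE, intro conjI allI exI)
  fix B B' i u assume "\<forall>i u. \<bar>g i u\<bar> \<le> B" "\<forall>i u. \<bar>g' i u\<bar> \<le> B'"
  then show "\<bar>g i u + g' i u\<bar> \<le> B + B'" by (meson abs_triangle_ineq add_mono order.trans)
qed (simp add: borel_measurable_add)

lemma regular_integrable: "regular g \<Longrightarrow> g i integrable_on {a..b}"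
  unfolding regular_def using bounded_borel_integrable by blast

lemma regular_datum:
  assumes S: "is_interval S" "S \<subseteq> {- lmax..0}" and w: "continuous_on UNIV w"
    and bdd: "\<And>x. x \<in> {- lmax..0} \<Longrightarrow> 0 \<le> w x \<and> w x \<le> B"
  shows "regular (datum A S w)"
  unfolding regular_def
proof (intro conjI allI exI)
  fix i
  have "S \<in> sets borel" by (rule real_interval_borel_measurable[OF S(1)])
  moreover have "w \<in> borel_measurable borel" by (rule borel_measurable_continuous_onI[OF w])
  ultimately show "datum A S w i \<in> borel_measurable borel"
    unfolding datum_def by (intro measurable_If) auto
  show "\<bar>datum A S w i u\<bar> \<le> \<bar>B\<bar>" for u using bdd[of u] S(2) by (auto simp: datum_def)
qed

lemma limit_value_add:
  assumes "regular g" "regular g'"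
  shows "limit_value v (\<lambda>i u. g i u + g' i u) = limit_value v g + limit_value v g'"
  using regular_integrable[OF assms(1)] regular_integrable[OF assms(2)]
  by (simp add: limit_value_def integral_add sum.distrib distrib_left add_divide_distrib)

lemma limit_value_diff_le:
  assumes g: "regular g" "regular g'"
    and le: "\<And>e. e \<in> E \<Longrightarrow> \<bar>integral {- l e..0} (\<lambda>x. g (tgt e) x - g' (tgt e) x)\<bar> \<le> D"
  shows "\<bar>limit_value v g - limit_value v g'\<bar> \<le> (\<Sum>e\<in>E. \<bar>v (src e) * q e\<bar>) / \<bar>mean_length v\<bar> * D"
proof -
  have "limit_value v g - limit_value v g' =
        (\<Sum>e\<in>E. v (src e) * q e * integral {- l e..0} (\<lambda>x. g (tgt e) x - g' (tgt e) x)) / mean_length v"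
    using regular_integrable[OF g(1)] regular_integrable[OF g(2)]
    by (simp add: limit_value_def integral_diff sum_subtractf right_diff_distrib diff_divide_distrib)
  moreover have "\<bar>\<Sum>e\<in>E. v (src e) * q e * integral {- l e..0} (\<lambda>x. g (tgt e) x - g' (tgt e) x)\<bar>
      \<le> (\<Sum>e\<in>E. \<bar>v (src e) * q e\<bar> * D)"
    by (rule order.trans[OF sum_abs], rule sum_mono, subst abs_mult) (auto intro: mult_left_mono le)
  ultimately show ?thesis
    by (simp add: sum_distrib_right divide_right_mono)
qed

lemma sol_add: "sol (\<lambda>i u. g i u + g' i u) i u = sol g i u + sol g' i u"
proof -
  have "it k (\<lambda>i u. g i u + g' i u) i u = it k g i u + it k g' i u" for k
    by (induction k arbitrary: i u) (auto simp: sum.distrib distrib_left)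
  then show ?thesis by (simp add: sol_def)
qed

text \<open>One half of the convergence to the limit. This half follows from shrinking a datum, and
  it passes to sums.\<close>

definition lower_regular :: "('n \<Rightarrow> real) \<Rightarrow> ('n \<Rightarrow> real \<Rightarrow> real) \<Rightarrow> bool" where
  "lower_regular v g \<longleftrightarrow> regular g \<and>
     (\<forall>i. \<forall>\<epsilon>>0. \<forall>\<^sub>F u in at_top. limit_value v g - \<epsilon> \<le> sol g i u)"

lemma lower_regular_add:
  assumes "lower_regular v g" "lower_regular v g'"
  shows "lower_regular v (\<lambda>i u. g i u + g' i u)"
  unfolding lower_regular_def
proof (intro conjI allI impI)
  fix i and \<epsilon> :: real assume "\<epsilon> > 0"
  then have "\<forall>\<^sub>F u in at_top. limit_value v g - \<epsilon>/2 \<le> sol g i u"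
    "\<forall>\<^sub>F u in at_top. limit_value v g' - \<epsilon>/2 \<le> sol g' i u"
    using assms unfolding lower_regular_def by (metis half_gt_zero)+
  then show "\<forall>\<^sub>F u in at_top. limit_value v (\<lambda>i u. g i u + g' i u) - \<epsilon> \<le> sol (\<lambda>i u. g i u + g' i u) i u"
  proof eventually_elim
    case (elim u)
    then show ?case using assms
      by (simp add: sol_add limit_value_add lower_regular_def)
  qed
qed (use assms in \<open>simp add: lower_regular_def regular_add\<close>)

end

context nonlattice_renewal
begin

text \<open>Moving integrals of the solution for a slightly shrunken datum have a limit, and by
  \<open>sol_shift_mono\<close> they bound the given solution from below.\<close>

lemma lower_regular_datum:
  assumes v: "invariant v" "mean_length v \<noteq> 0"
    and S: "is_interval S" "S \<subseteq> {- lmax..0}" and w: "continuous_on UNIV w"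
    and bdd: "\<And>x. x \<in> {- lmax..0} \<Longrightarrow> 0 \<le> w x \<and> w x \<le> B"
    and lip: "K-lipschitz_on {- lmax..0} w"
  shows "lower_regular v (datum A S w)"
  unfolding lower_regular_def
proof (intro conjI allI impI)
  let ?g = "datum A S w"
  show g: "regular ?g" by (rule regular_datum) (use assms in auto)
  fix i and \<epsilon> :: real assume \<epsilon>: "\<epsilon> > 0"
  have K: "K \<ge> 0" using lip lipschitz_on_nonneg by blast
  have B: "B \<ge> 0" using bdd[of 0] lmax(1) by auto
  \<comment> \<open>The integral of the difference between the datum and its shrunken version is at
    most \<open>(K * lmax + B) * h\<close>; the first factor is the one in
    \<open>limit_value_diff_le\<close>.\<close>
  define C where "C = (\<Sum>e\<in>E. \<bar>v (src e) * q e\<bar>) / \<bar>mean_length v\<bar> * (K * lmax + B)"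
  have C: "C \<ge> 0" unfolding C_def using K B lmax(1)
    by (intro mult_nonneg_nonneg divide_nonneg_nonneg sum_nonneg add_nonneg_nonneg) auto
  define h where "h = \<epsilon> / (2 * (C + 1))"
  have h: "h > 0" "C * h \<le> \<epsilon> / 2" using \<epsilon> C by (auto simp: h_def field_simps)
  \<comment> \<open>For an interval \<open>S\<close>, the points of \<open>S'\<close> remain in
    \<open>S\<close> under all shifts by at most \<open>h\<close>. Lowering \<open>w\<close> by
    \<open>K * h\<close> absorbs its variation under such a shift, and the cut-off at 0 keeps the
    datum nonnegative.\<close>
  define S' where "S' = {x \<in> S. x + h \<in> S}"
  define g' where "g' = datum A S' (\<lambda>x. max 0 (w x - K * h))"
  have S': "is_interval S'" "S' \<subseteq> {- lmax..0}"
  proof -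
    show "is_interval S'" unfolding is_interval_1
    proof (intro ballI allI impI)
      fix a b x assume "a \<in> S'" "b \<in> S'" "a \<le> x \<and> x \<le> b"
      then show "x \<in> S'" using S(1) unfolding S'_def is_interval_1
        by (metis (mono_tags, lifting) add_le_cancel_right mem_Collect_eq)
    qed
  qed (use S in \<open>auto simp: S'_def\<close>)
  have g': "regular g'"
    unfolding g'_def
  proof (rule regular_datum[OF S', where B = B])
    fix x assume "x \<in> {- lmax..0}"
    moreover have "0 \<le> K * h" using K h by simp
    ultimately show "0 \<le> max 0 (w x - K * h) \<and> max 0 (w x - K * h) \<le> B" using bdd[of x] by auto
  qed (use w in \<open>auto intro!: continuous_intros\<close>)
  have mono: "sol g' i u \<le> sol ?g i (u + s)" if s: "0 \<le> s" "s \<le> h" for u s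
  proof (rule sol_shift_mono[OF s(1)])
    fix j x assume "x + s \<le> 0"
    show "g' j x \<le> ?g j (x + s)"
    proof (cases "j \<in> A \<and> x \<in> S'")
      case True
      then have x: "x \<in> S" "x + h \<in> S" by (auto simp: S'_def)
      then have xs: "x + s \<in> S" using S(1) s unfolding is_interval_1 by (meson add_left_mono le_add_same_cancel1)
      have "\<bar>w x - w (x + s)\<bar> \<le> K * s"
        using lipschitz_onD[OF lip subsetD[OF S(2) x(1)] subsetD[OF S(2) xs]] s by (simp add: dist_real_def)
      also have "\<dots> \<le> K * h" using K s by (intro mult_left_mono)
      finally have "w x - K * h \<le> w (x + s)" by linarith
      moreover have "0 \<le> w (x + s)" using bdd xs S(2) by blast
      ultimately show ?thesis using True xs by (simp add: g'_def datum_def)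
    next
      case False
      have "0 \<le> ?g j (x + s)" using bdd[of "x + s"] S(2) by (auto simp: datum_def)
      then show ?thesis using False by (auto simp: g'_def datum_def)
    qed
  next
    fix j x assume "x \<le> 0" "x + s > 0"
    then have "x \<notin> S'" using S(2) s by (force simp: S'_def)
    then show "g' j x \<le> 0" by (simp add: g'_def datum_def)
  next
    fix j x show "0 \<le> ?g j x" using bdd[of x] S(2) by (auto simp: datum_def)
  qed
  obtain B' where B': "\<And>i u. \<bar>g' i u\<bar> \<le> B'" using g' by (auto simp: regular_def)
  have "((\<lambda>u. integral {u - h..u} (sol g' i)) \<longlongrightarrow> h * limit_value v g') at_top"
    by (rule moving_integral_sol[OF v _ _ h(1), where B = B']) (use g' B' in \<open>auto simp: regular_def\<close>)
  then have "\<forall>\<^sub>F u in at_top. integral {u - h..u} (sol g' i) > h * limit_value v g' - h * (\<epsilon> / 2)"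
    by (rule order_tendstoD) (use h \<epsilon> in auto)
  then show "\<forall>\<^sub>F u in at_top. limit_value v ?g - \<epsilon> \<le> sol ?g i u"
  proof eventually_elim
    case (elim u)
    \<comment> \<open>At every time in the window the shrunken solution lies below the given one at
      the later time \<open>u\<close>, so an average yields a bound at a single point.\<close>
    have "integral {u - h..u} (sol g' i) \<le> integral {u - h..u} (\<lambda>_. sol ?g i u)"
    proof (rule integral_le)
      show "sol g' i integrable_on {u - h..u}"
        using g' B' by (intro sol_integrable) (auto simp: regular_def)
      fix s assume "s \<in> {u - h..u}"
      then show "sol g' i s \<le> sol ?g i u" using mono[of "u - s" s] by simp
    qed auto
    also have "\<dots> = h * sol ?g i u" using h by simp
    finally have "h * (limit_value v g' - \<epsilon> / 2) < h * sol ?g i u"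
      using elim by (simp add: right_diff_distrib)
    then have 1: "limit_value v g' - \<epsilon> / 2 < sol ?g i u" using h by simp
    have "\<bar>limit_value v ?g - limit_value v g'\<bar> \<le>
        (\<Sum>e\<in>E. \<bar>v (src e) * q e\<bar>) / \<bar>mean_length v\<bar> * ((K * lmax + B) * h)"
    proof (rule limit_value_diff_le[OF g g'])
      fix e assume e: "e \<in> E"
      \<comment> \<open>Points of \<open>S\<close> lost in \<open>S'\<close> lie within
        \<open>h\<close> of its right end \<sigma>. There the data differ by at most
        \<open>B\<close>, and elsewhere by at most \<open>K * h\<close>.\<close>
      define \<sigma> where "\<sigma> = Sup S"
      let ?ind = "\<lambda>x. if x \<in> {\<sigma> - h..\<sigma>} then 1 else (0::real)"
      have ind_int: "?ind integrable_on {a..b}" for a b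
        by (rule bounded_borel_integrable[where B = 1]) auto
      have diff: "0 \<le> ?g j x - g' j x \<and> ?g j x - g' j x \<le> K * h + B * ?ind x" for j x
      proof (cases "j \<in> A \<and> x \<in> S")
        case True
        then have x: "0 \<le> w x" "w x \<le> B" using bdd S(2) by auto
        show ?thesis
        proof (cases "x + h \<in> S")
          case True': True
          have "0 \<le> K * h" "0 \<le> B * ?ind x" using K h B by auto
          then show ?thesis using True True' x by (auto simp: datum_def g'_def S'_def max_def)
        next
          case False
          have bS: "bdd_above S" using S(2) by (meson bdd_above_Icc bdd_above_mono)
          have "x \<le> \<sigma>" unfolding \<sigma>_def using True bS by (auto intro: cSup_upper)
          moreover have "\<sigma> \<le> x + h"
            unfolding \<sigma>_def
          proof (rule cSup_least)
            fix y assume "y \<in> S"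
            show "y \<le> x + h"
            proof (rule ccontr)
              assume "\<not> y \<le> x + h"
              then have "x + h \<in> S" using S(1) True \<open>y \<in> S\<close> h unfolding is_interval_1
                by (meson le_add_same_cancel1 less_imp_le not_le)
              then show False using False by simp
            qed
          qed (use True in auto)
          ultimately have "?ind x = 1" by auto
          moreover have "0 \<le> K * h" using K h by simp
          ultimately show ?thesis using True False x by (auto simp: datum_def g'_def S'_def)
        qed
      next
        case False
        moreover have "0 \<le> K * h + B * ?ind x" using K h B by auto
        ultimately show ?thesis by (auto simp: datum_def g'_def S'_def)
      qed
      have int: "(\<lambda>x. ?g (tgt e) x - g' (tgt e) x) integrable_on {- l e..0}"
        using regular_integrable[OF g] regular_integrable[OF g'] by (intro integrable_diff)
      have "integral {- l e..0} (\<lambda>x. ?g (tgt e) x - g' (tgt e) x) \<le>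
            integral {- l e..0} (\<lambda>x. K * h + B * ?ind x)"
        by (rule integral_le[OF int])
           (use diff ind_int in \<open>auto intro!: integrable_add integrable_cmul[where 'b = real, simplified]\<close>)
      also have "\<dots> = K * h * l e + B * integral {- l e..0} ?ind"
        using l_pos[OF e] ind_int
        by (subst integral_add) (auto intro!: integrable_cmul[where 'b = real, simplified])
      also have "\<dots> \<le> K * h * lmax + B * h"
        using lmax(2)[OF e] K B h integral_indicator_Icc_le[of h "- l e" 0 \<sigma>]
        by (intro add_mono mult_left_mono) auto
      finally have "integral {- l e..0} (\<lambda>x. ?g (tgt e) x - g' (tgt e) x) \<le> (K * lmax + B) * h"
        by (simp add: algebra_simps)
      moreover have "0 \<le> integral {- l e..0} (\<lambda>x. ?g (tgt e) x - g' (tgt e) x)"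
        by (rule integral_nonneg[OF int]) (use diff in auto)
      ultimately show "\<bar>integral {- l e..0} (\<lambda>x. ?g (tgt e) x - g' (tgt e) x)\<bar> \<le> (K * lmax + B) * h"
        by simp
    qed
    also have "\<dots> = C * h" by (simp add: C_def)
    finally show ?case using 1 h(2) by linarith
  qed
qed

text \<open>The upper bound is the lower bound for the complementary datum, because constants solve the
  renewal equation.\<close>

theorem renewal_theorem:
  assumes v: "invariant v" "mean_length v \<noteq> 0"
    and f: "solves 0 f" and J: "is_interval J" and w: "continuous_on UNIV w"
    and nonneg: "\<And>x. 0 \<le> w x" and lip: "K-lipschitz_on {- lmax..0} w"
    and init: "\<And>j x. - lmax \<le> x \<Longrightarrow> x \<le> 0 \<Longrightarrow> f j x = (if j = r \<and> x \<in> J then w x else 0)"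
  shows "(f i \<longlongrightarrow> (\<Sum>e\<in>E. v (src e) * q e * (if tgt e = r then integral ({- l e..0} \<inter> J) w else 0))
          / mean_length v) at_top"
proof -
  define B where "B = w 0 + K * lmax"
  have K: "K \<ge> 0" using lip lipschitz_on_nonneg by blast
  have bdd: "0 \<le> w x \<and> w x \<le> B" if "x \<in> {- lmax..0}" for x
  proof -
    have "\<bar>w x - w 0\<bar> \<le> K * \<bar>x\<bar>"
      using lipschitz_onD[OF lip, of x 0] that lmax(1) by (auto simp: dist_real_def)
    also have "\<dots> \<le> K * lmax" using that K by (intro mult_left_mono) auto
    finally show ?thesis using nonneg by (simp add: B_def)
  qed
  have B0: "B \<ge> 0" using nonneg K lmax(1) by (simp add: B_def)
  define S where "S = {- lmax..0} \<inter> J"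
  \<comment> \<open>The lower bound is available for intervals only, so the complement of
    \<open>S\<close> in the window is split into the part to its left and the part to its right. For
    empty \<open>S\<close> everything falls into \<open>S1\<close>.\<close>
  define S1 where "S1 = {x \<in> {- lmax..0}. \<forall>y\<in>S. x < y}"
  define S2 where "S2 = {- lmax..0} - S - S1"
  have S: "is_interval S" "S \<subseteq> {- lmax..0}" unfolding S_def using J by (auto intro: is_interval_Int is_interval_cc)
  have S1: "is_interval S1" "S1 \<subseteq> {- lmax..0}"
    unfolding is_interval_1 S1_def by force+
  have S2: "is_interval S2" "S2 \<subseteq> {- lmax..0}"
  proof -
    show "is_interval S2" unfolding is_interval_1
    proof (intro ballI allI impI)
      fix a b x assume *: "a \<in> S2" "b \<in> S2" "a \<le> x \<and> x \<le> b"
      then obtain y where y: "y \<in> S" "y \<le> a" by (auto simp: S2_def S1_def not_less)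
      have "x \<notin> S"
      proof
        assume "x \<in> S"
        then have "a \<in> S" using S(1) y * unfolding is_interval_1 by blast
        then show False using * by (simp add: S2_def)
      qed
      moreover have "x \<notin> S1" using y * by (force simp: S1_def)
      ultimately show "x \<in> S2" using * by (auto simp: S2_def)
    qed
  qed (auto simp: S2_def)
  let ?g = "datum {r} S w"
  have const: "lower_regular v (datum A T (\<lambda>_. B))" if "is_interval T" "T \<subseteq> {- lmax..0}" for A T
    by (rule lower_regular_datum[OF v that, where B = B and K = 0]) (use B0 in \<open>auto simp: lipschitz_on_constant\<close>)
  have diff: "lower_regular v (datum {r} S (\<lambda>x. B - w x))"
  proof (rule lower_regular_datum[OF v S, where B = B and K = K])
    show "K-lipschitz_on {- lmax..0} (\<lambda>x. B - w x)"
      using lip by (auto simp: lipschitz_on_def dist_real_def abs_minus_commute)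
  qed (use w bdd nonneg in \<open>auto intro!: continuous_intros\<close>)
  \<comment> \<open>The pieces complete the datum to the constant \<open>B\<close> on the window:
    the missing height on \<open>S\<close>, all other types, and both sides of \<open>S\<close> for
    the type \<open>r\<close>.\<close>
  define rest where "rest = (\<lambda>i u. datum {r} S (\<lambda>x. B - w x) i u + (datum (- {r}) {- lmax..0} (\<lambda>_. B) i u
      + (datum {r} S1 (\<lambda>_. B) i u + datum {r} S2 (\<lambda>_. B) i u)))"
  have rest: "lower_regular v rest"
    unfolding rest_def by (intro lower_regular_add diff const S1 S2) (auto simp: is_interval_cc)
  have low: "lower_regular v ?g"
    by (rule lower_regular_datum[OF v S w bdd lip])
  have reg: "regular ?g" "regular rest" using low rest by (auto simp: lower_regular_def)
  have total: "?g j x + rest j x = B" if "x \<in> {- lmax..0}" for j x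
    using that S(2) S1(2) by (auto simp: rest_def datum_def S2_def S1_def)
  have lv: "limit_value v ?g + limit_value v rest = B"
  proof -
    have "integral {- l e..0} (\<lambda>x. ?g (tgt e) x + rest (tgt e) x) = l e * B" if "e \<in> E" for e
    proof -
      have "integral {- l e..0} (\<lambda>x. ?g (tgt e) x + rest (tgt e) x) = integral {- l e..0} (\<lambda>_. B)"
        by (rule integral_cong) (use total lmax(2)[OF that] in auto)
      then show ?thesis using l_pos[OF that] by simp
    qed
    then have "limit_value v (\<lambda>i u. ?g i u + rest i u) = (\<Sum>e\<in>E. v (src e) * q e * (l e * B)) / mean_length v"
      unfolding limit_value_def by simp
    also have "(\<Sum>e\<in>E. v (src e) * q e * (l e * B)) = mean_length v * B"
      by (simp add: mean_length_def sum_distrib_right mult.assoc)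
    finally show ?thesis using v(2) by (simp add: limit_value_add[OF reg])
  qed
  \<comment> \<open>By uniqueness the sum of both solutions is the constant \<open>B\<close>, so a
    lower bound for \<open>rest\<close> is an upper bound for the given datum.\<close>
  have sol_total: "sol ?g i u + sol rest i u = B" if "u \<ge> 0" for u
  proof -
    have "sol (\<lambda>i u. ?g i u + rest i u) i u = B"
    proof (rule solves_unique[where f' = "\<lambda>_ _. B", OF solves_sol])
      show "solves 0 (\<lambda>_ _. B)" by (simp add: solves_def avg_const)
    qed (use total that lmax(1) in \<open>auto simp: sol_init\<close>)
    then show ?thesis by (simp add: sol_add)
  qed
  have f_eq: "f i u = sol ?g i u" if "u \<ge> 0" for u
    by (rule solves_unique[OF f solves_sol])
       (use that lmax(1) init in \<open>auto simp: sol_init datum_def S_def\<close>)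
  have "(f i \<longlongrightarrow> limit_value v ?g) at_top"
  proof (rule tendstoI)
    fix \<epsilon> :: real assume \<epsilon>: "\<epsilon> > 0"
    then have "\<forall>\<^sub>F u in at_top. limit_value v ?g - \<epsilon>/2 \<le> sol ?g i u"
      "\<forall>\<^sub>F u in at_top. limit_value v rest - \<epsilon>/2 \<le> sol rest i u"
      using low rest unfolding lower_regular_def by (metis half_gt_zero)+
    then show "\<forall>\<^sub>F u in at_top. dist (f i u) (limit_value v ?g) < \<epsilon>"
      using eventually_ge_at_top[of 0]
    proof eventually_elim
      case (elim u)
      then show ?case using sol_total[of u] f_eq[of u] lv \<epsilon> by (simp add: dist_real_def abs_less_iff)
    qed
  qed
  moreover have "integral {- l e..0} (?g (tgt e)) = (if tgt e = r then integral ({- l e..0} \<inter> J) w else 0)"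
    if "e \<in> E" for e
  proof -
    have "integral {- l e..0} (?g r) = integral {- l e..0} (\<lambda>x. if x \<in> J then w x else 0)"
      by (rule integral_cong) (use lmax(2)[OF that] in \<open>auto simp: datum_def S_def\<close>)
    moreover have "integral {- l e..0} (?g (tgt e)) = 0" if "tgt e \<noteq> r"
    proof -
      have "integral {- l e..0} (?g (tgt e)) = integral {- l e..0} (\<lambda>_. 0)"
        by (rule integral_cong) (use that in \<open>simp add: datum_def\<close>)
      then show ?thesis by simp
    qed
    ultimately show ?thesis by (auto simp: integral_restrict_Int Int_commute)
  qed
  ultimately show ?thesis by (simp add: limit_value_def)
qed

end

section \<open>Constant sign of invariant vectors\<close>

context renewal
begin

lemma sum_over_src: "(\<Sum>e\<in>E. x (src e) * q e) = (\<Sum>i\<in>UNIV. x i)"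
proof -
  have "(\<Sum>e\<in>E. x (src e) * q e) = (\<Sum>i\<in>UNIV. \<Sum>e | e \<in> E \<and> src e = i. x (src e) * q e)"
    by (rule sum.group[symmetric]) (auto simp: finE)
  also have "\<dots> = (\<Sum>i\<in>UNIV. x i * (\<Sum>e | e \<in> E \<and> src e = i. q e))"
    unfolding sum_distrib_left by (intro sum.cong) auto
  finally show ?thesis by (simp add: q_sum)
qed

text \<open>The triangle inequality makes the absolute values subinvariant at each vertex. Summed
  over all vertices both sides agree, since the weights leaving each vertex sum to 1; hence equality
  holds everywhere.\<close>

lemma invariant_abs:
  assumes "invariant v"
  shows "invariant (\<lambda>i. \<bar>v i\<bar>)"
proof -
  let ?d = "\<lambda>j. (\<Sum>e | e \<in> E \<and> tgt e = j. \<bar>v (src e)\<bar> * q e) - \<bar>v j\<bar>"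
  have "?d j \<ge> 0" for j
  proof -
    have "\<bar>v j\<bar> \<le> (\<Sum>e | e \<in> E \<and> tgt e = j. \<bar>v (src e) * q e\<bar>)"
      using assms sum_abs[of "\<lambda>e. v (src e) * q e" "{e \<in> E. tgt e = j}"] by (simp add: invariant_def)
    also have "\<dots> = (\<Sum>e | e \<in> E \<and> tgt e = j. \<bar>v (src e)\<bar> * q e)"
      by (intro sum.cong) (use q_pos in \<open>auto simp: abs_mult less_imp_le\<close>)
    finally show ?thesis by simp
  qed
  moreover have "(\<Sum>j\<in>UNIV. ?d j) = 0"
  proof -
    have "(\<Sum>j\<in>UNIV. \<Sum>e | e \<in> E \<and> tgt e = j. \<bar>v (src e)\<bar> * q e) = (\<Sum>e\<in>E. \<bar>v (src e)\<bar> * q e)"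
      by (rule sum.group) (auto simp: finE)
    then show ?thesis using sum_over_src[of "\<lambda>i. \<bar>v i\<bar>"] by (simp add: sum_subtractf)
  qed
  ultimately have "?d j = 0" for j
    using sum_nonneg_eq_0_iff[of UNIV ?d] by simp
  then show ?thesis by (simp add: invariant_def)
qed

text \<open>A sum of nonnegative terms vanishes only termwise, so a zero at the head of an arc moves
  to its tail.\<close>

lemma invariant_zero:
  assumes "invariant w" "\<And>i. w i \<ge> 0"
  shows "path i n s j \<Longrightarrow> w j = 0 \<Longrightarrow> w i = 0"
proof (induction rule: path.induct)
  case (Cons e n s j)
  have "w (src e) * q e \<le> (\<Sum>e' | e' \<in> E \<and> tgt e' = tgt e. w (src e') * q e')"
    by (rule member_le_sum) (use Cons finE assms(2) q_pos in \<open>auto intro!: mult_nonneg_nonneg simp: less_imp_le\<close>)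
  also have "\<dots> = 0" using assms(1) Cons by (simp add: invariant_def)
  finally show ?case using assms(2)[of "src e"] q_pos[OF Cons.hyps(1)]
    by (simp add: mult_le_0_iff)
qed

end

text \<open>One of \<open>|v| - v\<close> and \<open>|v| + v\<close> vanishes at \<open>k\<close>.
  Both are nonnegative and invariant, so by connectedness that one vanishes identically and
  \<open>v\<close> has constant sign. The mean length is then, up to sign, a sum of positive
  terms.\<close>

lemma (in nonlattice_renewal) mean_length_nonzero:
  assumes v: "invariant v" and nz: "v k \<noteq> 0"
  shows "mean_length v \<noteq> 0"
proof -
  let ?a = "\<lambda>i. \<bar>v i\<bar>"
  have a: "invariant ?a" by (rule invariant_abs[OF v])
  have zero: "w i = 0" if "invariant w" "\<And>i. w i \<ge> 0" "w j = 0" for w i j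
  proof -
    obtain n s where "path i n s j" using connected by blast
    then show ?thesis using invariant_zero[OF that(1,2)] that(3) by blast
  qed
  have pos: "?a i > 0" for i 
    using zero[OF a, where i = k and j = i] nz by (metis abs_ge_zero abs_eq_0 less_eq_real_def)
  have E_mean: "mean_length ?a > 0" unfolding mean_length_def
    by (rule sum_pos) (use finE E_nonempty pos q_pos l_pos in auto)
  have "invariant (\<lambda>i. ?a i - v i)" "invariant (\<lambda>i. ?a i + v i)"
    using a v by (simp_all add: invariant_def left_diff_distrib distrib_right sum_subtractf sum.distrib)
  note inv = this
  have "(\<forall>i. ?a i = v i) \<or> (\<forall>i. ?a i = - v i)"
  proof (cases "v k \<ge> 0")
    case True
    then have "?a i - v i = 0" for i by (intro zero[OF inv(1), of k i]) auto
    then show ?thesis by simp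
  next
    case False
    then have "?a i + v i = 0" for i by (intro zero[OF inv(2), of k i]) (auto simp: abs_if)
    then show ?thesis by (metis add_eq_0_iff2)
  qed
  moreover have "mean_length (\<lambda>i. - v i) = - mean_length v"
    by (simp add: mean_length_def sum_negf)
  ultimately have "mean_length ?a = mean_length v \<or> mean_length ?a = - mean_length v" by auto
  then show ?thesis using E_mean by auto
qed

section \<open>Substitution of tiles\<close>

lemma similarity_measurable:
  fixes f :: "real^'d::{finite,wellorder} \<Rightarrow> real^'d::_"
  assumes c: "c > 0" and f: "similarity_map c f" and A: "A \<in> lmeasurable"
  shows "f ` A \<in> lmeasurable"
proof -
  define h where "h x = f (x /\<^sub>R c) - f 0" for x
  have "orthogonal_transformation h"
    unfolding orthogonal_transformation_isometry
  proof (intro conjI allI)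
    fix x y
    have "dist (h x) (h y) = dist (f (x /\<^sub>R c)) (f (y /\<^sub>R c))" by (simp add: h_def dist_norm)
    also have "\<dots> = c * dist (x /\<^sub>R c) (y /\<^sub>R c)" using f by (simp add: similarity_map_def)
    also have "\<dots> = dist x y" using c by (simp add: dist_norm flip: scaleR_diff_right)
    finally show "dist (h x) (h y) = dist x y" .
  qed (simp add: h_def)
  then have "linear h" by (rule orthogonal_transformation_linear)
  then have lin: "linear (\<lambda>x. h (c *\<^sub>R x))"
    by (rule linear_compose[unfolded o_def, rotated]) (simp add: linear_scaleR)
  have "f ` A = (+) (f 0) ` (\<lambda>x. h (c *\<^sub>R x)) ` A"
    using c by (simp add: image_image h_def)
  then show ?thesis
    using measurable_translation measurable_linear_image[OF lin A] by metis
qed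

lemma similarity_negligible:
  fixes f :: "real^'d::finite \<Rightarrow> real^'d"
  assumes f: "similarity_map c f" and A: "negligible A"
  shows "negligible (f ` A)"
proof (rule negligible_locally_Lipschitz_image[OF _ A])
  fix x
  have "norm (f y - f x) \<le> c * norm (y - x)" for y
    using f by (simp add: similarity_map_def flip: dist_norm)
  then show "\<exists>T B. open T \<and> x \<in> T \<and> (\<forall>y\<in>A \<inter> T. norm (f y - f x) \<le> B * norm (y - x))"
    by blast
qed simp

lemma similarity_inj: "c > 0 \<Longrightarrow> similarity_map c f \<Longrightarrow> inj f"
  unfolding similarity_map_def inj_def by (metis dist_eq_0_iff mult_eq_0_iff less_irrefl)

lemma similarity_comp:
  "similarity_map a f \<Longrightarrow> similarity_map b g \<Longrightarrow> similarity_map (a * b) (\<lambda>x. f (g x))"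
  by (simp add: similarity_map_def)

lemma similarity_scale: "a > 0 \<Longrightarrow> similarity_map a ((*\<^sub>R) a)"
  by (simp add: similarity_map_def dist_norm flip: scaleR_diff_right)

lemma isometric_scale: "isometric_map g \<Longrightarrow> a > 0 \<Longrightarrow> similarity_map a (\<lambda>x. g (a *\<^sub>R x))"
  by (simp add: similarity_map_def isometric_map_def dist_norm flip: scaleR_diff_right)

lemma measure_Union_negligible:
  assumes "sorted_wrt (\<lambda>A B. negligible (A \<inter> B)) As" "\<And>A. A \<in> set As \<Longrightarrow> A \<in> lmeasurable"
  shows "measure lebesgue (\<Union>(set As)) = (\<Sum>A\<leftarrow>As. measure lebesgue A)"
  using assms
proof (induction As)
  case (Cons A As)
  have neg: "negligible (A \<inter> \<Union>(set As))"
    unfolding Int_Union using Cons.prems(1) by (intro negligible_Union) auto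
  have "AE x in lebesgue. x \<notin> A \<inter> \<Union>(set As)"
    by (rule AE_not_in) (use neg negligible_iff_null_sets in blast)
  then have "measure lebesgue (A \<union> \<Union>(set As)) = measure lebesgue A + measure lebesgue (\<Union>(set As))"
    by (intro measure_Un_AE fmeasurable.finite_Union) (use Cons.prems(2) in auto)
  then show ?case using Cons by simp
qed simp

lemma expectation_finite:
  "finite (set_pmf p) \<Longrightarrow> measure_pmf.expectation p h = (\<Sum>x\<in>set_pmf p. pmf p x * (h x :: real))"
  by (subst integral_measure_pmf[of "set_pmf p"]) auto

lemma expectation_bind_finite:
  fixes h :: "'b \<Rightarrow> real"
  assumes "finite (set_pmf p)" "\<And>x. x \<in> set_pmf p \<Longrightarrow> finite (set_pmf (f x))"
  shows "measure_pmf.expectation (bind_pmf p f) h =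
    (\<Sum>x\<in>set_pmf p. pmf p x * measure_pmf.expectation (f x) h)"
  using pmf_expectation_bind[of "set_pmf p" f p h] assms by simp

section \<open>The renewal equation of a substitution system\<close>

locale normalized_rss =
  fixes \<Sigma> :: "('d::{finite,wellorder}, 'n::finite) rss"
  assumes rss: "random_substitution_system \<Sigma>" and normal: "normalized \<Sigma>"
begin

abbreviation "A \<equiv> arcs (assoc_graph \<Sigma>)"

definition arc_vol :: "'n \<times> nat \<times> nat \<Rightarrow> real" where
  "arc_vol = (\<lambda>(i, k, m). measure lebesgue (snd (subst_tiles \<Sigma> i k ! m)))"

definition arc_prob :: "'n \<times> nat \<times> nat \<Rightarrow> real" where
  "arc_prob = (\<lambda>(i, k, m). pmf (rule_pmf \<Sigma> i) k)"

abbreviation "src \<equiv> tail (assoc_graph \<Sigma>)"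
abbreviation "tgt \<equiv> head (assoc_graph \<Sigma>)"

lemma proto: "proto \<Sigma> i \<in> lmeasurable" "measure lebesgue (proto \<Sigma> i) = 1"
  using rss normal by (auto simp: random_substitution_system_def is_tile_def normalized_def)

lemma set_rule_pmf: "set_pmf (rule_pmf \<Sigma> i) = {1..num_rules \<Sigma> i}"
  using rss by (simp add: random_substitution_system_def)

lemma rule_entry:
  assumes "k \<in> {1..num_rules \<Sigma> i}" "(j, \<alpha>, g) \<in> set (rule \<Sigma> i k)"
  shows "0 < \<alpha>" "\<alpha> < 1" "isometric_map g"
  using rss assms unfolding random_substitution_system_def by fast+

lemma arcs_iff: "(i, k, m) \<in> A \<longleftrightarrow> k \<in> {1..num_rules \<Sigma> i} \<and> m < length (rule \<Sigma> i k)"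
  by (simp add: assoc_graph_def subst_tiles_def)

lemma arc_vol_eq:
  assumes "k \<in> {1..num_rules \<Sigma> i}" "m < length (rule \<Sigma> i k)" "rule \<Sigma> i k ! m = (j, \<alpha>, g)"
  shows "arc_vol (i, k, m) = \<alpha> ^ CARD('d)" "tgt (i, k, m) = j"
proof -
  have "\<alpha> > 0" using rule_entry(1)[OF assms(1)] nth_mem[OF assms(2)] assms(3) by metis
  then show "arc_vol (i, k, m) = \<alpha> ^ CARD('d)"
    using measure_similarity_image[OF _ similarity_scale proto(1)[of j], of \<alpha>] assms proto(2)
    by (simp add: arc_vol_def subst_tiles_def)
qed (use assms in \<open>simp add: assoc_graph_def subst_tiles_def\<close>)

lemma src_eq: "src (i, k, m) = i" by (simp add: assoc_graph_def)

lemma arc_vol_bounds: "e \<in> A \<Longrightarrow> 0 < arc_vol e" "e \<in> A \<Longrightarrow> arc_vol e < 1"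
proof -
  assume e: "e \<in> A"
  obtain i k m where e': "e = (i, k, m)" by (cases e)
  obtain j \<alpha> g where jag: "rule \<Sigma> i k ! m = (j, \<alpha>, g)" by (cases "rule \<Sigma> i k ! m")
  have km: "k \<in> {1..num_rules \<Sigma> i}" "m < length (rule \<Sigma> i k)" using e by (auto simp: e' arcs_iff)
  then have "0 < \<alpha>" "\<alpha> < 1" using rule_entry[OF km(1)] nth_mem[OF km(2)] jag by metis+
  then show "0 < arc_vol e" "arc_vol e < 1"
    using arc_vol_eq(1)[OF km jag] by (auto simp: e' power_less_one_iff)
qed

lemma arc_prob_pos: "e \<in> A \<Longrightarrow> 0 < arc_prob e"
  using set_rule_pmf by (cases e) (auto simp: arc_prob_def arcs_iff pmf_positive_iff)

lemma finite_arcs: "finite A"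
proof -
  have "A = (SIGMA i:UNIV. SIGMA k:{1..num_rules \<Sigma> i}. {..<length (rule \<Sigma> i k)})"
    by (auto simp: arcs_iff)
  then show ?thesis by auto
qed

lemma sum_arcs_from:
  "(\<Sum>e | e \<in> A \<and> src e = i. F e) = (\<Sum>k = 1..num_rules \<Sigma> i. \<Sum>m<length (rule \<Sigma> i k). F (i, k, m))"
proof -
  let ?B = "SIGMA k:{1..num_rules \<Sigma> i}. {..<length (rule \<Sigma> i k)}"
  have "{e. e \<in> A \<and> src e = i} = Pair i ` ?B"
    by (auto simp: arcs_iff src_eq image_iff)
  then have "(\<Sum>e | e \<in> A \<and> src e = i. F e) = (\<Sum>p\<in>?B. F (i, p))"
    by (simp add: sum.reindex inj_on_def)
  also have "\<dots> = (\<Sum>k = 1..num_rules \<Sigma> i. \<Sum>m<length (rule \<Sigma> i k). F (i, k, m))"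
    by (subst sum.Sigma) (auto intro: sum.cong)
  finally show ?thesis .
qed

text \<open>The pieces of a rule partition a prototile of volume 1 up to null sets. This is what
  makes \<open>arc_prob e * arc_vol e\<close> a probability distribution on the arcs leaving a
  type.\<close>

lemma sum_arc_vol:
  assumes k: "k \<in> {1..num_rules \<Sigma> i}"
  shows "(\<Sum>m<length (rule \<Sigma> i k). arc_vol (i, k, m)) = 1"
proof -
  let ?piece = "\<lambda>(j, \<alpha>, g). g ` ((*\<^sub>R) \<alpha> ` proto \<Sigma> j)"
  let ?As = "map ?piece (rule \<Sigma> i k)"
  have part: "is_partition (proto \<Sigma> i) ?As"
    using rss k unfolding random_substitution_system_def by blast
  have piece: "?piece x \<in> lmeasurable" if "x \<in> set (rule \<Sigma> i k)" for x
  proof -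
    obtain j \<alpha> g where x: "x = (j, \<alpha>, g)" by (cases x)
    have "(\<lambda>y. g (\<alpha> *\<^sub>R y)) ` proto \<Sigma> j \<in> lmeasurable"
      using rule_entry[OF k that[unfolded x]]
      by (intro similarity_measurable[of \<alpha>] isometric_scale proto(1)) auto
    then show ?thesis by (simp add: x image_image)
  qed
  have "1 = measure lebesgue (\<Union>(set ?As))"
    using measure_negligible_symdiff[OF proto(1), of i "\<Union>(set ?As)"] part proto(2)[of i]
    by (simp add: is_partition_def)
  also have "\<dots> = (\<Sum>B\<leftarrow>?As. measure lebesgue B)"
    by (rule measure_Union_negligible)
       (use part piece in \<open>auto simp: is_partition_def sorted_wrt_iff_nth_less\<close>)
  also have "\<dots> = (\<Sum>m<length (rule \<Sigma> i k). measure lebesgue (?piece (rule \<Sigma> i k ! m)))"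
    by (simp add: sum_list_sum_nth atLeast0LessThan)
  also have "\<dots> = (\<Sum>m<length (rule \<Sigma> i k). arc_vol (i, k, m))"
  proof (rule sum.cong)
    fix m assume "m \<in> {..<length (rule \<Sigma> i k)}"
    then have m: "m < length (rule \<Sigma> i k)" by simp
    obtain j \<alpha> g where x: "rule \<Sigma> i k ! m = (j, \<alpha>, g)" by (cases "rule \<Sigma> i k ! m")
    have \<alpha>: "0 < \<alpha>" "isometric_map g" using rule_entry[OF k] nth_mem[OF m] x by metis+
    have "measure lebesgue ((\<lambda>y. g (\<alpha> *\<^sub>R y)) ` proto \<Sigma> j) = \<alpha> ^ CARD('d)"
      using measure_similarity_image[OF \<alpha>(1) isometric_scale[OF \<alpha>(2,1)] proto(1)] proto(2) by simp
    then show "measure lebesgue (?piece (rule \<Sigma> i k ! m)) = arc_vol (i, k, m)"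
      using arc_vol_eq(1)[OF k m x] by (simp add: x image_image)
  qed simp
  finally show ?thesis by simp
qed

sublocale renewal A src tgt "\<lambda>e. arc_prob e * arc_vol e" "arc_length \<Sigma>"
proof
  show "finite A" by (rule finite_arcs)
  show "0 < arc_prob e * arc_vol e" if "e \<in> A" for e
    using arc_prob_pos arc_vol_bounds that by simp
  show "0 < arc_length \<Sigma> e" if "e \<in> A" for e
  proof -
    have "arc_length \<Sigma> e = ln (1 / arc_vol e)"
      by (cases e) (simp add: arc_length_def arc_vol_def)
    then show ?thesis using arc_vol_bounds[OF that] by simp
  qed
  show "(\<Sum>e | e \<in> A \<and> src e = i. arc_prob e * arc_vol e) = 1" for i
  proof -
    have "(\<Sum>e | e \<in> A \<and> src e = i. arc_prob e * arc_vol e) =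
        (\<Sum>k = 1..num_rules \<Sigma> i. pmf (rule_pmf \<Sigma> i) k * (\<Sum>m<length (rule \<Sigma> i k). arc_vol (i, k, m)))"
      unfolding sum_arcs_from by (simp add: arc_prob_def sum_distrib_left)
    also have "\<dots> = (\<Sum>k = 1..num_rules \<Sigma> i. pmf (rule_pmf \<Sigma> i) k)"
      by (simp add: sum_arc_vol)
    also have "\<dots> = 1" by (rule sum_pmf_eq_1) (use set_rule_pmf in auto)
    finally show ?thesis .
  qed
qed

lemma arc_length_eq: "arc_length \<Sigma> e = - ln (arc_vol e)"
  by (cases e) (simp add: arc_length_def arc_vol_def ln_div)

lemma weighted_matrix_eq:
  "weighted_matrix \<Sigma> h $ i $ j = (\<Sum>e | e \<in> A \<and> src e = i. if tgt e = j then arc_prob e * h (arc_vol e) else 0)"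
proof -
  have "(\<Sum>T\<leftarrow>filter (\<lambda>T. fst T = j) (subst_tiles \<Sigma> i k). h (measure lebesgue (snd T))) =
      (\<Sum>m<length (rule \<Sigma> i k). if tgt (i, k, m) = j then h (arc_vol (i, k, m)) else 0)" for k
    unfolding sum_list_map_filter'
    unfolding sum_list_sum_nth
    by (rule sum.cong) (auto simp: subst_tiles_def arc_vol_def assoc_graph_def)
  then show ?thesis
    unfolding sum_arcs_from
    by (auto simp: weighted_matrix_def arc_prob_def sum_distrib_left intro!: sum.cong)
qed

lemma vector_weighted_matrix:
  "(v v* weighted_matrix \<Sigma> h) $ r = (\<Sum>e\<in>A. v $ src e * (if tgt e = r then arc_prob e * h (arc_vol e) else 0))"
proof -
  have "(v v* weighted_matrix \<Sigma> h) $ r =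
      (\<Sum>i\<in>UNIV. \<Sum>e | e \<in> A \<and> src e = i. v $ src e * (if tgt e = r then arc_prob e * h (arc_vol e) else 0))"
    unfolding vector_matrix_mult_def weighted_matrix_eq
    by (auto simp: sum_distrib_left sum_distrib_right mult.commute intro!: sum.cong)
  also have "\<dots> = (\<Sum>e\<in>A. v $ src e * (if tgt e = r then arc_prob e * h (arc_vol e) else 0))"
    by (rule sum.group) (auto simp: finite_arcs)
  finally show ?thesis .
qed

text \<open>As \<open>arc_length \<Sigma> e = - ln (arc_vol e)\<close>, the entropy term of an arc
  is its weight times its length.\<close>

lemma inner_H_mat: "v \<bullet> (H_mat \<Sigma> *v 1) = mean_length (\<lambda>i. v $ i)"
proof -
  have "v \<bullet> (H_mat \<Sigma> *v 1) = (\<Sum>r\<in>UNIV. (v v* H_mat \<Sigma>) $ r)"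
    unfolding dot_lmul_matrix[symmetric] by (simp add: inner_vec_def)
  also have "\<dots> = (\<Sum>e\<in>A. \<Sum>r\<in>UNIV. v $ src e * (if tgt e = r then arc_prob e * (- arc_vol e * ln (arc_vol e)) else 0))"
    unfolding H_mat_def vector_weighted_matrix by (rule sum.swap)
  also have "\<dots> = mean_length (\<lambda>i. v $ i)"
    unfolding mean_length_def by (rule sum.cong) (auto simp: arc_length_eq simp flip: sum_distrib_left)
  finally show ?thesis .
qed

section \<open>Placed tiles and almost disjoint patches\<close>

definition proper :: "('d, 'n) tile \<Rightarrow> bool" where
  "proper T \<longleftrightarrow> (\<exists>c>0. similarity_map c (snd T))"

text \<open>The condition compares positions in the list, so it also excludes a repeated tile of
  positive volume. This is needed to equate the volume of a union with a sum over the list.\<close>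

definition ae_disjoint :: "('d, 'n) patch \<Rightarrow> bool" where
  "ae_disjoint P \<longleftrightarrow> sorted_wrt (\<lambda>T T'. negligible (region \<Sigma> T \<inter> region \<Sigma> T')) P"

lemma tile_vol_eq: "c > 0 \<Longrightarrow> similarity_map c (snd T) \<Longrightarrow> tile_vol \<Sigma> T = c ^ CARD('d)"
  using measure_similarity_image[OF _ _ proto(1)] proto(2) by (simp add: tile_vol_def region_def)

lemma proper_measurable: "proper T \<Longrightarrow> region \<Sigma> T \<in> lmeasurable"
  unfolding proper_def region_def using similarity_measurable[OF _ _ proto(1)] by blast

lemma proper_vol_pos: "proper T \<Longrightarrow> tile_vol \<Sigma> T > 0"
  unfolding proper_def using tile_vol_eq by fastforce

lemma
  assumes T: "proper T" and k: "k \<in> {1..num_rules \<Sigma> (fst T)}"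
    and m: "m < length (rule \<Sigma> (fst T) k)"
  shows apply_rule_proper: "proper (apply_rule \<Sigma> k T ! m)"
    and apply_rule_type: "fst (apply_rule \<Sigma> k T ! m) = tgt (fst T, k, m)"
    and apply_rule_vol: "tile_vol \<Sigma> (apply_rule \<Sigma> k T ! m) = tile_vol \<Sigma> T * arc_vol (fst T, k, m)"
proof -
  obtain j \<alpha> g where x: "rule \<Sigma> (fst T) k ! m = (j, \<alpha>, g)" by (cases "rule \<Sigma> (fst T) k ! m")
  have \<alpha>: "0 < \<alpha>" "isometric_map g" using rule_entry[OF k] nth_mem[OF m] x by metis+
  obtain c where c: "c > 0" "similarity_map c (snd T)" using T by (auto simp: proper_def)
  have C: "apply_rule \<Sigma> k T ! m = (j, \<lambda>x. snd T (g (\<alpha> *\<^sub>R x)))"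
    using m x by (simp add: apply_rule_def)
  have sim: "similarity_map (c * \<alpha>) (snd (apply_rule \<Sigma> k T ! m))"
    unfolding C using similarity_comp[OF c(2) isometric_scale[OF \<alpha>(2,1)]] by simp
  then show "proper (apply_rule \<Sigma> k T ! m)"
    unfolding proper_def using c \<alpha> by (intro exI[of _ "c * \<alpha>"]) auto
  show "fst (apply_rule \<Sigma> k T ! m) = tgt (fst T, k, m)"
    using arc_vol_eq(2)[OF k m x] by (simp add: C)
  show "tile_vol \<Sigma> (apply_rule \<Sigma> k T ! m) = tile_vol \<Sigma> T * arc_vol (fst T, k, m)"
    using tile_vol_eq[OF _ sim] tile_vol_eq[OF c] arc_vol_eq(1)[OF k m x] c \<alpha>
    by (simp add: power_mult_distrib)
qed

lemma length_apply_rule: "length (apply_rule \<Sigma> k T) = length (rule \<Sigma> (fst T) k)"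
  by (simp add: apply_rule_def)

lemma set_substitute_tile:
  assumes "Q \<in> set_pmf (substitute_tile \<Sigma> T)"
  obtains "Q = [T]" | k where "k \<in> {1..num_rules \<Sigma> (fst T)}" "Q = apply_rule \<Sigma> k T"
  using assms set_rule_pmf by (auto simp: substitute_tile_def split: if_splits)

text \<open>The placement is injective and maps null sets to null sets, so it transports the
  partition of the prototile. Containment in the parent tile is recorded in order to separate
  descendants of different tiles.\<close>

lemma apply_rule_disjoint:
  assumes T: "proper T" and k: "k \<in> {1..num_rules \<Sigma> (fst T)}"
  shows "ae_disjoint (apply_rule \<Sigma> k T)"
    and "C \<in> set (apply_rule \<Sigma> k T) \<Longrightarrow> negligible (region \<Sigma> C - region \<Sigma> T)"
proof -
  let ?i = "fst T"
  let ?As = "map (\<lambda>(j, \<alpha>, g). g ` ((*\<^sub>R) \<alpha> ` proto \<Sigma> j)) (rule \<Sigma> ?i k)"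
  obtain c where c: "c > 0" "similarity_map c (snd T)" using T by (auto simp: proper_def)
  have inj: "inj (snd T)" by (rule similarity_inj[OF c])
  have part: "is_partition (proto \<Sigma> ?i) ?As"
    using rss k unfolding random_substitution_system_def by blast
  have region: "region \<Sigma> (apply_rule \<Sigma> k T ! m) = snd T ` (?As ! m)"
    if "m < length (rule \<Sigma> ?i k)" for m
    using that by (cases "rule \<Sigma> ?i k ! m") (simp add: apply_rule_def region_def image_image)
  have "\<forall>a<length ?As. \<forall>b<length ?As. a \<noteq> b \<longrightarrow> negligible (?As ! a \<inter> ?As ! b)"
    using part unfolding is_partition_def by blast
  note disj = this[rule_format]
  show "ae_disjoint (apply_rule \<Sigma> k T)"
    unfolding ae_disjoint_def sorted_wrt_iff_nth_less
  proof (intro allI impI)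
    fix a b assume ab: "a < b" "b < length (apply_rule \<Sigma> k T)"
    then have len: "a < length (rule \<Sigma> ?i k)" "b < length (rule \<Sigma> ?i k)"
      by (simp_all add: length_apply_rule)
    have "negligible (?As ! a \<inter> ?As ! b)"
      by (rule disj) (use len ab in simp_all)
    then have "negligible (snd T ` (?As ! a \<inter> ?As ! b))" by (rule similarity_negligible[OF c(2)])
    then show "negligible (region \<Sigma> (apply_rule \<Sigma> k T ! a) \<inter> region \<Sigma> (apply_rule \<Sigma> k T ! b))"
      unfolding region[OF len(1)] region[OF len(2)] image_Int[OF inj] .
  qed
  assume "C \<in> set (apply_rule \<Sigma> k T)"
  then obtain m where m: "m < length (rule \<Sigma> ?i k)" "C = apply_rule \<Sigma> k T ! m"
    by (auto simp: in_set_conv_nth length_apply_rule)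
  have "?As ! m \<in> set ?As" by (rule nth_mem) (use m in simp)
  then have "?As ! m \<subseteq> \<Union>(set ?As)" by (rule Union_upper)
  moreover have "negligible (\<Union>(set ?As) - proto \<Sigma> ?i)"
    using part unfolding is_partition_def negligible_Un_eq by blast
  ultimately have "negligible (?As ! m - proto \<Sigma> ?i)"
    by (rule negligible_subset[rotated, OF Diff_mono[OF _ order_refl]])
  then have "negligible (snd T ` (?As ! m - proto \<Sigma> ?i))" by (rule similarity_negligible[OF c(2)])
  then show "negligible (region \<Sigma> C - region \<Sigma> T)"
    unfolding m(2) region[OF m(1)] image_set_diff[OF inj] by (simp only: region_def)
qed

lemma substitute_tile_props:
  assumes T: "proper T" and Q: "Q \<in> set_pmf (substitute_tile \<Sigma> T)"
  shows "ae_disjoint Q" "C \<in> set Q \<Longrightarrow> proper C" "C \<in> set Q \<Longrightarrow> negligible (region \<Sigma> C - region \<Sigma> T)"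
proof -
  have "ae_disjoint Q \<and> (\<forall>C\<in>set Q. proper C \<and> negligible (region \<Sigma> C - region \<Sigma> T))"
    using Q
  proof (cases rule: set_substitute_tile)
    case 1
    then show ?thesis using T by (simp add: ae_disjoint_def)
  next
    case (2 k)
    have "proper C" if C: "C \<in> set Q" for C
    proof -
      obtain m where "m < length (rule \<Sigma> (fst T) k)" "C = apply_rule \<Sigma> k T ! m"
        using C by (auto simp: 2(2) in_set_conv_nth length_apply_rule)
      then show ?thesis using apply_rule_proper[OF T 2(1)] by simp
    qed
    then show ?thesis using apply_rule_disjoint[OF T 2(1)] by (simp add: 2(2))
  qed
  then show "ae_disjoint Q" "C \<in> set Q \<Longrightarrow> proper C" "C \<in> set Q \<Longrightarrow> negligible (region \<Sigma> C - region \<Sigma> T)"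
    by auto
qed

lemma negligible_Int_trans:
  assumes "negligible (X - X')" "negligible (Y - Y')" "negligible (X' \<inter> Y')"
  shows "negligible (X \<inter> Y)"
proof (rule negligible_subset)
  show "negligible ((X - X') \<union> (Y - Y') \<union> (X' \<inter> Y'))" using assms by (intro negligible_Un)
qed blast

lemma substitute_patch_props:
  assumes "\<forall>T\<in>set P. proper T" "ae_disjoint P" "Q \<in> set_pmf (substitute_patch \<Sigma> P)"
  shows "ae_disjoint Q \<and> (\<forall>C\<in>set Q. proper C \<and> (\<exists>T\<in>set P. negligible (region \<Sigma> C - region \<Sigma> T)))"
  using assms
proof (induction P arbitrary: Q)
  case Nil then show ?case by (simp add: ae_disjoint_def)
next
  case (Cons T P)
  obtain Q1 Q2 where Q: "Q1 \<in> set_pmf (substitute_tile \<Sigma> T)" "Q2 \<in> set_pmf (substitute_patch \<Sigma> P)"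
    "Q = Q1 @ Q2" using Cons.prems(3) by auto
  have T: "proper T" using Cons.prems by simp
  note p1 = substitute_tile_props[OF T Q(1)]
  have p2: "ae_disjoint Q2 \<and> (\<forall>C\<in>set Q2. proper C \<and> (\<exists>T\<in>set P. negligible (region \<Sigma> C - region \<Sigma> T)))"
    by (rule Cons.IH) (use Cons.prems Q(2) in \<open>auto simp: ae_disjoint_def\<close>)
  have "negligible (region \<Sigma> C \<inter> region \<Sigma> C')" if C: "C \<in> set Q1" "C' \<in> set Q2" for C C'
  proof -
    obtain T' where "T' \<in> set P" "negligible (region \<Sigma> C' - region \<Sigma> T')" using p2 C(2) by blast
    moreover have "negligible (region \<Sigma> T \<inter> region \<Sigma> T')"
      using Cons.prems(2) \<open>T' \<in> set P\<close> by (simp add: ae_disjoint_def)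
    ultimately show ?thesis using p1(3)[OF C(1)] negligible_Int_trans by blast
  qed
  then show ?case using p1 p2 by (auto simp: Q(3) ae_disjoint_def sorted_wrt_append)
qed

lemma substitute_rounds_props:
  assumes "\<forall>T\<in>set P. proper T" "ae_disjoint P" "Q \<in> set_pmf (substitute_rounds \<Sigma> N P)"
  shows "ae_disjoint Q \<and> (\<forall>T\<in>set Q. proper T)"
  using assms(3)
proof (induction N arbitrary: Q)
  case 0 then show ?case using assms by simp
next
  case (Suc N)
  then obtain R where "R \<in> set_pmf (substitute_rounds \<Sigma> N P)" "Q \<in> set_pmf (substitute_patch \<Sigma> R)" by auto
  then show ?case using Suc.IH substitute_patch_props[of R Q] by blast
qed

lemma finite_substitute_tile: "finite (set_pmf (substitute_tile \<Sigma> T))"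
  using set_rule_pmf by (simp add: substitute_tile_def)

lemma finite_substitute_patch: "finite (set_pmf (substitute_patch \<Sigma> P))"
  by (induction P) (auto simp: finite_substitute_tile)

lemma finite_substitute_rounds: "finite (set_pmf (substitute_rounds \<Sigma> N P))"
  by (induction N) (auto simp: finite_substitute_patch)

section \<open>Expectations of additive functionals\<close>

definition patch_sum :: "('n \<Rightarrow> real \<Rightarrow> real) \<Rightarrow> ('d, 'n) patch \<Rightarrow> real" where
  "patch_sum W P = (\<Sum>T\<leftarrow>P. W (fst T) (tile_vol \<Sigma> T))"

text \<open>The operator dual to one round: instead of evolving the patch, it evolves the weight
  that a tile contributes in expectation.\<close>

definition step :: "('n \<Rightarrow> real \<Rightarrow> real) \<Rightarrow> 'n \<Rightarrow> real \<Rightarrow> real" where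
  "step W i x =
     (if x > 1 then \<Sum>e | e \<in> A \<and> src e = i. arc_prob e * W (tgt e) (x * arc_vol e) else W i x)"

lemma expectation_substitute_tile:
  assumes T: "proper T"
  shows "measure_pmf.expectation (substitute_tile \<Sigma> T) (patch_sum W) = step W (fst T) (tile_vol \<Sigma> T)"
proof (cases "tile_vol \<Sigma> T > 1")
  case True
  let ?i = "fst T"
  have "measure_pmf.expectation (substitute_tile \<Sigma> T) (patch_sum W) =
      measure_pmf.expectation (rule_pmf \<Sigma> ?i) (\<lambda>k. patch_sum W (apply_rule \<Sigma> k T))"
    using True by (simp add: substitute_tile_def)
  also have "\<dots> = (\<Sum>k = 1..num_rules \<Sigma> ?i. pmf (rule_pmf \<Sigma> ?i) k * patch_sum W (apply_rule \<Sigma> k T))"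
    by (subst expectation_finite) (simp_all add: set_rule_pmf)
  also have "\<dots> = (\<Sum>k = 1..num_rules \<Sigma> ?i. \<Sum>m<length (rule \<Sigma> ?i k).
      arc_prob (?i, k, m) * W (tgt (?i, k, m)) (tile_vol \<Sigma> T * arc_vol (?i, k, m)))"
  proof (rule sum.cong)
    fix k assume k: "k \<in> {1..num_rules \<Sigma> ?i}"
    have "patch_sum W (apply_rule \<Sigma> k T) =
        (\<Sum>m<length (rule \<Sigma> ?i k). W (tgt (?i, k, m)) (tile_vol \<Sigma> T * arc_vol (?i, k, m)))"
      unfolding patch_sum_def sum_list_sum_nth
      by (rule sum.cong) (auto simp: length_apply_rule apply_rule_type[OF T k] apply_rule_vol[OF T k])
    then show "pmf (rule_pmf \<Sigma> ?i) k * patch_sum W (apply_rule \<Sigma> k T) = (\<Sum>m<length (rule \<Sigma> ?i k).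
      arc_prob (?i, k, m) * W (tgt (?i, k, m)) (tile_vol \<Sigma> T * arc_vol (?i, k, m)))"
      by (simp add: arc_prob_def sum_distrib_left)
  qed simp
  also have "\<dots> = step W ?i (tile_vol \<Sigma> T)"
    using True by (simp only: step_def sum_arcs_from if_True)
  finally show ?thesis .
qed (simp add: substitute_tile_def step_def patch_sum_def)

lemma expectation_substitute_patch:
  assumes "\<forall>T\<in>set P. proper T"
  shows "measure_pmf.expectation (substitute_patch \<Sigma> P) (patch_sum W) = patch_sum (step W) P"
  using assms
proof (induction P)
  case Nil then show ?case by (simp add: patch_sum_def)
next
  case (Cons T P)
  let ?t = "substitute_tile \<Sigma> T" and ?p = "substitute_patch \<Sigma> P"
  define B where "B = measure_pmf.expectation ?p (patch_sum W)"
  have "measure_pmf.expectation (bind_pmf ?p (\<lambda>R. return_pmf (Q @ R))) (patch_sum W) = patch_sum W Q + B" for Q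
  proof -
    have "measure_pmf.expectation (bind_pmf ?p (\<lambda>R. return_pmf (Q @ R))) (patch_sum W) =
        (\<Sum>R\<in>set_pmf ?p. pmf ?p R * (patch_sum W Q + patch_sum W R))"
      by (subst expectation_bind_finite) (auto simp: finite_substitute_patch patch_sum_def)
    also have "\<dots> = (\<Sum>R\<in>set_pmf ?p. pmf ?p R) * patch_sum W Q + B"
      unfolding B_def expectation_finite[OF finite_substitute_patch] distrib_left sum.distrib sum_distrib_right ..
    finally show ?thesis by (simp add: sum_pmf_eq_1[OF finite_substitute_patch order_refl])
  qed
  then have "measure_pmf.expectation (substitute_patch \<Sigma> (T # P)) (patch_sum W) =
      (\<Sum>Q\<in>set_pmf ?t. pmf ?t Q * (patch_sum W Q + B))"
    unfolding substitute_patch.simps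
    by (subst expectation_bind_finite) (auto simp: finite_substitute_tile finite_substitute_patch)
  also have "\<dots> = measure_pmf.expectation ?t (patch_sum W) + (\<Sum>Q\<in>set_pmf ?t. pmf ?t Q) * B"
    unfolding expectation_finite[OF finite_substitute_tile] distrib_left sum.distrib sum_distrib_right ..
  also have "\<dots> = measure_pmf.expectation ?t (patch_sum W) + B"
    by (simp add: sum_pmf_eq_1[OF finite_substitute_tile order_refl])
  also have "\<dots> = patch_sum (step W) (T # P)"
    using Cons by (simp add: expectation_substitute_tile B_def) (simp add: patch_sum_def)
  finally show ?case .
qed

text \<open>The last round is absorbed into the weight, so the induction hypothesis is applied to
  \<open>step W\<close>.\<close>

lemma expectation_substitute_rounds:
  assumes "\<forall>T\<in>set P. proper T" "ae_disjoint P"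
  shows "measure_pmf.expectation (substitute_rounds \<Sigma> N P) (patch_sum W) = patch_sum ((step ^^ N) W) P"
proof (induction N arbitrary: W)
  case 0 then show ?case by simp
next
  case (Suc N)
  have "measure_pmf.expectation (substitute_rounds \<Sigma> (Suc N) P) (patch_sum W) =
     (\<Sum>Q\<in>set_pmf (substitute_rounds \<Sigma> N P). pmf (substitute_rounds \<Sigma> N P) Q *
        measure_pmf.expectation (substitute_patch \<Sigma> Q) (patch_sum W))"
    by (simp add: expectation_bind_finite finite_substitute_rounds finite_substitute_patch)
  also have "\<dots> = (\<Sum>Q\<in>set_pmf (substitute_rounds \<Sigma> N P). pmf (substitute_rounds \<Sigma> N P) Q * patch_sum (step W) Q)"
    using substitute_rounds_props[OF assms] by (intro sum.cong) (simp_all add: expectation_substitute_patch)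
  also have "\<dots> = patch_sum ((step ^^ N) (step W)) P"
    by (simp flip: Suc.IH add: expectation_finite finite_substitute_rounds)
  finally show ?case by (simp add: funpow_swap1)
qed

text \<open>Logarithmic volumes and the weight \<open>exp (- u)\<close> turn the substitution operator into the renewal
  operator, because \<open>arc_prob e * arc_vol e\<close> sums to 1 over the arcs leaving a type.\<close>

lemma funpow_step_eq_it:
  "exp (- u) * (step ^^ N) W i (exp u) = it N (\<lambda>i u. exp (- u) * W i (exp u)) i u"
proof (induction N arbitrary: i u)
  case (Suc N)
  show ?case
  proof (cases "u \<le> 0")
    case True
    have "(step ^^ N) W i (exp u) = W i (exp u)" for N
      using True by (induction N) (auto simp: step_def)
    from this[of "Suc N"] show ?thesis using True by (simp del: funpow.simps)
  next
    case False
    \<comment> \<open>The factor \<open>arc_vol e\<close> comes from the normalization: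
      \<open>exp (- u)\<close> equals \<open>arc_vol e\<close> times
      \<open>exp (- (u - arc_length \<Sigma> e))\<close>.\<close>
    have eq: "exp (- u) * (arc_prob e * (step ^^ N) W (tgt e) (exp u * arc_vol e)) =
        arc_prob e * arc_vol e * it N (\<lambda>i u. exp (- u) * W i (exp u)) (tgt e) (u - arc_length \<Sigma> e)"
      if "e \<in> A" for e
    proof -
      have "exp (u - arc_length \<Sigma> e) = exp u * arc_vol e"
        using arc_vol_bounds[OF that] by (simp add: arc_length_eq exp_add)
      then show ?thesis
        using arc_vol_bounds[OF that] unfolding Suc.IH[symmetric]
        by (simp add: exp_minus exp_diff field_simps arc_length_eq)
    qed
    have "exp (- u) * (step ^^ Suc N) W i (exp u) =
        (\<Sum>e | e \<in> A \<and> src e = i. exp (- u) * (arc_prob e * (step ^^ N) W (tgt e) (exp u * arc_vol e)))"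
      using False by (simp add: step_def sum_distrib_left)
    also have "\<dots> = (\<Sum>e | e \<in> A \<and> src e = i. arc_prob e * arc_vol e *
        it N (\<lambda>i u. exp (- u) * W i (exp u)) (tgt e) (u - arc_length \<Sigma> e))"
      by (rule sum.cong) (auto simp: eq)
    finally show ?thesis using False by simp
  qed
qed simp

lemma substitute_patch_finished:
  "\<forall>T\<in>set P. tile_vol \<Sigma> T \<le> 1 \<Longrightarrow> substitute_patch \<Sigma> P = return_pmf P"
  by (induction P) (simp_all add: substitute_tile_def bind_return_pmf)

lemma substitute_rounds_finished:
  assumes "finished_after \<Sigma> N P" "N \<le> N'"
  shows "substitute_rounds \<Sigma> N' P = substitute_rounds \<Sigma> N P"
  using assms(2)
proof (induction N' rule: dec_induct)
  case (step N')
  have "bind_pmf (substitute_rounds \<Sigma> N P) (substitute_patch \<Sigma>) = bind_pmf (substitute_rounds \<Sigma> N P) return_pmf"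
    using assms(1) by (intro bind_pmf_cong refl substitute_patch_finished) (auto simp: finished_after_def)
  then show ?case using step.IH by (simp add: bind_return_pmf')
qed simp

lemma legal_inflate:
  assumes S: "legal_tile \<Sigma> S"
  shows "proper S" "proper (inflate (exp t) S)"
    "tile_vol \<Sigma> (inflate (exp t) S) = exp (real CARD('d) * t) * tile_vol \<Sigma> S"
proof -
  obtain c g where c: "c > 0" "isometric_map g" "snd S = (\<lambda>x. g (c *\<^sub>R x))"
    using S by (auto simp: legal_tile_def)
  have s: "similarity_map c (snd S)" using isometric_scale[OF c(2,1)] c(3) by simp
  have s': "similarity_map (exp t * c) (snd (inflate (exp t) S))"
    using similarity_comp[OF similarity_scale[of "exp t"] s] by (simp add: inflate_def)
  show "proper S" "proper (inflate (exp t) S)"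
    unfolding proper_def using s s' c(1) by (auto intro: exI[of _ "exp t * c"])
  show "tile_vol \<Sigma> (inflate (exp t) S) = exp (real CARD('d) * t) * tile_vol \<Sigma> S"
    using tile_vol_eq[OF c(1) s] tile_vol_eq[OF _ s'] c(1)
    by (simp add: power_mult_distrib exp_of_nat_mult)
qed

text \<open>A common number of rounds is chosen, large enough both to finish the substitution and
  for the iterates of the renewal equation to become stationary at the given volume.\<close>

lemma expectation_semiflow:
  assumes S: "legal_tile \<Sigma> S"
  defines "V \<equiv> \<lambda>t. tile_vol \<Sigma> (inflate (exp t) S)"
  shows "measure_pmf.expectation (semiflow \<Sigma> t S) (patch_sum W) / V t =
    sol (\<lambda>i u. exp (- u) * W i (exp u)) (fst S) (ln (V t))"
proof -
  let ?P = "[inflate (exp t) S]"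
  define N0 where "N0 = (LEAST N. finished_after \<Sigma> N ?P)"
  have fin: "finished_after \<Sigma> N0 ?P"
    unfolding N0_def by (rule LeastI_ex) (rule ex_finished_after[OF rss S])
  obtain N1 :: nat where "real N1 > ln (V t) / lmin" using reals_Archimedean2 by blast
  then have N1: "ln (V t) \<le> real N1 * lmin" using lmin(1) by (simp add: field_simps)
  define N where "N = max N0 N1"
  have "real N1 * lmin \<le> real N * lmin" using lmin(1) by (simp add: N_def)
  with N1 have N: "ln (V t) \<le> real N * lmin" by linarith
  have Vpos: "V t > 0" unfolding V_def by (rule proper_vol_pos) (rule legal_inflate[OF S])
  have "semiflow \<Sigma> t S = substitute_rounds \<Sigma> N ?P"
    unfolding semiflow_def Let_def N0_def[symmetric]
    by (rule substitute_rounds_finished[OF fin, symmetric]) (simp add: N_def)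
  then have "measure_pmf.expectation (semiflow \<Sigma> t S) (patch_sum W) = (step ^^ N) W (fst S) (V t)"
    using expectation_substitute_rounds[of ?P N W] legal_inflate(2)[OF S]
    by (simp add: ae_disjoint_def patch_sum_def V_def inflate_def)
  moreover have "(step ^^ N) W (fst S) (V t) / V t = sol (\<lambda>i u. exp (- u) * W i (exp u)) (fst S) (ln (V t))"
    using funpow_step_eq_it[of "ln (V t)" N W "fst S"] sol_eq_it[OF N] Vpos
    by (simp add: exp_minus field_simps)
  ultimately show ?thesis by simp
qed

lemma num_tiles_eq: "num_tiles \<Sigma> r I = patch_sum (\<lambda>j x. if j = r \<and> x \<in> I then 1 else 0)"
proof
  fix P show "num_tiles \<Sigma> r I P = patch_sum (\<lambda>j x. if j = r \<and> x \<in> I then 1 else 0) P"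
    by (induction P) (auto simp: num_tiles_def tiles_in_def patch_sum_def)
qed

lemma vol_tiles_eq:
  assumes P: "ae_disjoint P" "\<forall>T\<in>set P. proper T"
  shows "vol_tiles \<Sigma> r I P = patch_sum (\<lambda>j x. if j = r \<and> x \<in> I then x else 0) P"
proof -
  let ?Q = "tiles_in \<Sigma> r I P"
  have "vol_tiles \<Sigma> r I P = measure lebesgue (\<Union>(set (map (region \<Sigma>) ?Q)))"
    by (simp add: vol_tiles_def)
  also have "\<dots> = (\<Sum>B\<leftarrow>map (region \<Sigma>) ?Q. measure lebesgue B)"
  proof (rule measure_Union_negligible)
    show "sorted_wrt (\<lambda>A B. negligible (A \<inter> B)) (map (region \<Sigma>) ?Q)"
      using P(1) unfolding ae_disjoint_def tiles_in_def sorted_wrt_map by (rule sorted_wrt_filter)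
  qed (use P(2) proper_measurable in \<open>auto simp: tiles_in_def\<close>)
  also have "\<dots> = (\<Sum>T\<leftarrow>P. if fst T = r \<and> tile_vol \<Sigma> T \<in> I then tile_vol \<Sigma> T else 0)"
    by (simp add: tiles_in_def sum_list_map_filter' tile_vol_def o_def cong: if_cong)
  finally show ?thesis by (simp add: patch_sum_def)
qed

lemma expectation_vol_tiles:
  assumes S: "legal_tile \<Sigma> S"
  shows "measure_pmf.expectation (semiflow \<Sigma> t S) (vol_tiles \<Sigma> r I) =
    measure_pmf.expectation (semiflow \<Sigma> t S) (patch_sum (\<lambda>j x. if j = r \<and> x \<in> I then x else 0))"
proof (rule integral_cong_AE)
  show "AE P in measure_pmf (semiflow \<Sigma> t S). vol_tiles \<Sigma> r I P = patch_sum (\<lambda>j x. if j = r \<and> x \<in> I then x else 0) P"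
    unfolding AE_measure_pmf_iff
  proof
    fix P assume "P \<in> set_pmf (semiflow \<Sigma> t S)"
    then have "ae_disjoint P \<and> (\<forall>T\<in>set P. proper T)"
      unfolding semiflow_def Let_def
      by (rule substitute_rounds_props[rotated 2]) (use legal_inflate[OF S] in \<open>auto simp: ae_disjoint_def\<close>)
    then show "vol_tiles \<Sigma> r I P = patch_sum (\<lambda>j x. if j = r \<and> x \<in> I then x else 0) P"
      by (intro vol_tiles_eq) auto
  qed
qed auto

end

section \<open>Densities\<close>

text \<open>The substitution \<open>x = exp u\<close> takes the datum window of an arc of volume
  \<epsilon> to the range of volumes in the density matrices. The strict inequality at \<epsilon> on
  one side and the closed window on the other differ by a null set.\<close>

lemma integral_exp_substitution:
  fixes \<phi> :: "real \<Rightarrow> real"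
  assumes \<epsilon>: "0 < \<epsilon>" "\<epsilon> < 1" and ab: "0 \<le> a" "a \<le> b" "b \<le> 1" and \<phi>: "continuous_on {\<epsilon>..1} \<phi>"
  shows "((\<lambda>x. if \<epsilon> < x \<and> x \<le> 1 then \<phi> x else 0) has_integral
    integral ({ln \<epsilon>..0} \<inter> {x. a \<le> exp x \<and> exp x \<le> b}) (\<lambda>x. exp x * \<phi> (exp x))) {a..b}"
proof (cases "\<epsilon> < b")
  case False
  have "{ln \<epsilon>..0} \<inter> {x. a \<le> exp x \<and> exp x \<le> b} \<subseteq> {ln \<epsilon>}"
  proof
    fix x assume x: "x \<in> {ln \<epsilon>..0} \<inter> {x. a \<le> exp x \<and> exp x \<le> b}"
    then have "exp x \<le> exp (ln \<epsilon>)" using False \<epsilon> by auto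
    then show "x \<in> {ln \<epsilon>}" using x by auto
  qed
  then have "negligible ({ln \<epsilon>..0} \<inter> {x. a \<le> exp x \<and> exp x \<le> b})"
    by (rule negligible_subset[OF negligible_sing])
  then have "integral ({ln \<epsilon>..0} \<inter> {x. a \<le> exp x \<and> exp x \<le> b}) (\<lambda>x. exp x * \<phi> (exp x)) = 0"
    by (intro integral_unique has_integral_negligible) auto
  then show ?thesis using False by (auto intro!: has_integral_is_0)
next
  case True
  \<comment> \<open>The maximum with \<epsilon> keeps the lower limit positive, so that its
    logarithm makes sense also for \<open>a = 0\<close>.\<close>
  define c where "c = max a \<epsilon>"
  have c: "0 < c" "c \<le> b" "\<epsilon> \<le> c" "a \<le> c" using \<epsilon> ab True by (auto simp: c_def)
  have "{ln \<epsilon>..0} \<inter> {x. a \<le> exp x \<and> exp x \<le> b} = {ln c..ln b}"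
  proof -
    have "ln \<epsilon> \<le> x \<and> x \<le> 0 \<and> a \<le> exp x \<and> exp x \<le> b \<longleftrightarrow> ln c \<le> x \<and> x \<le> ln b" for x
    proof -
      have "ln c \<le> x \<longleftrightarrow> c \<le> exp x" "ln \<epsilon> \<le> x \<longleftrightarrow> \<epsilon> \<le> exp x" "x \<le> ln b \<longleftrightarrow> exp x \<le> b"
        using c \<epsilon> True exp_le_cancel_iff[of "ln c" x] exp_le_cancel_iff[of "ln \<epsilon>" x] exp_le_cancel_iff[of x "ln b"]
        by auto
      moreover have "x \<le> 0 \<longleftrightarrow> exp x \<le> 1" by simp
      moreover have "c \<le> exp x \<longleftrightarrow> a \<le> exp x \<and> \<epsilon> \<le> exp x" by (simp add: c_def)
      moreover have "exp x \<le> b \<Longrightarrow> exp x \<le> 1" using ab by linarith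
      ultimately show ?thesis by blast
    qed
    then show ?thesis 
      by (intro set_eqI) (simp only: Int_iff atLeastAtMost_iff mem_Collect_eq conj_assoc)
  qed
  moreover have "((\<lambda>x. exp x * \<phi> (exp x)) has_integral integral {c..b} \<phi>) {ln c..ln b}"
  proof -
    have "((\<lambda>x. exp x *\<^sub>R \<phi> (exp x)) has_integral integral {exp (ln c)..exp (ln b)} \<phi>) {ln c..ln b}"
    proof (rule has_integral_substitution)
      show "exp ` {ln c..ln b} \<subseteq> {c..b}"
        using c exp_le_cancel_iff[of "ln c"] exp_le_cancel_iff[of _ "ln b"] by auto
      show "continuous_on {c..b} \<phi>" using \<phi> c ab by (auto elim!: continuous_on_subset)
    qed (use c in \<open>auto intro!: derivative_eq_intros simp: has_real_derivative_iff_has_vector_derivative[symmetric]\<close>)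
    then show ?thesis using c by simp
  qed
  moreover have "((\<lambda>x. if \<epsilon> < x \<and> x \<le> 1 then \<phi> x else 0) has_integral integral {c..b} \<phi>) {a..b}"
  proof -
    have "\<phi> integrable_on {c..b}"
      using \<phi> c ab by (intro integrable_continuous_real) (auto elim!: continuous_on_subset)
    then have "(\<phi> has_integral integral {c..b} \<phi>) {c..b}" by (rule integrable_integral)
    then have "((\<lambda>x. if x \<in> {c..b} then \<phi> x else 0) has_integral integral {c..b} \<phi>) {a..b}"
      using has_integral_restrict[of "{c..b}" "{a..b}" \<phi>] c by auto
    then show ?thesis
      by (rule has_integral_spike[of "{\<epsilon>}", rotated 2]) (use ab in \<open>auto simp: c_def\<close>)
  qed
  ultimately show ?thesis by (simp add: integral_unique)
qed

lemma exp_minus_lipschitz: "(exp L)-lipschitz_on {- L..0} (\<lambda>x::real. exp (- x))"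
proof (rule bounded_derivative_imp_lipschitz)
  fix x assume x: "x \<in> {- L..0}"
  show "((\<lambda>x. exp (- x)) has_derivative (\<lambda>h. - exp (- x) * h)) (at x within {- L..0})"
    by (auto intro!: derivative_eq_intros)
  show "onorm (\<lambda>h. - exp (- x) * h) \<le> exp L"
    by (rule onorm_le) (use x in \<open>auto simp: abs_mult intro!: mult_right_mono\<close>)
qed auto

section \<open>From matrices and graphs to the renewal setting\<close>

context normalized_rss
begin

lemma V_mat_nonneg: "V_mat \<Sigma> $ i $ j \<ge> 0"
  unfolding V_mat_def weighted_matrix_eq
  by (rule sum_nonneg) (auto intro!: mult_nonneg_nonneg less_imp_le[OF arc_prob_pos] less_imp_le[OF arc_vol_bounds(1)])

lemma V_mat_row_sum: "(\<Sum>j\<in>UNIV. V_mat \<Sigma> $ i $ j) = 1"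
proof -
  have "(\<Sum>j\<in>UNIV. V_mat \<Sigma> $ i $ j) =
      (\<Sum>e | e \<in> A \<and> src e = i. \<Sum>j\<in>UNIV. if tgt e = j then arc_prob e * arc_vol e else 0)"
    unfolding V_mat_def weighted_matrix_eq by (rule sum.swap)
  then show ?thesis using q_sum[of i] by simp
qed

text \<open>The matrix is stochastic: the constant vector attains the eigenvalue 1, and at an entry
  of maximal modulus an eigenvector shows that no eigenvalue has modulus above 1.\<close>

lemma perron_frobenius_V_mat: "perron_frobenius_eigenvalue (V_mat \<Sigma>) = 1"
  unfolding perron_frobenius_eigenvalue_def
proof (rule cSup_eq_maximum)
  let ?V = "\<chi> i j. complex_of_real (V_mat \<Sigma> $ i $ j)"
  have "?V *v 1 = 1 *s 1"
    by (simp add: vec_eq_iff matrix_vector_mult_def V_mat_row_sum flip: of_real_sum)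
  moreover have "(1 :: complex^'n) \<noteq> 0" by (simp add: vec_eq_iff)
  ultimately show "1 \<in> {cmod z |z. \<exists>w::complex^'n. w \<noteq> 0 \<and> ?V *v w = z *s w}"
    by (auto intro!: exI[of _ 1])
  fix x assume "x \<in> {cmod z |z. \<exists>w::complex^'n. w \<noteq> 0 \<and> ?V *v w = z *s w}"
  then obtain z w where zw: "x = cmod z" "w \<noteq> 0" "?V *v w = z *s w" by blast
  define M where "M = Max (range (\<lambda>i. cmod (w $ i)))"
  have M: "cmod (w $ i) \<le> M" for i by (simp add: M_def)
  have "M \<in> range (\<lambda>i. cmod (w $ i))" unfolding M_def by (rule Max_in) auto
  then obtain i where i: "M = cmod (w $ i)" by blast
  obtain k where "w $ k \<noteq> 0" using zw(2) by (auto simp: vec_eq_iff)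
  then have "M > 0" using M[of k] by (meson less_le_trans zero_less_norm_iff)
  have "cmod z * M = cmod ((?V *v w) $ i)" by (simp add: zw(3) norm_mult i)
  also have "\<dots> \<le> (\<Sum>j\<in>UNIV. cmod (V_mat \<Sigma> $ i $ j * w $ j))"
    unfolding matrix_vector_mult_def by (simp add: norm_sum)
  also have "\<dots> \<le> (\<Sum>j\<in>UNIV. V_mat \<Sigma> $ i $ j * M)"
    by (rule sum_mono) (use M V_mat_nonneg in \<open>auto simp: norm_mult intro!: mult_left_mono\<close>)
  also have "\<dots> = 1 * M" by (simp add: V_mat_row_sum flip: sum_distrib_right)
  finally show "x \<le> 1" using \<open>M > 0\<close> zw(1) by simp
qed

lemma invariant_left_eigenvector:
  assumes "left_perron_frobenius_eigenvector (V_mat \<Sigma>) v"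
  shows "invariant (\<lambda>i. v $ i)"
  unfolding invariant_def
proof
  fix j
  have "v v* V_mat \<Sigma> = v"
    using assms by (simp add: left_perron_frobenius_eigenvector_def perron_frobenius_V_mat)
  then have "v $ j = (v v* V_mat \<Sigma>) $ j" by simp
  also have "\<dots> = (\<Sum>e\<in>A. if tgt e = j then v $ src e * (arc_prob e * arc_vol e) else 0)"
    unfolding V_mat_def vector_weighted_matrix by (rule sum.cong) auto
  also have "\<dots> = (\<Sum>e | e \<in> A \<and> tgt e = j. v $ src e * (arc_prob e * arc_vol e))"
    by (rule sum.inter_filter[OF finite_arcs, symmetric])
  finally show "(\<Sum>e | e \<in> A \<and> tgt e = j. v $ src e * (arc_prob e * arc_vol e)) = v $ j" by simp
qed

lemma cas_path:
  "set p \<subseteq> A \<Longrightarrow> pre_digraph.cas (assoc_graph \<Sigma>) u p w \<Longrightarrow> path u (length p) (path_length \<Sigma> p) w"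
proof (induction p arbitrary: u)
  case Nil
  then show ?case by (simp add: pre_digraph.cas.simps path_length_def path.Nil)
next
  case (Cons e p)
  then have "src e = u" "path (tgt e) (length p) (path_length \<Sigma> p) w"
    by (auto simp: pre_digraph.cas.simps)
  then show ?case using path.Cons[of e "length p" "path_length \<Sigma> p" w] Cons.prems(1)
    by (auto simp: path_length_def)
qed

lemma closed_path_pos:
  assumes "closed_path \<Sigma> p"
  obtains u where "path u (length p) (path_length \<Sigma> p) u" "path_length \<Sigma> p > 0"
proof -
  obtain u where u: "pre_digraph.awalk (assoc_graph \<Sigma>) u p u" and "p \<noteq> []"
    using assms by (auto simp: closed_path_def)
  then have path: "path u (length p) (path_length \<Sigma> p) u"
    by (intro cas_path) (auto simp: pre_digraph.awalk_def)
  moreover have "path_length \<Sigma> p > 0"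
  proof -
    have "0 < real (length p) * lmin" using lmin(1) \<open>p \<noteq> []\<close> by simp
    then show ?thesis using path_length_ge[OF path] by linarith
  qed
  ultimately show ?thesis by (rule that)
qed

lemma nonlattice_renewalI:
  assumes irr: "irreducible_system \<Sigma>" and inc: "incommensurable \<Sigma>"
  shows "nonlattice_renewal A src tgt (\<lambda>e. arc_prob e * arc_vol e) (arc_length \<Sigma>)"
proof
  show "\<exists>n s. path i n s j" for i j
  proof -
    have "(i, j) \<in> rtrancl_on (verts (assoc_graph \<Sigma>)) (arcs_ends (assoc_graph \<Sigma>))"
      using irr by (simp add: irreducible_system_def strongly_connected_def reachable_def assoc_graph_def)
    then show ?thesis
    proof (induction rule: rtrancl_on_induct)
      case base
      then show ?case using path.Nil by blast
    next
      case (step y z)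
      then obtain e where e: "e \<in> A" "src e = y" "tgt e = z" by (auto simp: arcs_ends_conv)
      obtain n s where "path i n s y" using step by blast
      then show ?case using path_trans path.Cons[OF e(1) path.Nil] e by metis
    qed
  qed
  obtain p q where pq: "closed_path \<Sigma> p" "closed_path \<Sigma> q"
    "path_length \<Sigma> p \<notin> {path_length \<Sigma> q * x | x. x \<in> \<rat>}"
    using inc by (auto simp: incommensurable_def)
  obtain u where u: "path u (length p) (path_length \<Sigma> p) u" "path_length \<Sigma> p > 0"
    using closed_path_pos[OF pq(1)] .
  obtain w where w: "path w (length q) (path_length \<Sigma> q) w" "path_length \<Sigma> q > 0"
    using closed_path_pos[OF pq(2)] .
  have "path_length \<Sigma> p = path_length \<Sigma> q * (path_length \<Sigma> p / path_length \<Sigma> q)" using w by simp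
  then have "path_length \<Sigma> p / path_length \<Sigma> q \<notin> \<rat>" using pq(3) by blast
  then show "\<exists>i j m n \<alpha> \<beta>. path i m \<alpha> i \<and> path j n \<beta> j \<and> \<alpha> > 0 \<and> \<beta> > 0 \<and> \<alpha> / \<beta> \<notin> \<rat>"
    using u w by blast
qed

lemma semiflow_deterministic:
  assumes "\<forall>i. num_rules \<Sigma> i = 1"
  shows "\<exists>Q. semiflow \<Sigma> t S = return_pmf Q"
proof -
  have "rule_pmf \<Sigma> i = return_pmf 1" for i
    using set_rule_pmf[of i] assms by (simp add: set_pmf_subset_singleton[symmetric])
  then have "\<exists>Q. substitute_tile \<Sigma> T = return_pmf Q" for T
    by (auto simp: substitute_tile_def)
  then have tile: "\<exists>Q. substitute_patch \<Sigma> P = return_pmf Q" for P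
  proof (induction P)
    case (Cons T P)
    then show ?case by (metis bind_return_pmf substitute_patch.simps(2))
  qed simp
  have "\<exists>Q. substitute_rounds \<Sigma> N P = return_pmf Q" for N P
  proof (induction N)
    case (Suc N)
    then show ?case using tile by (metis bind_return_pmf substitute_rounds.simps(2))
  qed simp
  then show ?thesis by (simp add: semiflow_def Let_def)
qed

end

section \<open>Limits for the semi-flow\<close>

locale ergodic_rss = normalized_rss \<Sigma> for \<Sigma> :: "('d::{finite,wellorder}, 'n::finite) rss" +
  assumes irreducible: "irreducible_system \<Sigma>" and incommensurable: "incommensurable \<Sigma>"
begin

sublocale nonlattice_renewal A src tgt "\<lambda>e. arc_prob e * arc_vol e" "arc_length \<Sigma>"
  by (rule nonlattice_renewalI[OF irreducible incommensurable])

text \<open>The logarithm of the inflated volume is \<open>ln (tile_vol \<Sigma> S) + d t\<close>,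
  which tends to infinity, so type and size of \<open>S\<close> disappear in the limit. The limit
  enters through an equation for \<open>c\<close>, which leaves only an integral over each arc to be
  computed in applications.\<close>

lemma expectation_patch_sum_tendsto:
  assumes S: "legal_tile \<Sigma> S" and v: "left_perron_frobenius_eigenvector (V_mat \<Sigma>) v"
    and J: "is_interval J" and w: "continuous_on UNIV w"
    and nonneg: "\<And>x. 0 \<le> w x" and lip: "K-lipschitz_on {- lmax..0} w"
    and W: "\<And>j x. exp (- x) * W j (exp x) = (if j = r \<and> x \<in> J then w x else 0)"
    and c: "(\<Sum>e\<in>A. v $ src e * (arc_prob e * arc_vol e) *
        (if tgt e = r then integral ({ln (arc_vol e)..0} \<inter> J) w else 0)) / (v \<bullet> (H_mat \<Sigma> *v 1)) = c"
  shows "((\<lambda>t. measure_pmf.expectation (semiflow \<Sigma> t S) (patch_sum W) / tile_vol \<Sigma> (inflate (exp t) S))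
    \<longlongrightarrow> c) at_top"
proof -
  have inv: "invariant (\<lambda>i. v $ i)" by (rule invariant_left_eigenvector[OF v])
  obtain k where "v $ k \<noteq> 0"
    using v by (auto simp: left_perron_frobenius_eigenvector_def vec_eq_iff)
  then have nz: "mean_length (\<lambda>i. v $ i) \<noteq> 0" by (rule mean_length_nonzero[OF inv])
  let ?f = "sol (\<lambda>i u. exp (- u) * W i (exp u))"
  have "(?f (fst S) \<longlongrightarrow> (\<Sum>e\<in>A. v $ src e * (arc_prob e * arc_vol e) *
        (if tgt e = r then integral ({- arc_length \<Sigma> e..0} \<inter> J) w else 0)) / mean_length (\<lambda>i. v $ i)) at_top"
    by (rule renewal_theorem[OF inv nz solves_sol J w nonneg lip]) (simp add: sol_init W)
  then have lim: "(?f (fst S) \<longlongrightarrow> c) at_top"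
    unfolding c[symmetric] inner_H_mat by (simp only: arc_length_eq minus_minus)
  have pos: "tile_vol \<Sigma> S > 0" by (rule proper_vol_pos[OF legal_inflate(1)[OF S]])
  have "ln (tile_vol \<Sigma> (inflate (exp t) S)) = ln (tile_vol \<Sigma> S) + real CARD('d) * t" for t
    unfolding legal_inflate(3)[OF S] using pos by (simp add: ln_mult)
  moreover have "filterlim (\<lambda>t. ln (tile_vol \<Sigma> S) + real CARD('d) * t) at_top at_top"
    by (intro filterlim_tendsto_add_at_top[OF tendsto_const]
        filterlim_tendsto_pos_mult_at_top[OF tendsto_const] filterlim_ident) simp
  ultimately have "filterlim (\<lambda>t. ln (tile_vol \<Sigma> (inflate (exp t) S))) at_top at_top" by simp
  from filterlim_compose[OF lim this] show ?thesis
    by (simp add: expectation_semiflow[OF S])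
qed

lemma vol_interval: "is_interval {x. exp x \<in> {a..b::real}}"
  unfolding is_interval_1 by (auto intro: order_trans[of a "exp _"] order_trans[of "exp _" "exp _" b])

text \<open>Expectations are divided by volume, so a tile of logarithmic volume \<open>x\<close>
  contributes \<open>exp (- x)\<close> to the normalized number and 1 to the normalized volume.
  These are the two choices of \<open>w\<close>.\<close>

theorem density_limits:
  assumes S: "legal_tile \<Sigma> S" and ab: "0 \<le> a" "a \<le> b" "b \<le> 1"
    and v: "left_perron_frobenius_eigenvector (V_mat \<Sigma>) v"
  shows "((\<lambda>t. measure_pmf.expectation (semiflow \<Sigma> t S) (num_tiles \<Sigma> r {a..b})
          / tile_vol \<Sigma> (inflate (exp t) S))
      \<longlongrightarrow> integral {a..b} (\<lambda>x. (v v* C_mat \<Sigma> x) $ r / (v \<bullet> (H_mat \<Sigma> *v 1)))) at_top"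
    and "((\<lambda>t. measure_pmf.expectation (semiflow \<Sigma> t S) (vol_tiles \<Sigma> r {a..b})
          / tile_vol \<Sigma> (inflate (exp t) S))
      \<longlongrightarrow> integral {a..b} (\<lambda>x. (v v* D_mat \<Sigma> x) $ r / (v \<bullet> (H_mat \<Sigma> *v 1)))) at_top"
    and "((\<lambda>t. measure_pmf.expectation (semiflow \<Sigma> t S) (num_tiles \<Sigma> r UNIV)
          / tile_vol \<Sigma> (inflate (exp t) S))
      \<longlongrightarrow> (v v* (S_mat \<Sigma> - V_mat \<Sigma>)) $ r / (v \<bullet> (H_mat \<Sigma> *v 1))) at_top"
    and "((\<lambda>t. measure_pmf.expectation (semiflow \<Sigma> t S) (vol_tiles \<Sigma> r UNIV)
          / tile_vol \<Sigma> (inflate (exp t) S))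
      \<longlongrightarrow> (v v* H_mat \<Sigma>) $ r / (v \<bullet> (H_mat \<Sigma> *v 1))) at_top"
proof -
  let ?J = "{x. exp x \<in> {a..b}}" and ?L = "v \<bullet> (H_mat \<Sigma> *v 1)"
  have cont: "continuous_on UNIV (\<lambda>x::real. exp (- x))" by (intro continuous_intros)
  have lip1: "0-lipschitz_on {- lmax..0} (\<lambda>_. 1::real)" by (rule lipschitz_on_constant)
  \<comment> \<open>Both density matrices arise from a factor \<phi>: \<open>1 / x\<^sup>2\<close>
    for numbers and \<open>1 / x\<close> for volumes. In logarithmic volume,
    \<open>exp x * \<phi> (exp x)\<close> is then \<open>exp (- x)\<close> and 1,
    respectively.\<close>
  have density: "integral {a..b} (\<lambda>x. (v v* weighted_matrix \<Sigma> (\<lambda>y. if y < x \<and> x \<le> 1 then y * \<phi> x else 0)) $ r / ?L) =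
     (\<Sum>e\<in>A. v $ src e * (arc_prob e * arc_vol e) *
        (if tgt e = r then integral ({ln (arc_vol e)..0} \<inter> ?J) (\<lambda>x. exp x * \<phi> (exp x)) else 0)) / ?L"
    if \<phi>: "\<And>\<epsilon>. \<epsilon> > 0 \<Longrightarrow> continuous_on {\<epsilon>..1} \<phi>" for \<phi> :: "real \<Rightarrow> real"
  proof (intro integral_unique has_integral_divide)
    have "((\<lambda>x. \<Sum>e\<in>A. v $ src e * (if tgt e = r then arc_prob e * (if arc_vol e < x \<and> x \<le> 1 then arc_vol e * \<phi> x else 0) else 0))
      has_integral (\<Sum>e\<in>A. v $ src e * (arc_prob e * arc_vol e) *
        (if tgt e = r then integral ({ln (arc_vol e)..0} \<inter> ?J) (\<lambda>x. exp x * \<phi> (exp x)) else 0))) {a..b}"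
    proof (rule has_integral_sum[OF finite_arcs])
      fix e assume e: "e \<in> A"
      have "((\<lambda>x. if arc_vol e < x \<and> x \<le> 1 then \<phi> x else 0) has_integral
          integral ({ln (arc_vol e)..0} \<inter> ?J) (\<lambda>x. exp x * \<phi> (exp x))) {a..b}"
        using integral_exp_substitution[OF arc_vol_bounds[OF e] ab \<phi>] arc_vol_bounds[OF e] by simp
      from has_integral_mult_right[OF this, of "v $ src e * (arc_prob e * arc_vol e)"]
      show "((\<lambda>x. v $ src e * (if tgt e = r then arc_prob e * (if arc_vol e < x \<and> x \<le> 1 then arc_vol e * \<phi> x else 0) else 0))
        has_integral v $ src e * (arc_prob e * arc_vol e) *
        (if tgt e = r then integral ({ln (arc_vol e)..0} \<inter> ?J) (\<lambda>x. exp x * \<phi> (exp x)) else 0)) {a..b}"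
        by (cases "tgt e = r") (auto simp: algebra_simps if_distrib[of "\<lambda>x. _ * x"] cong: if_cong)
    qed
    then show "((\<lambda>x. (v v* weighted_matrix \<Sigma> (\<lambda>y. if y < x \<and> x \<le> 1 then y * \<phi> x else 0)) $ r) has_integral
      (\<Sum>e\<in>A. v $ src e * (arc_prob e * arc_vol e) *
        (if tgt e = r then integral ({ln (arc_vol e)..0} \<inter> ?J) (\<lambda>x. exp x * \<phi> (exp x)) else 0))) {a..b}"
      by (simp add: vector_weighted_matrix)
  qed
  show "((\<lambda>t. measure_pmf.expectation (semiflow \<Sigma> t S) (num_tiles \<Sigma> r {a..b})
          / tile_vol \<Sigma> (inflate (exp t) S))
      \<longlongrightarrow> integral {a..b} (\<lambda>x. (v v* C_mat \<Sigma> x) $ r / ?L)) at_top"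
    unfolding num_tiles_eq
  proof (rule expectation_patch_sum_tendsto[OF S v vol_interval cont _ exp_minus_lipschitz])
    have exp: "(\<lambda>x. exp (- x)) = (\<lambda>x::real. exp x * (1 / (exp x)\<^sup>2))"
      by (rule ext) (simp add: exp_minus power2_eq_square field_simps)
    have C: "C_mat \<Sigma> x = weighted_matrix \<Sigma> (\<lambda>y. if y < x \<and> x \<le> 1 then y * (1 / x\<^sup>2) else 0)" for x
      by (simp add: C_mat_def cong: if_cong)
    show "(\<Sum>e\<in>A. v $ src e * (arc_prob e * arc_vol e) *
        (if tgt e = r then integral ({ln (arc_vol e)..0} \<inter> ?J) (\<lambda>x. exp (- x)) else 0)) / ?L =
      integral {a..b} (\<lambda>x. (v v* C_mat \<Sigma> x) $ r / ?L)"
      unfolding C exp by (rule density[symmetric]) (auto intro!: continuous_intros)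
  qed auto
  show "((\<lambda>t. measure_pmf.expectation (semiflow \<Sigma> t S) (vol_tiles \<Sigma> r {a..b})
          / tile_vol \<Sigma> (inflate (exp t) S))
      \<longlongrightarrow> integral {a..b} (\<lambda>x. (v v* D_mat \<Sigma> x) $ r / ?L)) at_top"
    unfolding expectation_vol_tiles[OF S]
  proof (rule expectation_patch_sum_tendsto[OF S v vol_interval continuous_on_const _ lip1])
    have one: "(\<lambda>_. 1) = (\<lambda>x::real. exp x * (1 / exp x))" by simp
    have D: "D_mat \<Sigma> x = weighted_matrix \<Sigma> (\<lambda>y. if y < x \<and> x \<le> 1 then y * (1 / x) else 0)" for x
      by (simp add: D_mat_def cong: if_cong)
    show "(\<Sum>e\<in>A. v $ src e * (arc_prob e * arc_vol e) *
        (if tgt e = r then integral ({ln (arc_vol e)..0} \<inter> ?J) (\<lambda>x. 1) else 0)) / ?L =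
      integral {a..b} (\<lambda>x. (v v* D_mat \<Sigma> x) $ r / ?L)"
      unfolding D one by (rule density[symmetric]) (auto intro!: continuous_intros)
  qed (auto simp: exp_minus)
  show "((\<lambda>t. measure_pmf.expectation (semiflow \<Sigma> t S) (num_tiles \<Sigma> r UNIV)
          / tile_vol \<Sigma> (inflate (exp t) S))
      \<longlongrightarrow> (v v* (S_mat \<Sigma> - V_mat \<Sigma>)) $ r / ?L) at_top"
    unfolding num_tiles_eq
  proof (rule expectation_patch_sum_tendsto[OF S v is_interval_univ cont _ exp_minus_lipschitz])
    \<comment> \<open>Multiplied by \<open>arc_vol e\<close>, this gives
      \<open>1 - arc_vol e\<close>, the contribution of an arc to
      \<open>S_mat - V_mat\<close>.\<close>
    have int: "integral {ln (arc_vol e)..0} (\<lambda>x. exp (- x)) = 1 / arc_vol e - 1" if "e \<in> A" for e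
    proof (rule integral_unique)
      have "((\<lambda>x. exp (- x)) has_integral (- exp (- 0) - (- exp (- ln (arc_vol e))))) {ln (arc_vol e)..0}"
        using arc_vol_bounds[OF that]
        by (intro fundamental_theorem_of_calculus)
           (auto intro!: derivative_eq_intros simp: has_real_derivative_iff_has_vector_derivative[symmetric])
      then show "((\<lambda>x. exp (- x)) has_integral 1 / arc_vol e - 1) {ln (arc_vol e)..0}"
        using arc_vol_bounds[OF that] by (simp add: exp_minus divide_inverse)
    qed
    have "(v v* (S_mat \<Sigma> - V_mat \<Sigma>)) $ r = (v v* S_mat \<Sigma>) $ r - (v v* V_mat \<Sigma>) $ r"
      by (simp add: vector_matrix_mult_def right_diff_distrib sum_subtractf)
    also have "\<dots> = (\<Sum>e\<in>A. v $ src e * (arc_prob e * arc_vol e) *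
        (if tgt e = r then integral ({ln (arc_vol e)..0} \<inter> UNIV) (\<lambda>x. exp (- x)) else 0))"
      unfolding S_mat_def V_mat_def vector_weighted_matrix sum_subtractf[symmetric]
      using arc_vol_bounds(1) by (intro sum.cong refl) (force simp: int field_simps)
    finally show "(\<Sum>e\<in>A. v $ src e * (arc_prob e * arc_vol e) *
        (if tgt e = r then integral ({ln (arc_vol e)..0} \<inter> UNIV) (\<lambda>x. exp (- x)) else 0)) / ?L =
      (v v* (S_mat \<Sigma> - V_mat \<Sigma>)) $ r / ?L" by simp
  qed auto
  show "((\<lambda>t. measure_pmf.expectation (semiflow \<Sigma> t S) (vol_tiles \<Sigma> r UNIV)
          / tile_vol \<Sigma> (inflate (exp t) S))
      \<longlongrightarrow> (v v* H_mat \<Sigma>) $ r / ?L) at_top"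
    unfolding expectation_vol_tiles[OF S]
  proof (rule expectation_patch_sum_tendsto[OF S v is_interval_univ continuous_on_const _ lip1])
    \<comment> \<open>Here the integral of 1 is the arc length \<open>- ln (arc_vol e)\<close>,
      which together with the weight gives the entropy term.\<close>
    have "(v v* H_mat \<Sigma>) $ r = (\<Sum>e\<in>A. v $ src e * (arc_prob e * arc_vol e) *
        (if tgt e = r then integral ({ln (arc_vol e)..0} \<inter> UNIV) (\<lambda>x. 1) else 0))"
      unfolding H_mat_def vector_weighted_matrix
      using arc_vol_bounds by (intro sum.cong refl) (force simp: algebra_simps)
    then show "(\<Sum>e\<in>A. v $ src e * (arc_prob e * arc_vol e) *
        (if tgt e = r then integral ({ln (arc_vol e)..0} \<inter> UNIV) (\<lambda>x. 1) else 0)) / ?L =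
      (v v* H_mat \<Sigma>) $ r / ?L" by simp
  qed (auto simp: exp_minus)
qed

end

theorem theorem2p3:
  fixes \<Sigma> :: "('d::{finite,wellorder}, 'n::finite) rss"
    and S :: "('d, 'n) tile" and r :: 'n and a b :: real and v :: "real^'n"
  assumes "random_substitution_system \<Sigma>"
    and "normalized \<Sigma>"
    and "irreducible_system \<Sigma>"
    and "incommensurable \<Sigma>"
    and "legal_tile \<Sigma> S"
    and "0 \<le> a" and "a \<le> b" and "b \<le> 1"
    and "left_perron_frobenius_eigenvector (V_mat \<Sigma>) v"
  shows
    "((\<lambda>t. measure_pmf.expectation (semiflow \<Sigma> t S) (num_tiles \<Sigma> r {a..b})
          / tile_vol \<Sigma> (inflate (exp t) S))
      \<longlongrightarrow> integral {a..b} (\<lambda>x. (v v* C_mat \<Sigma> x) $ r / (v \<bullet> (H_mat \<Sigma> *v 1)))) at_top \<and>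
     ((\<lambda>t. measure_pmf.expectation (semiflow \<Sigma> t S) (vol_tiles \<Sigma> r {a..b})
          / tile_vol \<Sigma> (inflate (exp t) S))
      \<longlongrightarrow> integral {a..b} (\<lambda>x. (v v* D_mat \<Sigma> x) $ r / (v \<bullet> (H_mat \<Sigma> *v 1)))) at_top \<and>
     ((\<lambda>t. measure_pmf.expectation (semiflow \<Sigma> t S) (num_tiles \<Sigma> r UNIV)
          / tile_vol \<Sigma> (inflate (exp t) S))
      \<longlongrightarrow> (v v* (S_mat \<Sigma> - V_mat \<Sigma>)) $ r / (v \<bullet> (H_mat \<Sigma> *v 1))) at_top \<and>
     ((\<lambda>t. measure_pmf.expectation (semiflow \<Sigma> t S) (vol_tiles \<Sigma> r UNIV)
          / tile_vol \<Sigma> (inflate (exp t) S))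
      \<longlongrightarrow> (v v* H_mat \<Sigma>) $ r / (v \<bullet> (H_mat \<Sigma> *v 1))) at_top \<and>
     ((\<forall>i. num_rules \<Sigma> i = 1) \<longrightarrow>
      (\<exists>P. (\<forall>t\<ge>0. semiflow \<Sigma> t S = return_pmf (P t)) \<and>
        ((\<lambda>t. num_tiles \<Sigma> r {a..b} (P t) / tile_vol \<Sigma> (inflate (exp t) S))
          \<longlongrightarrow> integral {a..b} (\<lambda>x. (v v* C_mat \<Sigma> x) $ r / (v \<bullet> (H_mat \<Sigma> *v 1)))) at_top \<and>
        ((\<lambda>t. vol_tiles \<Sigma> r {a..b} (P t) / tile_vol \<Sigma> (inflate (exp t) S))
          \<longlongrightarrow> integral {a..b} (\<lambda>x. (v v* D_mat \<Sigma> x) $ r / (v \<bullet> (H_mat \<Sigma> *v 1)))) at_top \<and>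
        ((\<lambda>t. num_tiles \<Sigma> r UNIV (P t) / tile_vol \<Sigma> (inflate (exp t) S))
          \<longlongrightarrow> (v v* (S_mat \<Sigma> - V_mat \<Sigma>)) $ r / (v \<bullet> (H_mat \<Sigma> *v 1))) at_top \<and>
        ((\<lambda>t. vol_tiles \<Sigma> r UNIV (P t) / tile_vol \<Sigma> (inflate (exp t) S))
          \<longlongrightarrow> (v v* H_mat \<Sigma>) $ r / (v \<bullet> (H_mat \<Sigma> *v 1))) at_top))"
proof -
  interpret ergodic_rss \<Sigma>
    using assms(1-4) by unfold_locales
  note lims = density_limits[OF assms(5-9), of r]
  have "\<exists>P. (\<forall>t\<ge>0. semiflow \<Sigma> t S = return_pmf (P t)) \<and>
        ((\<lambda>t. num_tiles \<Sigma> r {a..b} (P t) / tile_vol \<Sigma> (inflate (exp t) S))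
          \<longlongrightarrow> integral {a..b} (\<lambda>x. (v v* C_mat \<Sigma> x) $ r / (v \<bullet> (H_mat \<Sigma> *v 1)))) at_top \<and>
        ((\<lambda>t. vol_tiles \<Sigma> r {a..b} (P t) / tile_vol \<Sigma> (inflate (exp t) S))
          \<longlongrightarrow> integral {a..b} (\<lambda>x. (v v* D_mat \<Sigma> x) $ r / (v \<bullet> (H_mat \<Sigma> *v 1)))) at_top \<and>
        ((\<lambda>t. num_tiles \<Sigma> r UNIV (P t) / tile_vol \<Sigma> (inflate (exp t) S))
          \<longlongrightarrow> (v v* (S_mat \<Sigma> - V_mat \<Sigma>)) $ r / (v \<bullet> (H_mat \<Sigma> *v 1))) at_top \<and>
        ((\<lambda>t. vol_tiles \<Sigma> r UNIV (P t) / tile_vol \<Sigma> (inflate (exp t) S))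
          \<longlongrightarrow> (v v* H_mat \<Sigma>) $ r / (v \<bullet> (H_mat \<Sigma> *v 1))) at_top"
    if one: "\<forall>i. num_rules \<Sigma> i = 1"
  proof -
    define P where "P t = (SOME Q. semiflow \<Sigma> t S = return_pmf Q)" for t
    have P: "semiflow \<Sigma> t S = return_pmf (P t)" for t
      unfolding P_def by (rule someI_ex[OF semiflow_deterministic[OF one]])
    have "measure_pmf.expectation (semiflow \<Sigma> t S) h = h (P t)" for t and h :: "('d, 'n) patch \<Rightarrow> real"
      by (simp add: P)
    with lims P show ?thesis by (intro exI[of _ P]) simp
  qed
  with lims show ?thesis by blast
qed

end
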